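(* Let $T$ be any one of the four intervals $\left(-\frac35,-\frac13\right)$, $\left(-\frac13,-\frac1{15}\right)$, $\left(-\frac1{15},\frac15\right)$, $\left(\frac15,\frac7{15}\right)$. Let $h$ be absolutely monotone with $h^{(8)}>0$ in $(-1,1)$, and let $C\subset\mathbb{S}^{22}$ be a $T$-avoiding spherical code with $|C|=47104$. Then $$E_h(C)\ \ge\ \mathcal{E}_h(23,47104;T)=47104\left(275\,h\!\left(-\tfrac35\right)+7128\,h\!\left(-\tfrac13\right)+22275\,h\!\left(-\tfrac1{15}\right)+15400\,h\!\left(\tfrac15\right)+2025\,h\!\left(\tfrac7{15}\right)\right).$$ Equality $E_h(C)=\mathcal{E}_h(23,47104;T)$ is attained when $C$ is a spherical $7$-design with $I(C)=\{-\frac35,-\frac13,-\frac1{15},\frac15,\frac7{15}\}$ (and hence a distance-invariant code) and with distance distribution $(275,7128,22275,15400,2025)$. In particular, the code $C_{1/4}$ is $T$-avoiding universally optimal on $\mathbb{S}^{22}$.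
   Context: A spherical code is a finite set $C\subset\mathbb{S}^{n-1}$; $I(C)=\{x\cdot y: x,y\in C,\ x\ne y\}$. For $T\subset[-1,1)$, $C$ is $T$-avoiding if $I(C)\cap T=\varnothing$. A spherical $\tau$-design is a spherical code $C$ such that the average over $C$ of every polynomial in $n$ variables of total degree at most $\tau$ equals its average over $\mathbb{S}^{n-1}$ with respect to normalized surface measure. A potential is a function $h:[-1,1)\to(-\infty,+\infty)$, continuous on $[-1,1)$; it is absolutely monotone if $h^{(j)}\ge0$ for all $j\ge1$ (on $(-1,1)$). The $h$-energy is $E_h(C)=\sum_{x\neq y\in C}h(x\cdot y)$ (sum over ordered pairs). $\mathcal{E}_h(n,N;T)$ is the minimum of $E_h(C)$ over all $T$-avoiding spherical codes $C\subset\mathbb{S}^{n-1}$ with $|C|=N$. For $T$ open, a code $C\subset\mathbb{S}^{n-1}$ is $T$-avoiding universally optimal if it is $T$-avoiding and, for every absolutely monotone $h$, it minimizes $E_h$ among all $T$-avoiding codes on $\mathbb{S}^{n-1}$ of cardinality $|C|$. A code $C$ is distance invariant if for each $t\in I(C)$ the number $A_t=|\{y\in C: x\cdot y=t\}|$ does not depend on $x\in C$; its distance distribution is the tuple $(A_t)$ listed in increasing order of $t\in I(C)$. The code $C_{1/4}$: let $L\subset\mathbb{S}^{23}$ be the set of the $196560$ minimal vectors of the Leech lattice rescaled to unit length. Fix $x\in L$; $C_{1/4}$ is the set of vectors $(y-\frac14x)/\sqrt{1-\frac1{16}}$ with $y\in L$, $x\cdot y=\frac14$, regarded as a subset of the unit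 sphere $\mathbb{S}^{22}$ of $x^\perp\cong\mathbb{R}^{23}$. It is a spherical $7$-design with $47104$ points, with the inner products and distance distribution listed in the claim. *)

theory Defs
  imports "HOL-Analysis.Analysis" "HOL-Number_Theory.Cong"
begin

subsection \<open>Spherical codes\<close>

definition spherical_code :: "(real ^ 'n) set \<Rightarrow> bool" where
  "spherical_code C \<longleftrightarrow> finite C \<and> C \<subseteq> sphere 0 1"

definition inner_products :: "(real ^ 'n) set \<Rightarrow> real set" where
  "inner_products C = {x \<bullet> y | x y. x \<in> C \<and> y \<in> C \<and> x \<noteq> y}"

definition avoiding :: "real set \<Rightarrow> (real ^ 'n) set \<Rightarrow> bool" where
  "avoiding T C \<longleftrightarrow> inner_products C \<inter> T = {}"

definition distance_count :: "(real ^ 'n) set \<Rightarrow> real ^ 'n \<Rightarrow> real \<Rightarrow> nat" where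
  "distance_count C x t = card {y \<in> C. x \<bullet> y = t}"

definition distance_invariant :: "(real ^ 'n) set \<Rightarrow> bool" where
  "distance_invariant C \<longleftrightarrow>
     (\<forall>t \<in> inner_products C. \<forall>x \<in> C. \<forall>y \<in> C. distance_count C x t = distance_count C y t)"

definition has_distance_distribution :: "(real ^ 'n) set \<Rightarrow> nat list \<Rightarrow> bool" where
  "has_distance_distribution C A \<longleftrightarrow> distance_invariant C \<and>
     (\<forall>x \<in> C. map (distance_count C x) (sorted_list_of_set (inner_products C)) = A)"


subsection \<open>Spherical designs\<close>

definition polynomials_upto :: "nat \<Rightarrow> (real ^ 'n \<Rightarrow> real) set" where
  "polynomials_upto d = {p. \<exists>(M :: ('n \<Rightarrow> nat) set) c. finite M \<and>
     (\<forall>\<alpha> \<in> M. (\<Sum>i\<in>UNIV. \<alpha> i) \<le> d) \<and>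
     p = (\<lambda>x. \<Sum>\<alpha>\<in>M. c \<alpha> * (\<Prod>i\<in>UNIV. (x $ i) ^ \<alpha> i))}"

text \<open>Normalized surface measure as the cone measure: the mass of a subset \<open>A\<close> of the sphere is
  the fraction of the volume of the unit ball that is taken up by the cone over \<open>A\<close>. Here
  \<open>sgn x = x /\<^sub>R norm x\<close>; the value \<open>sgn 0 = 0\<close> only matters on a null set.\<close>

definition sphere_measure :: "(real ^ 'n) measure" where
  "sphere_measure = distr (uniform_measure lborel (ball 0 1)) borel sgn"

definition spherical_design :: "nat \<Rightarrow> (real ^ 'n) set \<Rightarrow> bool" where
  "spherical_design \<tau> C \<longleftrightarrow> spherical_code C \<and>
     (\<forall>p \<in> polynomials_upto \<tau>.
        (\<Sum>x\<in>C. p x) / real (card C) = integral\<^sup>L sphere_measure p)"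


subsection \<open>Potentials and energy\<close>

text \<open>Only the values of a potential on \<open>{-1..<1}\<close> are ever used. The derivatives in
  \<open>absolutely_monotone\<close> are taken at points of the open interval, so they do not depend on the
  values elsewhere either.\<close>

definition potential :: "(real \<Rightarrow> real) \<Rightarrow> bool" where
  "potential h \<longleftrightarrow> continuous_on {-1..<1} h"

definition absolutely_monotone :: "(real \<Rightarrow> real) \<Rightarrow> bool" where
  "absolutely_monotone h \<longleftrightarrow> potential h \<and>
     (\<forall>j. \<forall>t \<in> {-1<..<1}. (deriv ^^ j) h field_differentiable (at t)) \<and>
     (\<forall>j \<ge> 1. \<forall>t \<in> {-1<..<1}. (deriv ^^ j) h t \<ge> 0)"

definition energy :: "(real \<Rightarrow> real) \<Rightarrow> (real ^ 'n) set \<Rightarrow> real" where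
  "energy h C = (\<Sum>(x, y) \<in> {(x, y). x \<in> C \<and> y \<in> C \<and> x \<noteq> y}. h (x \<bullet> y))"

text \<open>The type argument carries the dimension \<open>n = CARD('n)\<close>. The definite description behind
  \<open>LEAST\<close> is the minimum whenever the minimum exists, and is unspecified otherwise.\<close>

definition min_energy :: "(real \<Rightarrow> real) \<Rightarrow> 'n::finite itself \<Rightarrow> nat \<Rightarrow> real set \<Rightarrow> real" where
  "min_energy h (_ :: 'n::finite itself) N T =
     (LEAST e. \<exists>C :: (real ^ 'n) set.
        spherical_code C \<and> avoiding T C \<and> card C = N \<and> e = energy h C)"

definition avoiding_universally_optimal :: "real set \<Rightarrow> (real ^ 'n) set \<Rightarrow> bool" where
  "avoiding_universally_optimal T C \<longleftrightarrow> spherical_code C \<and> avoiding T C \<and>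
     (\<forall>h. absolutely_monotone h \<longrightarrow>
        (\<forall>D :: (real ^ 'n) set. spherical_code D \<and> avoiding T D \<and> card D = card C \<longrightarrow>
           energy h C \<le> energy h D))"


subsection \<open>The Leech lattice and the code \<open>C\<^sub>1\<^sub>/\<^sub>4\<close>\<close>

text \<open>The 24 coordinates are indexed by the projective line over the field with 23 elements: the
  numeral type \<open>23\<close> carries arithmetic modulo 23, and \<open>None\<close> is the point at infinity.
  The extended binary Golay code is the extended quadratic residue code. Words are identified with
  their supports, and the code is spanned over the two-element field by the full set (for \<open>None\<close>)
  and the translates of the nonzero squares, each extended by the point at infinity.\<close>

definition golay_generator :: "23 option \<Rightarrow> 23 option set" where
  "golay_generator i = (case i of
       None \<Rightarrow> UNIV
     | Some a \<Rightarrow> insert None {Some (a + b ^ 2) | b. b \<noteq> 0})"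

definition golay_code :: "23 option set set" where
  "golay_code = {{j. odd (card {i \<in> I. j \<in> golay_generator i})} | I. True}"

definition leech_lattice :: "(real ^ (23 option)) set" where
  "leech_lattice = {(1 / sqrt 8) *\<^sub>R (\<chi> i. real_of_int (a i)) | a :: 23 option \<Rightarrow> int. \<exists>m.
     (\<forall>i. [a i = m] (mod 2)) \<and>
     [(\<Sum>i\<in>UNIV. a i) = 4 * m] (mod 8) \<and>
     (\<forall>k. {i. [a i = k] (mod 4)} \<in> golay_code)}"

definition minimal_vectors :: "(real ^ 'n) set \<Rightarrow> (real ^ 'n) set" where
  "minimal_vectors \<Lambda> = {v \<in> \<Lambda> - {0}. \<forall>w \<in> \<Lambda> - {0}. norm v \<le> norm w}"

definition leech_code :: "(real ^ (23 option)) set" where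
  "leech_code = (\<lambda>v. v /\<^sub>R norm v) ` minimal_vectors leech_lattice"

text \<open>A subset of the unit sphere of the hyperplane orthogonal to \<open>x\<close>.\<close>

definition C_quarter :: "real ^ (23 option) \<Rightarrow> (real ^ (23 option)) set" where
  "C_quarter x = {(1 / sqrt (1 - 1 / 16)) *\<^sub>R (y - (1 / 4) *\<^sub>R x) | y.
     y \<in> leech_code \<and> x \<bullet> y = 1 / 4}"

text \<open>\<open>f\<close> identifies the hyperplane orthogonal to \<open>x\<close> isometrically with \<open>\<real>\<^sup>2\<^sup>3\<close>;
  its values off that hyperplane play no role.\<close>

definition hyperplane_isometry ::
    "real ^ (23 option) \<Rightarrow> (real ^ (23 option) \<Rightarrow> real ^ 23) \<Rightarrow> bool" where
  "hyperplane_isometry x f \<longleftrightarrow> linear f \<and> (\<forall>v. x \<bullet> v = 0 \<longrightarrow> norm (f v) = norm v)"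

end

theory Submission
  imports Defs
begin

text \<open>The lower bound is a linear programming bound. Off \<open>T\<close>, a potential \<open>h\<close> dominates its Hermite
  interpolant at the five inner products, simple at the ends of \<open>T\<close> and double elsewhere. For a
  suitable order of the nodes the Newton basis polynomials of the interpolant have nonnegative
  Gegenbauer coefficients, and the divided differences of \<open>h\<close> are nonnegative, so positive
  definiteness of the Gegenbauer kernels bounds the energy by its value at a design.

  Attainment reduces to counting. A code with 47104 points and inner products among the five values
  meets the cardinality bound given by its annihilator, hence is a 5-design, which determines its
  distance distribution. Likewise the 196560 minimal vectors of the Leech lattice (produced by
  counting octads in the Golay code) meet the bound given by \<open>t\<^sup>2(t\<^sup>2 - 1/16)(t\<^sup>2 - 1/4)\<close>
  for antipodal codes in dimension 24, so each of them has exactly 47104 neighbours at inner product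
  1/4. In particular no transitivity of the automorphism group and no spherical integral is needed.\<close>

section \<open>Zonal kernels as projections onto harmonic polynomials\<close>

text \<open>Eight interpolation conditions involve Newton products of degree at most 7. The weights
  275, 7128, 22275, 15400, 2025 at the nodes, with weight 1 at \<open>t = 1\<close>, annihilate the
  Gegenbauer polynomials of degrees 1 to 7, so the energy bound is sharp for this distribution.
  Coefficients of degree 0 may have any sign, since a constant has a known sum over pairs. The
  product of all eight factors is never expanded; only its sign off \<open>T\<close> matters. The
  counts for the Golay code and the lattice are lower bounds: 4096 words, 759 octads, 196560 minimal
  vectors. The matching upper bound comes from the annihilator inequality itself: \<open>N\<close>
  points satisfy \<open>N * 45/32 >= N^2 / 139776\<close>, that is, \<open>N <= 196560\<close>.
  Equality makes the pair sums of degrees 2, 4, 6 vanish. Passing from pair sums to single points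
  uses the Fischer norm again: a vanishing pair sum is a vanishing norm, so the sum of the zonal
  polynomials is zero and pairs to zero with each unit vector. Linear equations then give the
  distance counts at every point.\<close>

text \<open>A homogeneous polynomial is given by its coefficient function on exponent vectors. For the Fischer
  inner product, multiplication by a variable is adjoint to partial differentiation, hence
  multiplication by the squared norm is adjoint to the Laplacian. The series \<open>exp_coeffs x\<close> of
  \<open>exp (x \<bullet> v)\<close> in \<open>v\<close> reproduces evaluation at \<open>x\<close>, and its harmonic projection in degree
  \<open>k\<close> is the zonal polynomial whose Gram matrix is the Gegenbauer kernel.\<close>

definition multi_indices :: "nat \<Rightarrow> ('n::finite \<Rightarrow> nat) set" where
  "multi_indices k = {\<alpha>. sum \<alpha> UNIV = k}"

definition multi_fact :: "('n::finite \<Rightarrow> nat) \<Rightarrow> real" where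
  "multi_fact \<alpha> = (\<Prod>i\<in>UNIV. fact (\<alpha> i))"

definition fischer :: "nat \<Rightarrow> (('n::finite \<Rightarrow> nat) \<Rightarrow> real) \<Rightarrow> (('n \<Rightarrow> nat) \<Rightarrow> real) \<Rightarrow> real" where
  "fischer k c d = (\<Sum>\<alpha>\<in>multi_indices k. multi_fact \<alpha> * c \<alpha> * d \<alpha>)"

definition mult_var :: "'n \<Rightarrow> (('n::finite \<Rightarrow> nat) \<Rightarrow> real) \<Rightarrow> ('n \<Rightarrow> nat) \<Rightarrow> real" where
  "mult_var i c \<alpha> = (if \<alpha> i = 0 then 0 else c (\<alpha>(i := \<alpha> i - 1)))"

definition partial_var :: "'n \<Rightarrow> (('n::finite \<Rightarrow> nat) \<Rightarrow> real) \<Rightarrow> ('n \<Rightarrow> nat) \<Rightarrow> real" where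
  "partial_var i c \<alpha> = real (Suc (\<alpha> i)) * c (\<alpha>(i := Suc (\<alpha> i)))"

definition mult_norm2 :: "(('n::finite \<Rightarrow> nat) \<Rightarrow> real) \<Rightarrow> ('n \<Rightarrow> nat) \<Rightarrow> real" where
  "mult_norm2 c \<alpha> = (\<Sum>i\<in>UNIV. mult_var i (mult_var i c) \<alpha>)"

definition laplacian :: "(('n::finite \<Rightarrow> nat) \<Rightarrow> real) \<Rightarrow> ('n \<Rightarrow> nat) \<Rightarrow> real" where
  "laplacian c \<alpha> = (\<Sum>i\<in>UNIV. partial_var i (partial_var i c) \<alpha>)"

definition exp_coeffs :: "real ^ 'n \<Rightarrow> ('n::finite \<Rightarrow> nat) \<Rightarrow> real" where
  "exp_coeffs x \<alpha> = (\<Prod>i\<in>UNIV. (x $ i) ^ \<alpha> i / fact (\<alpha> i))"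

lemma sum_upd:
  fixes \<alpha> :: "'n::finite \<Rightarrow> nat"
  shows "sum (\<alpha>(i := v)) UNIV + \<alpha> i = sum \<alpha> UNIV + v"
proof -
  have "sum (\<alpha>(i := v)) UNIV = v + sum \<alpha> (UNIV - {i})"
    by (subst sum.remove[of _ i]) (auto intro!: sum.cong)
  moreover have "sum \<alpha> UNIV = \<alpha> i + sum \<alpha> (UNIV - {i})"
    by (subst sum.remove[of _ i]) auto
  ultimately show ?thesis by simp
qed

lemma finite_multi_indices [simp]: "finite (multi_indices k :: ('n::finite \<Rightarrow> nat) set)"
proof (rule finite_subset)
  show "multi_indices k \<subseteq> (UNIV :: 'n set) \<rightarrow>\<^sub>E {..k}"
    by (auto simp: multi_indices_def PiE_def extensional_def intro: member_le_sum)
qed (auto intro: finite_PiE)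

lemma multi_fact_pos: "multi_fact \<alpha> > 0"
  by (auto simp: multi_fact_def intro: prod_pos)

lemma multi_fact_Suc: "multi_fact (\<alpha>(i := Suc (\<alpha> i))) = real (Suc (\<alpha> i)) * multi_fact \<alpha>"
proof -
  have "multi_fact (\<alpha>(i := Suc (\<alpha> i))) = fact (Suc (\<alpha> i)) * (\<Prod>j\<in>UNIV-{i}. fact (\<alpha> j))"
    unfolding multi_fact_def by (subst prod.remove[of _ i]) (auto intro!: prod.cong)
  moreover have "multi_fact \<alpha> = fact (\<alpha> i) * (\<Prod>j\<in>UNIV-{i}. fact (\<alpha> j))"
    unfolding multi_fact_def by (subst prod.remove[of _ i]) auto
  ultimately show ?thesis by simp
qed

lemma fischer_commute: "fischer k c d = fischer k d c"
  by (simp add: fischer_def mult_ac)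

lemma fischer_cong:
  assumes "\<And>\<alpha>. \<alpha> \<in> multi_indices k \<Longrightarrow> c \<alpha> = c' \<alpha>" "\<And>\<alpha>. \<alpha> \<in> multi_indices k \<Longrightarrow> d \<alpha> = d' \<alpha>"
  shows "fischer k c d = fischer k c' d'"
  unfolding fischer_def using assms by (intro sum.cong) auto

lemma fischer_sum_right:
  "fischer k c (\<lambda>\<alpha>. \<Sum>i\<in>A. w i * d i \<alpha>) = (\<Sum>i\<in>A. w i * fischer k c (d i))"
  unfolding fischer_def sum_distrib_left by (subst sum.swap) (simp add: mult_ac)

lemma fischer_sum_left:
  "fischer k (\<lambda>\<alpha>. \<Sum>i\<in>A. w i * c i \<alpha>) d = (\<Sum>i\<in>A. w i * fischer k (c i) d)"
  by (subst (1 2) fischer_commute) (rule fischer_sum_right)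

lemma fischer_scale_left: "fischer k (\<lambda>\<alpha>. a * c \<alpha>) d = a * fischer k c d"
  unfolding fischer_def sum_distrib_left by (simp add: mult_ac)

lemma fischer_scale_right: "fischer k c (\<lambda>\<alpha>. a * d \<alpha>) = a * fischer k c d"
  unfolding fischer_def sum_distrib_left by (simp add: mult_ac)

lemma fischer_nonneg: "fischer k c c \<ge> 0"
  unfolding fischer_def mult.assoc
  by (intro sum_nonneg mult_nonneg_nonneg[OF less_imp_le[OF multi_fact_pos] zero_le_square])

lemma fischer_self_eq_0:
  assumes "fischer k c c = 0" "\<alpha> \<in> multi_indices k"
  shows "c \<alpha> = 0"
proof -
  have "\<forall>\<alpha>\<in>multi_indices k. multi_fact \<alpha> * c \<alpha> * c \<alpha> = 0"
    using assms(1) unfolding fischer_def mult.assoc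
    by (subst (asm) sum_nonneg_eq_0_iff)
       (simp_all add: mult_nonneg_nonneg[OF less_imp_le[OF multi_fact_pos] zero_le_square])
  with assms(2) multi_fact_pos[of \<alpha>] show ?thesis by auto
qed

lemma fischer_mult_var:
  "fischer (Suc k) c (mult_var i d) = fischer k (partial_var i c) d"
proof -
  have "fischer (Suc k) c (mult_var i d) =
     (\<Sum>\<alpha>\<in>{\<alpha>\<in>multi_indices (Suc k). \<alpha> i \<noteq> 0}. multi_fact \<alpha> * c \<alpha> * d (\<alpha>(i := \<alpha> i - 1)))"
    unfolding fischer_def
    by (intro sum.mono_neutral_cong_right) (auto simp: mult_var_def)
  also have "\<dots> = (\<Sum>\<beta>\<in>multi_indices k.
      multi_fact (\<beta>(i := Suc (\<beta> i))) * c (\<beta>(i := Suc (\<beta> i))) * d \<beta>)"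
  proof (rule sum.reindex_bij_witness[of _ "\<lambda>\<beta>. \<beta>(i := Suc (\<beta> i))" "\<lambda>\<alpha>. \<alpha>(i := \<alpha> i - 1)"], goal_cases)
    case (2 \<alpha>) then show ?case using sum_upd[of \<alpha> i "\<alpha> i - 1"] by (auto simp: multi_indices_def)
  next
    case (4 \<beta>) then show ?case using sum_upd[of \<beta> i "Suc (\<beta> i)"] by (auto simp: multi_indices_def)
  qed auto
  also have "\<dots> = fischer k (partial_var i c) d"
    unfolding fischer_def by (simp add: multi_fact_Suc partial_var_def mult_ac)
  finally show ?thesis .
qed

lemma fischer_mult_norm2:
  "fischer (Suc (Suc k)) c (mult_norm2 d) = fischer k (laplacian c) d"
proof -
  have "fischer (Suc (Suc k)) c (mult_norm2 d)
      = (\<Sum>i\<in>UNIV. fischer (Suc (Suc k)) c (mult_var i (mult_var i d)))"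
    using fischer_sum_right[of "Suc (Suc k)" c "\<lambda>_. 1" "\<lambda>i. mult_var i (mult_var i d)" UNIV]
    by (simp add: mult_norm2_def[abs_def])
  also have "\<dots> = (\<Sum>i\<in>UNIV. fischer k (partial_var i (partial_var i c)) d)"
    by (simp add: fischer_mult_var)
  also have "\<dots> = fischer k (laplacian c) d"
    using fischer_sum_left[of k "\<lambda>_. 1" "\<lambda>i. partial_var i (partial_var i c)" UNIV d]
    by (simp add: laplacian_def[abs_def])
  finally show ?thesis .
qed

section \<open>Commutation of the Laplacian with powers of the squared norm\<close>

lemma partial_var_mult_var:
  "partial_var j (mult_var i c) \<alpha> = mult_var i (partial_var j c) \<alpha> + (if i = j then c \<alpha> else 0)"
  by (auto simp: partial_var_def mult_var_def fun_upd_twist fun_upd_idem algebra_simps of_nat_diff)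

lemma euler: "(\<Sum>i\<in>UNIV. mult_var i (partial_var i c) \<alpha>) = real (sum \<alpha> UNIV) * c \<alpha>"
proof -
  have "mult_var i (partial_var i c) \<alpha> = real (\<alpha> i) * c \<alpha>" for i
    by (auto simp: mult_var_def partial_var_def)
  then show ?thesis by (simp add: sum_distrib_right)
qed

lemma mult_var_add: "mult_var i (\<lambda>\<alpha>. c \<alpha> + d \<alpha>) = (\<lambda>\<alpha>. mult_var i c \<alpha> + mult_var i d \<alpha>)"
  by (simp add: mult_var_def fun_eq_iff)

lemma partial_var_add:
  "partial_var i (\<lambda>\<alpha>. c \<alpha> + d \<alpha>) = (\<lambda>\<alpha>. partial_var i c \<alpha> + partial_var i d \<alpha>)"
  by (simp add: partial_var_def fun_eq_iff algebra_simps)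

lemma partial_var_scale: "partial_var i (\<lambda>\<alpha>. a * c \<alpha>) = (\<lambda>\<alpha>. a * partial_var i c \<alpha>)"
  by (simp add: partial_var_def fun_eq_iff)

lemma partial2_mult2:
  "partial_var j (partial_var j (mult_var i (mult_var i c))) \<alpha> =
   mult_var i (mult_var i (partial_var j (partial_var j c))) \<alpha>
     + (if i = j then 2 * c \<alpha> + 4 * mult_var i (partial_var i c) \<alpha> else 0)"
proof (cases "i = j")
  case True
  have "partial_var j (mult_var j c) = (\<lambda>\<alpha>. mult_var j (partial_var j c) \<alpha> + c \<alpha>)" for c
    by (rule ext) (simp add: partial_var_mult_var)
  with True show ?thesis by (simp add: mult_var_add partial_var_add partial_var_scale)
next
  case False
  then have "partial_var j (mult_var i c) = mult_var i (partial_var j c)" for c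
    by (intro ext) (simp add: partial_var_mult_var)
  with False show ?thesis by simp
qed

text \<open>Summing \<open>partial2_mult2\<close> over both indices leaves extra terms only on the
  diagonal, and \<open>euler\<close> turns their first-order part into the degree of
  \<alpha>.\<close>

lemma laplacian_mult_norm2:
  fixes c :: "('n::finite \<Rightarrow> nat) \<Rightarrow> real"
  shows "laplacian (mult_norm2 c) \<alpha> =
    mult_norm2 (laplacian c) \<alpha> + (2 * real CARD('n) + 4 * real (sum \<alpha> UNIV)) * c \<alpha>"
proof -
  have P: "partial_var j (\<lambda>\<alpha>. \<Sum>i\<in>UNIV. f i \<alpha>) = (\<lambda>\<alpha>. \<Sum>i\<in>UNIV. partial_var j (f i) \<alpha>)"
    for j and f :: "'n \<Rightarrow> ('n \<Rightarrow> nat) \<Rightarrow> real"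
    by (simp add: partial_var_def sum_distrib_left fun_eq_iff)
  have M: "mult_var j (\<lambda>\<alpha>. \<Sum>i\<in>UNIV. f i \<alpha>) = (\<lambda>\<alpha>. \<Sum>i\<in>UNIV. mult_var j (f i) \<alpha>)"
    for j and f :: "'n \<Rightarrow> ('n \<Rightarrow> nat) \<Rightarrow> real"
    by (simp add: mult_var_def fun_eq_iff)
  have "laplacian (mult_norm2 c) \<alpha> = (\<Sum>j\<in>UNIV. \<Sum>i\<in>UNIV. mult_var i (mult_var i (partial_var j (partial_var j c))) \<alpha>
     + (if i = j then 2 * c \<alpha> + 4 * mult_var i (partial_var i c) \<alpha> else 0))"
    unfolding laplacian_def mult_norm2_def P by (simp add: partial2_mult2)
  also have "\<dots> = (\<Sum>j\<in>UNIV. \<Sum>i\<in>UNIV. mult_var i (mult_var i (partial_var j (partial_var j c))) \<alpha>)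
      + (\<Sum>j\<in>UNIV. 2 * c \<alpha> + 4 * mult_var j (partial_var j c) \<alpha>)"
    by (simp add: sum.distrib)
  also have "(\<Sum>j\<in>UNIV. 2 * c \<alpha> + 4 * mult_var j (partial_var j c) \<alpha>)
     = (2 * real CARD('n) + 4 * real (sum \<alpha> UNIV)) * c \<alpha>"
    by (simp add: sum.distrib sum_distrib_left[symmetric] euler algebra_simps)
  also have "(\<Sum>j\<in>UNIV. \<Sum>i\<in>UNIV. mult_var i (mult_var i (partial_var j (partial_var j c))) \<alpha>)
    = mult_norm2 (laplacian c) \<alpha>"
    unfolding laplacian_def mult_norm2_def M by (rule sum.swap)
  finally show ?thesis .
qed

lemma mult_norm2_add: "mult_norm2 (\<lambda>\<alpha>. c \<alpha> + d \<alpha>) = (\<lambda>\<alpha>. mult_norm2 c \<alpha> + mult_norm2 d \<alpha>)"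
  by (simp add: mult_norm2_def mult_var_add fun_eq_iff sum.distrib)

lemma mult_norm2_scale: "mult_norm2 (\<lambda>\<alpha>. a * c \<alpha>) = (\<lambda>\<alpha>. a * mult_norm2 c \<alpha>)"
  by (auto simp: mult_norm2_def mult_var_def fun_eq_iff sum_distrib_left intro!: sum.cong)

lemma laplacian_sum_scale:
  "laplacian (\<lambda>\<alpha>. \<Sum>j\<in>A. w j * c j \<alpha>) = (\<lambda>\<alpha>. \<Sum>j\<in>A. w j * laplacian (c j) \<alpha>)"
proof (rule ext)
  fix \<alpha>
  show "laplacian (\<lambda>\<alpha>. \<Sum>j\<in>A. w j * c j \<alpha>) \<alpha> = (\<Sum>j\<in>A. w j * laplacian (c j) \<alpha>)"
    unfolding laplacian_def partial_var_def sum_distrib_left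
    by (subst sum.swap) (simp add: mult_ac)
qed

lemma mult_norm2_degree:
  "mult_norm2 (\<lambda>\<alpha>. real (sum \<alpha> UNIV) * c \<alpha>) \<alpha> = (real (sum \<alpha> UNIV) - 2) * mult_norm2 c \<alpha>"
proof -
  have *: "mult_var i (mult_var i (\<lambda>\<alpha>. real (sum \<alpha> UNIV) * c \<alpha>)) \<alpha>
     = (real (sum \<alpha> UNIV) - 2) * mult_var i (mult_var i c) \<alpha>" for i
  proof (cases "\<alpha> i \<ge> 2")
    case True
    have "sum (\<alpha>(i := \<alpha> i - 2)) UNIV + 2 = sum \<alpha> UNIV"
      using sum_upd[of \<alpha> i "\<alpha> i - 2"] True by simp
    then have "real (sum (\<alpha>(i := \<alpha> i - 2)) UNIV) = real (sum \<alpha> UNIV) - 2"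
      by linarith
    moreover have "\<alpha>(i := \<alpha> i - Suc (Suc 0)) = \<alpha>(i := \<alpha> i - 2)"
      by (simp add: numeral_2_eq_2)
    ultimately show ?thesis
      by (auto simp: mult_var_def)
  next
    case False
    then show ?thesis by (auto simp: mult_var_def)
  qed
  show ?thesis
    unfolding mult_norm2_def[of _ \<alpha>] * sum_distrib_left ..
qed

text \<open>Each factor contributes one commutator, in a degree lower by two than that of the factor
  outside it, so the scalars form an arithmetic progression. As \<alpha> has the degree of the
  result, the sign in \<open>- 4 * real j\<close> is negative; in terms of the degree of
  \<open>c\<close> it would be positive.\<close>

lemma laplacian_mult_norm2_power:
  fixes c :: "('n::finite \<Rightarrow> nat) \<Rightarrow> real"
  shows "laplacian ((mult_norm2 ^^ Suc j) c) \<alpha> = (mult_norm2 ^^ Suc j) (laplacian c) \<alpha>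
     + real (Suc j) * (2 * real CARD('n) + 4 * real (sum \<alpha> UNIV) - 4 * real j) * (mult_norm2 ^^ j) c \<alpha>"
proof (induction j arbitrary: \<alpha>)
  case 0
  then show ?case by (simp add: laplacian_mult_norm2)
next
  case (Suc j)
  let ?n = "2 * real CARD('n)" and ?d = "\<lambda>\<alpha>::'n \<Rightarrow> nat. real (sum \<alpha> UNIV)"
  let ?R = "\<lambda>j. (mult_norm2 ^^ j) c"
  have IH: "laplacian (?R (Suc j)) = (\<lambda>\<alpha>. (mult_norm2 ^^ Suc j) (laplacian c) \<alpha>
     + (real (Suc j) * (?n - 4 * real j) * ?R j \<alpha> + 4 * real (Suc j) * (?d \<alpha> * ?R j \<alpha>)))"
    using Suc.IH by (simp add: fun_eq_iff algebra_simps)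
  have "laplacian (?R (Suc (Suc j))) \<alpha> = laplacian (mult_norm2 (?R (Suc j))) \<alpha>" by simp
  also have "\<dots> = mult_norm2 (laplacian (?R (Suc j))) \<alpha> + (?n + 4 * ?d \<alpha>) * ?R (Suc j) \<alpha>"
    by (rule laplacian_mult_norm2)
  also have "mult_norm2 (laplacian (?R (Suc j))) \<alpha> = (mult_norm2 ^^ Suc (Suc j)) (laplacian c) \<alpha>
     + (real (Suc j) * (?n - 4 * real j) * ?R (Suc j) \<alpha> + 4 * real (Suc j) * ((?d \<alpha> - 2) * ?R (Suc j) \<alpha>))"
    unfolding IH mult_norm2_add mult_norm2_scale mult_norm2_degree by simp
  finally show ?case by (simp add: algebra_simps)
qed

text \<open>Ends the telescoping sum in \<open>laplacian_zonal\<close>: a multiple of the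
  \<open>j\<close>-th power of the squared norm has no terms of lower degree.\<close>

lemma mult_norm2_power_eq_0:
  assumes "sum \<alpha> UNIV < 2 * j"
  shows "(mult_norm2 ^^ j) c \<alpha> = 0"
  using assms
proof (induction j arbitrary: \<alpha>)
  case (Suc j)
  have "mult_var i (mult_var i ((mult_norm2 ^^ j) c)) \<alpha> = 0" for i
  proof (cases "\<alpha> i \<ge> 2")
    case True
    have "sum (\<alpha>(i := \<alpha> i - 2)) UNIV + 2 = sum \<alpha> UNIV"
      using sum_upd[of \<alpha> i "\<alpha> i - 2"] True by simp
    with Suc.prems have "sum (\<alpha>(i := \<alpha> i - 2)) UNIV < 2 * j" by (simp del: fun_upd_apply)
    from Suc.IH[OF this] show ?thesis
      by (simp add: mult_var_def numeral_2_eq_2 del: fun_upd_apply) (simp add: fun_upd_def)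
  qed (auto simp: mult_var_def)
  then show ?case by (simp add: mult_norm2_def[of _ \<alpha>])
qed simp

section \<open>The exponential series and its harmonic projection\<close>

lemma partial_var_exp_coeffs: "partial_var i (exp_coeffs x) = (\<lambda>\<alpha>. x $ i * exp_coeffs x \<alpha>)"
proof (rule ext)
  fix \<alpha> :: "'a \<Rightarrow> nat"
  have "exp_coeffs x (\<alpha>(i := Suc (\<alpha> i))) =
     (x $ i) ^ Suc (\<alpha> i) / fact (Suc (\<alpha> i)) * (\<Prod>j\<in>UNIV-{i}. (x $ j) ^ \<alpha> j / fact (\<alpha> j))"
    unfolding exp_coeffs_def by (subst prod.remove[of _ i]) (auto intro!: prod.cong)
  moreover have "exp_coeffs x \<alpha> =
     (x $ i) ^ \<alpha> i / fact (\<alpha> i) * (\<Prod>j\<in>UNIV-{i}. (x $ j) ^ \<alpha> j / fact (\<alpha> j))"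
    unfolding exp_coeffs_def by (subst prod.remove[of _ i]) auto
  ultimately show "partial_var i (exp_coeffs x) \<alpha> = x $ i * exp_coeffs x \<alpha>"
    unfolding partial_var_def by (simp del: of_nat_Suc)
qed

lemma laplacian_exp_coeffs: "laplacian (exp_coeffs x) = (\<lambda>\<alpha>. (x \<bullet> x) * exp_coeffs x \<alpha>)"
proof -
  have "partial_var i (partial_var i (exp_coeffs x)) \<alpha> = x $ i * x $ i * exp_coeffs x \<alpha>" for i \<alpha>
  proof -
    have "partial_var i (partial_var i (exp_coeffs x)) \<alpha> = x $ i * partial_var i (exp_coeffs x) \<alpha>"
      by (subst partial_var_exp_coeffs) (simp add: partial_var_def)
    then show ?thesis by (simp add: partial_var_exp_coeffs)
  qed
  then show ?thesis by (simp add: laplacian_def fun_eq_iff inner_vec_def sum_distrib_right)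
qed

text \<open>Euler's identity replaces the multinomial theorem: it writes the factor
  \<open>Suc k\<close> as a sum of multiplications after derivatives, adjointness lowers the degree,
  and each derivative of a series is a scalar multiple of it.\<close>

lemma fischer_exp_coeffs: "fischer k (exp_coeffs x) (exp_coeffs y) = (x \<bullet> y) ^ k / fact k"
proof (induction k)
  case 0
  have "multi_indices 0 = {\<lambda>_::'a. 0::nat}" by (auto simp: multi_indices_def fun_eq_iff)
  then show ?case by (simp add: fischer_def multi_fact_def exp_coeffs_def)
next
  case (Suc k)
  have "real (Suc k) * fischer (Suc k) (exp_coeffs x) (exp_coeffs y)
      = fischer (Suc k) (exp_coeffs x) (\<lambda>\<alpha>. \<Sum>i\<in>UNIV. 1 * mult_var i (partial_var i (exp_coeffs y)) \<alpha>)"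
    unfolding fischer_scale_right[symmetric]
    by (intro fischer_cong) (auto simp: euler multi_indices_def)
  also have "\<dots> = (\<Sum>i\<in>UNIV. x $ i * y $ i * ((x \<bullet> y) ^ k / fact k))"
    unfolding fischer_sum_right fischer_mult_var partial_var_exp_coeffs fischer_scale_left fischer_scale_right Suc.IH
    by (simp add: mult_ac)
  also have "\<dots> = (x \<bullet> y) * ((x \<bullet> y) ^ k / fact k)"
    unfolding inner_vec_def inner_real_def by (simp only: sum_distrib_right)
  finally show ?case by (simp add: field_simps del: of_nat_Suc)
qed

text \<open>The recursion makes the combination below harmonic. \<open>gegen n k\<close> is the Gegenbauer polynomial of
  degree \<open>k\<close> for the sphere in \<open>\<real>\<^sup>n\<close>, with leading coefficient \<open>1 / k!\<close>.\<close>

primrec gegen_coeff :: "nat \<Rightarrow> nat \<Rightarrow> nat \<Rightarrow> real" where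
  "gegen_coeff n k 0 = 1"
| "gegen_coeff n k (Suc j) =
     - gegen_coeff n k j / (2 * real (Suc j) * (real n + 2 * real k - 2 * real j - 4))"

definition gegen :: "nat \<Rightarrow> nat \<Rightarrow> real \<Rightarrow> real" where
  "gegen n k t = (\<Sum>j\<le>k div 2. gegen_coeff n k j * (t ^ (k - 2 * j) / fact (k - 2 * j)))"

text \<open>Only the coefficients of degree \<open>k\<close> matter. There the \<open>j\<close>-th
  summand is a multiple of the polynomial
  \<open>|v|^(2j) (x \<bullet> v)^(k - 2j) / (k - 2j)!\<close> in \<open>v\<close>. The whole series
  is kept because for a unit vector \<open>x\<close> the Laplacian fixes it.\<close>

definition zonal :: "nat \<Rightarrow> real ^ 'n \<Rightarrow> ('n::finite \<Rightarrow> nat) \<Rightarrow> real" where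
  "zonal k x \<alpha> = (\<Sum>j\<le>k div 2. gegen_coeff CARD('n) k j * (mult_norm2 ^^ j) (exp_coeffs x) \<alpha>)"

lemma laplacian_zonal:
  fixes x :: "real ^ 'n"
  assumes "norm x = 1" and \<alpha>: "\<alpha> \<in> multi_indices k"
  shows "laplacian (zonal (Suc (Suc k)) x) \<alpha> = 0"
proof -
  let ?K = "Suc (Suc k)" and ?n = "CARD('n)"
  let ?a = "gegen_coeff ?n ?K" and ?R = "\<lambda>j. (mult_norm2 ^^ j) (exp_coeffs x) \<alpha>"
  have n: "real ?n > 0" by simp
  have xx: "x \<bullet> x = 1" using assms(1) by (simp add: norm_eq_1)
  have L0: "laplacian (exp_coeffs x) = exp_coeffs x"
    by (simp add: laplacian_exp_coeffs xx)
  have L: "laplacian ((mult_norm2 ^^ Suc j) (exp_coeffs x)) \<alpha>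
     = ?R (Suc j) + 2 * real (Suc j) * (real ?n + 2 * real ?K - 2 * real j - 4) * ?R j" for j
    using \<alpha> unfolding laplacian_mult_norm2_power L0 by (simp add: multi_indices_def algebra_simps)
  have zdef: "zonal ?K x = (\<lambda>\<alpha>. \<Sum>j\<le>?K div 2. ?a j * (mult_norm2 ^^ j) (exp_coeffs x) \<alpha>)"
    by (simp add: zonal_def fun_eq_iff)
  have "laplacian (zonal ?K x) \<alpha>
    = (\<Sum>j\<le>?K div 2. ?a j * laplacian ((mult_norm2 ^^ j) (exp_coeffs x)) \<alpha>)"
    unfolding zdef laplacian_sum_scale ..
  also have "\<dots> = ?R 0 + (\<Sum>j\<le>k div 2. ?a (Suc j) * laplacian ((mult_norm2 ^^ Suc j) (exp_coeffs x)) \<alpha>)"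
    by (simp only: div2_Suc_Suc sum.atMost_Suc_shift) (simp add: L0)
  \<comment> \<open>The recursion of \<open>gegen_coeff\<close> cancels the scalar of the
    commutator. What is left telescopes, and the term at 0 cancels \<open>?R 0\<close>.\<close>
  also have "(\<Sum>j\<le>k div 2. ?a (Suc j) * laplacian ((mult_norm2 ^^ Suc j) (exp_coeffs x)) \<alpha>)
     = (\<Sum>j\<le>k div 2. ?a (Suc j) * ?R (Suc j) - ?a j * ?R j)"
  proof (rule sum.cong[OF refl])
    fix j assume "j \<in> {..k div 2}"
    then have "real k \<ge> 2 * real j" by auto
    then have nz: "real ?n + 2 * real ?K - 2 * real j - 4 > 0" using n by (simp add: add_pos_nonneg)
    have "?a (Suc j) * (2 * real (Suc j) * (real ?n + 2 * real ?K - 2 * real j - 4)) = - ?a j"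
      using nz by (simp del: of_nat_Suc)
    then show "?a (Suc j) * laplacian ((mult_norm2 ^^ Suc j) (exp_coeffs x)) \<alpha> = ?a (Suc j) * ?R (Suc j) - ?a j * ?R j"
      unfolding L by (metis (no_types, opaque_lifting) add_uminus_conv_diff distrib_left mult.assoc mult_minus_left)
  qed
  also have "\<dots> = ?a (Suc (k div 2)) * ?R (Suc (k div 2)) - ?a 0 * ?R 0"
  proof -
    have "(\<Sum>j\<le>m. ?a (Suc j) * ?R (Suc j) - ?a j * ?R j) = ?a (Suc m) * ?R (Suc m) - ?a 0 * ?R 0" for m
      by (induction m) (simp_all del: gegen_coeff.simps(2) funpow.simps)
    then show ?thesis .
  qed
  also have "?R (Suc (k div 2)) = 0"
    using \<alpha> by (intro mult_norm2_power_eq_0) (auto simp: multi_indices_def)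
  finally show ?thesis by simp
qed

text \<open>Adjointness turns each factor of the squared norm into a Laplacian on the other series,
  which is fixed by it as \<open>x\<close> is a unit vector.\<close>

lemma fischer_zonal_left:
  assumes "norm x = 1"
  shows "fischer (2 * j + k) ((mult_norm2 ^^ j) (exp_coeffs y)) (exp_coeffs x) = (y \<bullet> x) ^ k / fact k"
proof (induction j)
  case 0
  then show ?case by (simp add: fischer_exp_coeffs)
next
  case (Suc j)
  have "x \<bullet> x = 1" using assms by (simp add: norm_eq_1)
  then have L: "laplacian (exp_coeffs x) = exp_coeffs x"
    by (simp add: laplacian_exp_coeffs)
  have "fischer (2 * Suc j + k) ((mult_norm2 ^^ Suc j) (exp_coeffs y)) (exp_coeffs x)
     = fischer (Suc (Suc (2 * j + k))) (exp_coeffs x) (mult_norm2 ((mult_norm2 ^^ j) (exp_coeffs y)))"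
    by (simp add: fischer_commute)
  also have "\<dots> = fischer (2 * j + k) (exp_coeffs x) ((mult_norm2 ^^ j) (exp_coeffs y))"
    by (simp add: fischer_mult_norm2 L)
  finally show ?case using Suc.IH by (simp add: fischer_commute)
qed

lemma fischer_zonal:
  fixes x y :: "real ^ 'n"
  assumes x: "norm x = 1" and y: "norm y = 1"
  shows "fischer k (zonal k x) (zonal k y) = gegen CARD('n) k (x \<bullet> y)"
proof -
  let ?a = "gegen_coeff CARD('n) k"
  have zdef: "zonal k y = (\<lambda>\<alpha>. \<Sum>j\<le>k div 2. ?a j * (mult_norm2 ^^ j) (exp_coeffs y) \<alpha>)" for y :: "real ^ 'n"
    by (simp add: zonal_def fun_eq_iff)
  have "fischer k (zonal k x) (zonal k y)
     = (\<Sum>j\<le>k div 2. ?a j * fischer k (zonal k x) ((mult_norm2 ^^ j) (exp_coeffs y)))"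
    unfolding zdef[of y] fischer_sum_right ..
  \<comment> \<open>For \<open>j > 0\<close> the right factor is a multiple of the squared norm,
    hence orthogonal to the harmonic polynomial \<open>zonal k x\<close>.\<close>
  also have "\<dots> = (\<Sum>j\<in>{0}. ?a j * fischer k (zonal k x) ((mult_norm2 ^^ j) (exp_coeffs y)))"
  proof (intro sum.mono_neutral_right ballI)
    fix j assume "j \<in> {..k div 2} - {0}"
    then have j: "j \<le> k div 2" "j \<noteq> 0" by auto
    then obtain i where i: "j = Suc i" by (cases j) auto
    from j have "k \<ge> 2" by auto
    then obtain m where k: "k = Suc (Suc m)" by (metis add_2_eq_Suc le_Suc_ex)
    have "fischer k (zonal k x) ((mult_norm2 ^^ j) (exp_coeffs y))
        = fischer m (laplacian (zonal k x)) ((mult_norm2 ^^ i) (exp_coeffs y))"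
      by (simp add: i k fischer_mult_norm2)
    also have "\<dots> = fischer m (\<lambda>_. 0) ((mult_norm2 ^^ i) (exp_coeffs y))"
      by (intro fischer_cong) (auto simp: k laplacian_zonal x)
    finally show "?a j * fischer k (zonal k x) ((mult_norm2 ^^ j) (exp_coeffs y)) = 0"
      by (simp add: fischer_def)
  qed auto
  also have "\<dots> = fischer k (zonal k x) (exp_coeffs y)" by simp
  also have "\<dots> = (\<Sum>j\<le>k div 2. ?a j * fischer k ((mult_norm2 ^^ j) (exp_coeffs x)) (exp_coeffs y))"
    unfolding zdef[of x] fischer_sum_left ..
  also have "\<dots> = gegen CARD('n) k (x \<bullet> y)"
    unfolding gegen_def
  proof (rule sum.cong[OF refl])
    fix j assume "j \<in> {..k div 2}"
    then have "2 * j + (k - 2 * j) = k" by auto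
    then show "?a j * fischer k ((mult_norm2 ^^ j) (exp_coeffs x)) (exp_coeffs y)
       = ?a j * ((x \<bullet> y) ^ (k - 2 * j) / fact (k - 2 * j))"
      using fischer_zonal_left[OF y, of j "k - 2 * j" x] by simp
  qed
  finally show ?thesis .
qed

section \<open>Positive definiteness of the Gegenbauer kernels\<close>

lemma fischer_sum_zonal:
  fixes C D :: "(real ^ 'n) set"
  assumes "C \<subseteq> sphere 0 1" "D \<subseteq> sphere 0 1"
  shows "fischer k (\<lambda>\<alpha>. \<Sum>x\<in>C. zonal k x \<alpha>) (\<lambda>\<alpha>. \<Sum>y\<in>D. zonal k y \<alpha>)
    = (\<Sum>x\<in>C. \<Sum>y\<in>D. gegen CARD('n) k (x \<bullet> y))"
proof -
  have "fischer k (\<lambda>\<alpha>. \<Sum>x\<in>C. zonal k x \<alpha>) (\<lambda>\<alpha>. \<Sum>y\<in>D. zonal k y \<alpha>)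
     = (\<Sum>x\<in>C. \<Sum>y\<in>D. fischer k (zonal k x) (zonal k y))"
    using fischer_sum_left[of k "\<lambda>_. 1" "zonal k" C] fischer_sum_right[of k _ "\<lambda>_. 1" "zonal k" D]
    by simp
  also have "\<dots> = (\<Sum>x\<in>C. \<Sum>y\<in>D. gegen CARD('n) k (x \<bullet> y))"
    using assms by (intro sum.cong) (auto simp: fischer_zonal subset_iff)
  finally show ?thesis .
qed

theorem gegen_positive_definite:
  fixes C :: "(real ^ 'n) set"
  assumes "C \<subseteq> sphere 0 1"
  shows "(\<Sum>x\<in>C. \<Sum>y\<in>C. gegen CARD('n) k (x \<bullet> y)) \<ge> 0"
  unfolding fischer_sum_zonal[OF assms assms, symmetric] by (rule fischer_nonneg)

text \<open>The pair sum is the squared Fischer norm of the summed zonal polynomials. If it is zero,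
  so is the sum, and with it the pairing with the zonal polynomial of any \<open>v\<close>, in the
  code or not. This turns tightness of a global bound into an identity at each point.\<close>

theorem gegen_sum_eq_0:
  fixes C :: "(real ^ 'n) set"
  assumes C: "C \<subseteq> sphere 0 1" and "norm v = 1"
    and 0: "(\<Sum>x\<in>C. \<Sum>y\<in>C. gegen CARD('n) k (x \<bullet> y)) = 0"
  shows "(\<Sum>x\<in>C. gegen CARD('n) k (v \<bullet> x)) = 0"
proof -
  let ?S = "\<lambda>\<alpha>. \<Sum>x\<in>C. zonal k x \<alpha>"
  from 0 have "fischer k ?S ?S = 0"
    unfolding fischer_sum_zonal[OF C C, symmetric] .
  then have "?S \<alpha> = 0" if "\<alpha> \<in> multi_indices k" for \<alpha>
    using fischer_self_eq_0[OF _ that] by blast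
  then have "fischer k (\<lambda>\<alpha>. \<Sum>x\<in>{v}. zonal k x \<alpha>) ?S = 0"
    by (simp add: fischer_def)
  moreover have "{v} \<subseteq> sphere 0 1" using assms(2) by simp
  ultimately show ?thesis
    using fischer_sum_zonal[OF _ C, of "{v}" k] by simp
qed

section \<open>Newton interpolation of absolutely monotone functions\<close>

text \<open>The divided difference \<open>(F t - F a) / (t - a)\<close> is the mean of \<open>F'\<close> over the segment from \<open>a\<close> to
  \<open>t\<close>, so its derivatives inherit nonnegativity, also at repeated nodes.\<close>

lemma divided_difference_chain:
  fixes F :: "nat \<Rightarrow> real \<Rightarrow> real"
  assumes F: "\<And>j t. t \<in> {-1<..<1} \<Longrightarrow> (F j has_real_derivative F (Suc j) t) (at t)"
    and a: "a \<in> {-1<..<1}"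
    and nonneg: "\<And>j t. t \<in> {-1<..<1} \<Longrightarrow> F (Suc j) t \<ge> 0"
  obtains G :: "nat \<Rightarrow> real \<Rightarrow> real" where
    "\<And>j t. t \<in> {-1<..<1} \<Longrightarrow> (G j has_real_derivative G (Suc j) t) (at t)"
    "\<And>j t. t \<in> {-1<..<1} \<Longrightarrow> G j t \<ge> 0"
    "\<And>t. t \<in> {-1<..<1} \<Longrightarrow> F 0 t = F 0 a + (t - a) * G 0 t"
proof -
  let ?U = "{-1<..<1::real}"
  have mem: "a + s * (t - a) \<in> ?U" if "t \<in> ?U" "s \<in> {0..1}" for s t
  proof -
    have "a + s * (t - a) = (1 - s) *\<^sub>R a + s *\<^sub>R t" by (simp add: algebra_simps)
    moreover have "convex ?U" by (rule convex_real_interval)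
    ultimately show ?thesis using a that unfolding convex_alt by (metis atLeastAtMost_iff)
  qed
  have cont: "continuous_on ?U (F j)" for j
    by (rule DERIV_continuous_on[where D = "F (Suc j)"]) (meson F has_field_derivative_at_within)
  \<comment> \<open>\<open>f j t s\<close> is the \<open>j\<close>-th derivative in \<open>t\<close>
    of \<open>F (Suc 0) (a + s * (t - a))\<close>, each differentiation adding a factor
    \<open>s\<close>. Differentiating under the integral thus gives all the \<open>G j\<close>
    together.\<close>
  define f where "f j t s = s ^ j * F (Suc j) (a + s * (t - a))" for j t s
  define G where "G j t = integral {0..1} (f j t)" for j t
  have int: "f j t integrable_on {0..1}" if "t \<in> ?U" for j t
    unfolding f_def
    by (intro integrable_continuous_real continuous_intros continuous_on_compose2[OF cont])
       (use mem that in auto)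
  show thesis
  proof
    fix j t assume t: "t \<in> ?U"
    have "((\<lambda>t. integral (cbox 0 1) (f j t)) has_real_derivative integral (cbox 0 1) (f (Suc j) t)) (at t within ?U)"
    proof (rule leibniz_rule_field_derivative[where fx = "f (Suc j)"])
      fix x s :: real assume xs: "x \<in> ?U" "s \<in> cbox 0 1"
      have "((\<lambda>x. F (Suc j) (a + s * (x - a))) has_real_derivative F (Suc (Suc j)) (a + s * (x - a)) * s) (at x)"
        by (rule DERIV_chain2[OF F]) (use xs mem in \<open>auto intro!: derivative_eq_intros\<close>)
      then have "((\<lambda>x. s ^ j * F (Suc j) (a + s * (x - a))) has_real_derivative f (Suc j) x s) (at x)"
        by (auto intro!: derivative_eq_intros simp: f_def)
      then show "((\<lambda>x. f j x s) has_real_derivative f (Suc j) x s) (at x within ?U)"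
        unfolding f_def[of j] by (rule has_field_derivative_at_within)
    next
      show "continuous_on (?U \<times> cbox 0 1) (\<lambda>(x, s). f (Suc j) x s)"
        unfolding f_def case_prod_unfold
        by (intro continuous_intros continuous_on_compose2[OF cont]) (use mem in auto)
    qed (use int t in \<open>auto intro: convex_real_interval\<close>)
    then show "(G j has_real_derivative G (Suc j) t) (at t)"
      using t by (simp add: G_def[abs_def] at_within_open[OF t])
    show "G j t \<ge> 0"
      unfolding G_def
      by (intro integral_nonneg int t) (use nonneg mem t in \<open>auto simp: f_def intro!: mult_nonneg_nonneg\<close>)
  next
    fix t assume t: "t \<in> ?U"
    have "((\<lambda>s. F (Suc 0) (a + s * (t - a)) * (t - a)) has_integral F 0 (a + 1 * (t - a)) - F 0 (a + 0 * (t - a))) {0..1}"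
    proof (rule fundamental_theorem_of_calculus)
      fix s :: real assume s: "s \<in> {0..1}"
      have "((\<lambda>s. F 0 (a + s * (t - a))) has_real_derivative F (Suc 0) (a + s * (t - a)) * (t - a)) (at s)"
        by (rule DERIV_chain2[OF F]) (use s t mem in \<open>auto intro!: derivative_eq_intros\<close>)
      then show "((\<lambda>s. F 0 (a + s * (t - a))) has_vector_derivative F (Suc 0) (a + s * (t - a)) * (t - a)) (at s within {0..1})"
        by (simp add: has_field_derivative_at_within flip: has_real_derivative_iff_has_vector_derivative)
    qed simp
    moreover have "((\<lambda>s. F (Suc 0) (a + s * (t - a)) * (t - a)) has_integral G 0 t * (t - a)) {0..1}"
      using has_integral_mult_left[OF integrable_integral[OF int[OF t, of 0]], of "t - a"]
      by (simp add: G_def f_def)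
    ultimately have "F 0 (a + 1 * (t - a)) - F 0 (a + 0 * (t - a)) = G 0 t * (t - a)"
      by (rule has_integral_unique)
    then show "F 0 t = F 0 a + (t - a) * G 0 t"
      by (simp add: mult.commute)
  qed
qed

definition newton_basis :: "real list \<Rightarrow> nat \<Rightarrow> real \<Rightarrow> real" where
  "newton_basis ts j t = (\<Prod>i<j. t - ts ! i)"

lemma newton_basis_0 [simp]: "newton_basis ts 0 t = 1"
  by (simp add: newton_basis_def)

lemma newton_basis_Cons_Suc [simp]:
  "newton_basis (a # ts) (Suc j) t = (t - a) * newton_basis ts j t"
  unfolding newton_basis_def by (subst prod.lessThan_Suc_shift) simp

lemma newton_basis_length_eq_0: "t \<in> set ts \<Longrightarrow> newton_basis ts (length ts) t = 0"
  by (auto simp: newton_basis_def in_set_conv_nth)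

text \<open>Peeling off a node replaces \<open>F\<close> by its divided difference, which satisfies
  the same hypotheses. The values met at the nodes are the coefficients, and the last quotient is
  \<open>R\<close>. A repeated node is no special case because the quotient is defined at the node
  as well.\<close>

lemma newton_expansion:
  fixes F :: "nat \<Rightarrow> real \<Rightarrow> real"
  assumes "\<And>j t. t \<in> {-1<..<1} \<Longrightarrow> (F j has_real_derivative F (Suc j) t) (at t)"
    and "\<And>j t. t \<in> {-1<..<1} \<Longrightarrow> F j t \<ge> 0"
    and "set ts \<subseteq> {-1<..<1}"
  shows "\<exists>c R. (\<forall>j. c j \<ge> 0) \<and> (\<forall>t\<in>{-1<..<1}. R t \<ge> 0 \<and>
    F 0 t = (\<Sum>j<length ts. c j * newton_basis ts j t) + R t * newton_basis ts (length ts) t)"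
  using assms
proof (induction ts arbitrary: F)
  case Nil
  then show ?case by (intro exI[of _ "\<lambda>_. 0"] exI[of _ "F 0"]) auto
next
  case (Cons a ts)
  have "a \<in> {-1<..<1}" using Cons.prems(3) by simp
  from divided_difference_chain[of F a, OF Cons.prems(1) this Cons.prems(2)]
  obtain G where G: "\<And>j t. t \<in> {-1<..<1} \<Longrightarrow> (G j has_real_derivative G (Suc j) t) (at t)"
    "\<And>j t. t \<in> {-1<..<1} \<Longrightarrow> G j t \<ge> 0"
    and eq: "\<And>t. t \<in> {-1<..<1} \<Longrightarrow> F 0 t = F 0 a + (t - a) * G 0 t"
    by blast
  from Cons.prems(3) have "set ts \<subseteq> {-1<..<1}" by simp
  from Cons.IH[of G, OF G this] obtain c R where c: "\<And>j. c j \<ge> 0" and R: "\<And>t. t \<in> {-1<..<1} \<Longrightarrow> R t \<ge> 0 \<and>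
    G 0 t = (\<Sum>j<length ts. c j * newton_basis ts j t) + R t * newton_basis ts (length ts) t" by blast
  show ?case
  proof (intro exI conjI ballI allI)
    show "case_nat (F 0 a) c j \<ge> 0" for j
      using c Cons.prems(2,3) by (auto split: nat.split)
    fix t :: real assume t: "t \<in> {-1<..<1}"
    show "R t \<ge> 0" using R[OF t] by blast
    have "(t - a) * G 0 t = (\<Sum>j<length ts. c j * ((t - a) * newton_basis ts j t))
        + R t * ((t - a) * newton_basis ts (length ts) t)"
      using R[OF t] by (simp add: distrib_left sum_distrib_left mult_ac)
    then show "F 0 t = (\<Sum>j<length (a # ts). case_nat (F 0 a) c j * newton_basis (a # ts) j t)
        + R t * newton_basis (a # ts) (length (a # ts)) t"
      unfolding eq[OF t] by (simp only: list.size sum.lessThan_Suc_shift add_0_right add_Suc_right)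
        (simp add: sum.lessThan_Suc_shift del: sum.lessThan_Suc)
  qed
qed

text \<open>Only the derivatives of \<open>h\<close> have a sign, so the first node is split off by
  hand: the divided difference \<open>G\<close> and all its derivatives are nonnegative, and
  \<open>newton_expansion\<close> applies to it. The coefficient of index 0 is \<open>h a\<close>,
  of either sign. The error is \<open>R\<close> times the full product, which gives the minorant
  where that product is nonnegative.\<close>

lemma absolutely_monotone_newton_minorant:
  assumes h: "absolutely_monotone h" and ts: "set ts \<subseteq> {-1<..<1}" "ts \<noteq> []"
  obtains c where
    "\<And>j. j \<ge> 1 \<Longrightarrow> c j \<ge> 0"
    "\<And>t. t \<in> set ts \<Longrightarrow> h t = (\<Sum>j<length ts. c j * newton_basis ts j t)"
    "\<And>t. \<lbrakk>t \<in> {-1<..<1}; newton_basis ts (length ts) t \<ge> 0\<rbrakk>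
       \<Longrightarrow> (\<Sum>j<length ts. c j * newton_basis ts j t) \<le> h t"
proof -
  obtain a us where us: "ts = a # us" using ts(2) by (cases ts) auto
  let ?F = "\<lambda>j. (deriv ^^ j) h"
  have F: "(?F j has_real_derivative ?F (Suc j) t) (at t)" if "t \<in> {-1<..<1}" for j t
    using h that by (auto simp: absolutely_monotone_def intro!: DERIV_deriv_iff_field_differentiable[THEN iffD2])
  have Fn: "?F (Suc j) t \<ge> 0" if "t \<in> {-1<..<1}" for j t
    using h that unfolding absolutely_monotone_def by (metis One_nat_def le_add1 plus_1_eq_Suc)
  have a: "a \<in> {-1<..<1}" using ts us by auto
  from divided_difference_chain[of ?F a, OF F a Fn]
  obtain G where G: "\<And>j t. t \<in> {-1<..<1} \<Longrightarrow> (G j has_real_derivative G (Suc j) t) (at t)"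
    "\<And>j t. t \<in> {-1<..<1} \<Longrightarrow> G j t \<ge> 0"
    and eq': "\<And>t. t \<in> {-1<..<1} \<Longrightarrow> (deriv ^^ 0) h t = (deriv ^^ 0) h a + (t - a) * G 0 t"
    by blast
  then have eq: "h t = h a + (t - a) * G 0 t" if "t \<in> {-1<..<1}" for t
    using eq'[OF that] by simp
  have "set us \<subseteq> {-1<..<1}" using ts us by auto
  from newton_expansion[of G, OF G this] obtain c R where c: "\<And>j. c j \<ge> 0"
    and R: "\<And>t. t \<in> {-1<..<1} \<Longrightarrow> R t \<ge> 0 \<and>
    G 0 t = (\<Sum>j<length us. c j * newton_basis us j t) + R t * newton_basis us (length us) t" by blast
  let ?c = "case_nat (h a) c"
  have expand: "h t = (\<Sum>j<length ts. ?c j * newton_basis ts j t) + R t * newton_basis ts (length ts) t"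
    if t: "t \<in> {-1<..<1}" for t
  proof -
    have "(t - a) * G 0 t = (\<Sum>j<length us. c j * ((t - a) * newton_basis us j t))
        + R t * ((t - a) * newton_basis us (length us) t)"
      using R[OF t] by (simp add: distrib_left sum_distrib_left mult_ac)
    then show ?thesis
      unfolding eq[OF t] us by (simp add: sum.lessThan_Suc_shift del: sum.lessThan_Suc)
  qed
  show thesis
  proof (rule that[of ?c])
    show "?c j \<ge> 0" if "j \<ge> 1" for j using c that by (auto split: nat.split)
    show "h t = (\<Sum>j<length ts. ?c j * newton_basis ts j t)" if "t \<in> set ts" for t
      using expand[of t] ts that by (auto simp: newton_basis_length_eq_0)
    show "(\<Sum>j<length ts. ?c j * newton_basis ts j t) \<le> h t"
      if "t \<in> {-1<..<1}" "newton_basis ts (length ts) t \<ge> 0" for t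
      using expand[of t] R[of t] that by simp
  qed
qed

section \<open>Linear programming bound in dimension 23\<close>

lemma gegen_coeff_numeral:
  "gegen_coeff n k (numeral v) = - gegen_coeff n k (pred_numeral v)
     / (2 * real (numeral v) * (real n + 2 * real k - 2 * real (pred_numeral v) - 4))"
  unfolding numeral_eq_Suc gegen_coeff.simps ..

lemma gegen_0: "gegen n 0 t = 1"
  by (simp add: gegen_def)

lemma gegen_1: "gegen n (Suc 0) t = t"
  by (simp add: gegen_def)

lemma gegen_23:
  "gegen 23 2 t = t^2/2 - 1/46"
  "gegen 23 3 t = t^3/6 - t/50"
  "gegen 23 4 t = t^4/24 - t^2/108 + 1/5400"
  "gegen 23 5 t = t^5/120 - t^3/348 + t/6264"
  "gegen 23 6 t = t^6/720 - t^4/1488 + t^2/14384 - 1/1165104"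
  "gegen 23 7 t = t^7/5040 - t^5/7920 + t^3/49104 - t/1424016"
  by (simp_all add: gegen_def gegen_coeff_numeral atMost_nat_numeral atMost_Suc fact_numeral)

lemma gegen_24:
  "gegen 24 2 t = t^2/2 - 1/48"
  "gegen 24 4 t = t^4/24 - t^2/112 + 1/5824"
  "gegen 24 6 t = t^6/720 - t^4/1536 + t^2/15360 - 1/1290240"
  by (simp_all add: gegen_def gegen_coeff_numeral atMost_nat_numeral atMost_Suc fact_numeral)

text \<open>The coefficient of the three-term recurrence of the monic Gegenbauer polynomials,
  divided by \<open>k\<close> to account for the leading coefficient \<open>1 / k!\<close>.\<close>

definition gegen_beta :: "nat \<Rightarrow> nat \<Rightarrow> real" where
  "gegen_beta n k = (real n + real k - 3) / ((real n + 2 * real k - 2) * (real n + 2 * real k - 4))"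

lemma gegen_23_recurrence:
  assumes "1 \<le> k" "k \<le> 6"
  shows "t * gegen 23 k t = real (Suc k) * gegen 23 (Suc k) t + gegen_beta 23 k * gegen 23 (k - 1) t"
proof -
  from assms have "k \<in> {1, 2, 3, 4, 5, 6}" by auto
  then show ?thesis
    by (elim insertE)
       (simp_all add: gegen_beta_def gegen_0 gegen_1 gegen_23 gegen_23(1)[unfolded numeral_2_eq_2]
         power_numeral_reduce algebra_simps add_divide_distrib diff_divide_distrib)
qed

fun gegen_comb :: "nat \<Rightarrow> real list \<Rightarrow> real \<Rightarrow> real" where
  "gegen_comb k [] t = 0"
| "gegen_comb k (c # cs) t = c * gegen 23 k t + gegen_comb (Suc k) cs t"

text \<open>\<open>times_node\<close> multiplies a Gegenbauer expansion by \<open>t - a\<close> through the three-term recurrence; the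
  argument \<open>p\<close> carries the preceding coefficient.\<close>

fun times_node :: "nat \<Rightarrow> real \<Rightarrow> real \<Rightarrow> real list \<Rightarrow> real list" where
  "times_node k a p [] = [real k * p]"
| "times_node k a p (c # cs) =
     (real k * p - a * c + gegen_beta 23 (Suc k) * (case cs of [] \<Rightarrow> 0 | c' # _ \<Rightarrow> c')) # times_node (Suc k) a c cs"

lemma length_times_node [simp]: "length (times_node k a p cs) = Suc (length cs)"
  by (induction k a p cs rule: times_node.induct) auto

text \<open>A tail of an expansion is not closed under multiplication by \<open>t\<close>: its first
  coefficient sends a term down to degree \<open>k - 1\<close>, and the preceding coefficient
  \<open>p\<close> sends one up to degree \<open>k\<close>. The two extra summands record this
  exchange.\<close>

lemma gegen_comb_times_node_Suc:
  assumes "1 \<le> k" "k + length cs \<le> 7"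
  shows "gegen_comb k (times_node k a p cs) t = (t - a) * gegen_comb k cs t + real k * p * gegen 23 k t
     - (case cs of [] \<Rightarrow> 0 | c # _ \<Rightarrow> c) * gegen_beta 23 k * gegen 23 (k - 1) t"
  using assms
proof (induction k a p cs rule: times_node.induct)
  case (2 k a p c cs)
  have rec: "t * gegen 23 k t = real (Suc k) * gegen 23 (Suc k) t + gegen_beta 23 k * gegen 23 (k - 1) t"
    using 2 by (intro gegen_23_recurrence) auto
  have "gegen_comb k (times_node k a p (c # cs)) t
     = (real k * p - a * c) * gegen 23 k t + (t - a) * gegen_comb (Suc k) cs t + c * (real (Suc k) * gegen 23 (Suc k) t)"
    using 2 by (simp add: algebra_simps del: of_nat_Suc)
  also have "real (Suc k) * gegen 23 (Suc k) t = t * gegen 23 k t - gegen_beta 23 k * gegen 23 (k - 1) t"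
    using rec by simp
  finally show ?case by (simp add: algebra_simps)
qed simp

lemma gegen_comb_times_node:
  assumes "length cs \<le> 7"
  shows "gegen_comb 0 (times_node 0 a p cs) t = (t - a) * gegen_comb 0 cs t"
proof (cases cs)
  case (Cons c ds)
  then have "gegen_comb (Suc 0) (times_node (Suc 0) a c ds) t = (t - a) * gegen_comb (Suc 0) ds t + c * t
     - (case ds of [] \<Rightarrow> 0 | c # _ \<Rightarrow> c) * gegen_beta 23 (Suc 0)"
    using assms gegen_comb_times_node_Suc[of "Suc 0" ds a c t] by (simp add: gegen_1 gegen_0)
  with Cons show ?thesis by (simp add: gegen_0 algebra_simps)
qed simp

text \<open>The head of the list is the coefficient of degree 0. It is exempt from the sign test
  because the sum of a constant over all pairs is known exactly.\<close>

fun newton_positive :: "real list \<Rightarrow> real list \<Rightarrow> bool" where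
  "newton_positive [] ts \<longleftrightarrow> False"
| "newton_positive (c # cs) [] \<longleftrightarrow> list_all ((\<le>) 0) cs"
| "newton_positive (c # cs) (a # ts) \<longleftrightarrow>
     list_all ((\<le>) 0) cs \<and> newton_positive (times_node 0 a 0 (c # cs)) ts"

lemma newton_positive_gegen_comb:
  assumes "newton_positive cs ts" "length cs + length ts \<le> 8" "j \<le> length ts"
  shows "\<exists>d ds. length ds < 8 \<and> list_all ((\<le>) 0) ds \<and>
     (\<forall>t. gegen_comb 0 cs t * newton_basis ts j t = gegen_comb 0 (d # ds) t)"
  using assms
proof (induction cs ts arbitrary: j rule: newton_positive.induct)
  case (2 c cs)
  then show ?case by (intro exI[of _ c] exI[of _ cs]) auto
next
  case (3 c cs a ts)
  show ?case
  proof (cases j)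
    case 0
    with 3 show ?thesis by (intro exI[of _ c] exI[of _ cs]) auto
  next
    case (Suc i)
    have "length (c # cs) \<le> 7" using 3 by simp
    note node = gegen_comb_times_node[OF this, of a 0]
    have "\<exists>d ds. length ds < 8 \<and> list_all ((\<le>) 0) ds \<and>
     (\<forall>t. gegen_comb 0 (times_node 0 a 0 (c # cs)) t * newton_basis ts i t = gegen_comb 0 (d # ds) t)"
      using 3 Suc by (intro "3.IH") (auto simp del: times_node.simps)
    then show ?thesis unfolding node Suc by (simp add: mult_ac)
  qed
qed simp

section \<open>Pair sums, energy and the linear programming inequality\<close>

definition pair_sum :: "(real \<Rightarrow> real) \<Rightarrow> (real ^ 'n) set \<Rightarrow> real" where
  "pair_sum p C = (\<Sum>x\<in>C. \<Sum>y\<in>C. p (x \<bullet> y))"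

lemma pair_sum_add: "pair_sum (\<lambda>t. p t + q t) C = pair_sum p C + pair_sum q C"
  by (simp add: pair_sum_def sum.distrib)

lemma pair_sum_scale: "pair_sum (\<lambda>t. a * p t) C = a * pair_sum p C"
  by (simp add: pair_sum_def sum_distrib_left)

lemma pair_sum_0 [simp]: "pair_sum (\<lambda>t. 0) C = 0"
  by (simp add: pair_sum_def)

lemma pair_sum_const: "pair_sum (\<lambda>t. a) C = (real (card C))\<^sup>2 * a"
  by (simp add: pair_sum_def power2_eq_square)

lemma gegen_comb_fun:
  "gegen_comb k [] = (\<lambda>t. 0)"
  "gegen_comb k (c # cs) = (\<lambda>t. c * gegen 23 k t + gegen_comb (Suc k) cs t)"
  by (simp_all add: fun_eq_iff)

lemma energy_eq:
  assumes "spherical_code C"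
  shows "energy h C = (\<Sum>x\<in>C. \<Sum>y\<in>C - {x}. h (x \<bullet> y))"
proof -
  have "{(x, y). x \<in> C \<and> y \<in> C \<and> x \<noteq> y} = (SIGMA x:C. C - {x})" by auto
  then show ?thesis
    using assms by (simp add: energy_def spherical_code_def sum.Sigma)
qed

lemma energy_eq_pair_sum:
  assumes "spherical_code C"
  shows "energy h C = pair_sum h C - real (card C) * h 1"
proof -
  have "(\<Sum>y\<in>C. h (x \<bullet> y)) = h 1 + (\<Sum>y\<in>C - {x}. h (x \<bullet> y))" if "x \<in> C" for x
    using assms that norm_eq_1[of x] by (subst sum.remove[of C x]) (auto simp: spherical_code_def)
  then have "pair_sum h C = (\<Sum>x\<in>C. h 1 + (\<Sum>y\<in>C - {x}. h (x \<bullet> y)))"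
    unfolding pair_sum_def by (intro sum.cong) auto
  then show ?thesis
    by (simp add: energy_eq[OF assms] sum.distrib)
qed

lemma pair_sum_gegen_nonneg:
  fixes C :: "(real ^ 'n) set"
  assumes "spherical_code C"
  shows "pair_sum (gegen CARD('n) k) C \<ge> 0"
  using assms unfolding pair_sum_def spherical_code_def by (intro gegen_positive_definite) auto

lemma pair_sum_gegen_comb:
  fixes C :: "(real ^ 23) set"
  assumes C: "spherical_code C" and nonneg: "list_all ((\<le>) 0) ds"
  shows "pair_sum (gegen_comb 0 (d # ds)) C \<ge> (real (card C))\<^sup>2 * d"
proof -
  have "pair_sum (gegen_comb k ds) C \<ge> 0" for k
    using nonneg pair_sum_gegen_nonneg[OF C]
    by (induction ds arbitrary: k) (simp_all add: gegen_comb_fun pair_sum_add pair_sum_scale)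
  then show ?thesis
    by (simp add: gegen_comb_fun gegen_0 pair_sum_add pair_sum_const)
qed

text \<open>The energy per point of a code with the distance distribution of \<open>C\<^sub>1\<^sub>/\<^sub>4\<close>.\<close>

definition node_value :: "(real \<Rightarrow> real) \<Rightarrow> real" where
  "node_value h = 275 * h (-3/5) + 7128 * h (-1/3) + 22275 * h (-1/15) + 15400 * h (1/5) + 2025 * h (7/15)"

text \<open>This is the 7-design identity for the distance distribution, with the point itself
  counted at inner product 1. It is all that the lower bound uses about the extremal code.\<close>

lemma node_value_gegen:
  assumes "1 \<le> k" "k \<le> 7"
  shows "gegen 23 k 1 + node_value (gegen 23 k) = 0"
proof -
  from assms have "k \<in> {1, 2, 3, 4, 5, 6, 7}" by auto
  then show ?thesis
    by (elim insertE) (simp_all add: node_value_def gegen_1 gegen_23 power_numeral_reduce)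
qed

lemma node_value_gegen_comb:
  assumes "length ds < 8"
  shows "gegen_comb 0 (d # ds) 1 + node_value (gegen_comb 0 (d # ds)) = 47104 * d"
proof -
  have "gegen_comb k ds 1 + node_value (gegen_comb k ds) = 0" if "1 \<le> k" "k + length ds \<le> 8" for k
    using that
  proof (induction ds arbitrary: k)
    case (Cons d ds)
    have "gegen_comb k (d # ds) 1 + node_value (gegen_comb k (d # ds)) =
      d * (gegen 23 k 1 + node_value (gegen 23 k)) + (gegen_comb (Suc k) ds 1 + node_value (gegen_comb (Suc k) ds))"
      by (simp add: node_value_def algebra_simps)
    also have "\<dots> = 0"
      using Cons.IH[of "Suc k"] Cons.prems node_value_gegen[of k] by simp
    finally show ?case .
  qed (simp add: node_value_def)
  from this[of 1] assms show ?thesis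
    by (simp add: node_value_def gegen_0 algebra_simps)
qed

lemma energy_sum:
  assumes "spherical_code C"
  shows "energy (\<lambda>t. \<Sum>j<n. c j * p j t) C = (\<Sum>j<n. c j * energy (p j) C)"
  unfolding energy_def sum_distrib_left by (subst sum.swap) (simp add: case_prod_unfold)

text \<open>With the diagonal terms added back, both sides are compared with
  \<open>47104 * 47104 * d\<close> for the constant Gegenbauer coefficient \<open>d\<close>: the
  energy side is at least this by positive definiteness, the node side equals it.\<close>

lemma energy_newton_minorant:
  fixes C :: "(real ^ 23) set"
  assumes C: "spherical_code C" "card C = 47104"
    and pos: "newton_positive [1] ts" "length ts = 7" and j: "j \<le> 7"
  shows "energy (newton_basis ts j) C \<ge> 47104 * node_value (newton_basis ts j)"
proof -
  obtain d ds where ds: "length ds < 8" "list_all ((\<le>) 0) ds"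
    and eq: "\<And>t. newton_basis ts j t = gegen_comb 0 (d # ds) t"
    using newton_positive_gegen_comb[OF pos(1), of j] pos(2) j by (auto simp: gegen_0)
  have "newton_basis ts j = gegen_comb 0 (d # ds)" using eq by (rule ext)
  then show ?thesis
    using pair_sum_gegen_comb[OF C(1) ds(2), of d] node_value_gegen_comb[OF ds(1), of d]
    unfolding energy_eq_pair_sum[OF C(1)] C(2) by (simp only:) (simp del: gegen_comb.simps add: power2_eq_square)
qed

lemma inner_bounds:
  assumes "spherical_code C" "x \<in> C" "y \<in> C" "x \<noteq> y"
  shows "x \<bullet> y \<in> {-1..<1}"
proof -
  have n: "norm x = 1" "norm y = 1" using assms by (auto simp: spherical_code_def subset_iff)
  have "\<bar>x \<bullet> y\<bar> \<le> 1" using Cauchy_Schwarz_ineq2[of x y] n by simp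
  moreover have "x \<bullet> y \<noteq> 1"
    using norm_cauchy_schwarz_eq[of x y] n assms(4) by simp
  ultimately show ?thesis by auto
qed

text \<open>Derivatives are controlled only on the open interval, but antipodal points have inner
  product \<open>-1\<close>. The comparison reaches this endpoint by continuity.\<close>

lemma le_at_minus_1:
  assumes "continuous_on {-1..<1} f" "continuous_on {-1..<1} h" "b \<in> {-1<..<1::real}"
    and le: "\<And>t. t \<in> {-1<..<b} \<Longrightarrow> f t \<le> (h t :: real)"
  shows "f (-1) \<le> h (-1)"
proof -
  have cont: "continuous_on {-1..b} (\<lambda>t. h t - f t)"
    using assms(3) by (intro continuous_on_diff continuous_on_subset[OF assms(1)] continuous_on_subset[OF assms(2)]) auto
  have "closure {-1<..<b} = {-1..b}" using assms(3) by (intro closure_greaterThanLessThan) auto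
  with cont continuous_ge_on_closure[of "{-1<..<b}" "\<lambda>t. h t - f t" "-1" 0] le assms(3)
  show ?thesis by auto
qed

lemma energy_lower_bound:
  fixes C :: "(real ^ 23) set"
  assumes h: "absolutely_monotone h"
    and C: "spherical_code C" "card C = 47104" "avoiding T C"
    and pos: "newton_positive [1] (butlast ts)" "length ts = 8"
    and ts: "set ts = {-3/5, -1/3, -1/15, 1/5, 7/15}"
    and sign: "\<And>t. t \<notin> T \<Longrightarrow> newton_basis ts 8 t \<ge> 0"
    and T: "T \<subseteq> {-3/5<..}"
  shows "energy h C \<ge> 47104 * node_value h"
proof -
  obtain c where c: "\<And>j. j \<ge> 1 \<Longrightarrow> c j \<ge> 0"
    and eq: "\<And>t. t \<in> set ts \<Longrightarrow> h t = (\<Sum>j<length ts. c j * newton_basis ts j t)"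
    and le: "\<And>t. \<lbrakk>t \<in> {-1<..<1}; newton_basis ts (length ts) t \<ge> 0\<rbrakk>
       \<Longrightarrow> (\<Sum>j<length ts. c j * newton_basis ts j t) \<le> h t"
    by (rule absolutely_monotone_newton_minorant[OF h, of ts]) (use ts pos(2) in auto)
  define f where "f t = (\<Sum>j<8. c j * newton_basis ts j t)" for t
  \<comment> \<open>The products of index below 8 involve only the first seven nodes, so the
    positivity test is applied to \<open>butlast ts\<close>.\<close>
  have nb: "newton_basis ts j = newton_basis (butlast ts) j" if "j < 8" for j
    using that pos(2) by (auto simp: newton_basis_def nth_butlast fun_eq_iff)
  have cont_f: "continuous_on {-1..<1} f"
    unfolding f_def[abs_def] newton_basis_def by (intro continuous_intros)
  have cont_h: "continuous_on {-1..<1} h"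
    using h by (simp add: absolutely_monotone_def potential_def)
  have fh: "f t \<le> h t" if "t \<in> {-1<..<1}" "t \<notin> T" for t
    using le[of t] sign[of t] that pos(2) by (simp add: f_def)
  have "f (-1) \<le> h (-1)"
    by (rule le_at_minus_1[OF cont_f cont_h, of "-3/5"]) (use T fh in force)+
  then have fh': "f t \<le> h t" if "t \<in> {-1..<1}" "t \<notin> T" for t
    using fh[of t] that by (cases "t = -1") auto
  have "47104 * node_value h = 47104 * node_value f"
    using eq pos(2) by (simp add: node_value_def f_def ts)
  also have "\<dots> = (\<Sum>j<8. c j * (47104 * node_value (newton_basis ts j)))"
    by (simp add: f_def node_value_def sum_distrib_left sum.distrib algebra_simps)
  also have "\<dots> \<le> (\<Sum>j<8. c j * energy (newton_basis ts j) C)"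
  proof (rule sum_mono)
    fix j :: nat assume j: "j \<in> {..<8}"
    show "c j * (47104 * node_value (newton_basis ts j)) \<le> c j * energy (newton_basis ts j) C"
    \<comment> \<open>The coefficient \<open>c 0\<close> may be negative. This is harmless, as for
      the constant product the two sides agree.\<close>
    proof (cases "j = 0")
      case True
      then show ?thesis
        by (simp add: newton_basis_def[abs_def] energy_eq_pair_sum[OF C(1)] pair_sum_const C(2) node_value_def)
    next
      case False
      then show ?thesis
        using j energy_newton_minorant[OF C(1,2) pos(1), of j] pos(2) nb[of j]
        by (intro mult_left_mono c) auto
    qed
  qed
  also have "\<dots> = energy f C"
    unfolding f_def[abs_def] energy_sum[OF C(1)] ..
  also have "\<dots> \<le> energy h C"
    unfolding energy_eq[OF C(1)]
  proof (intro sum_mono fh')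
    fix x y assume "x \<in> C" "y \<in> C - {x}"
    then show "x \<bullet> y \<in> {-1..<1}" "x \<bullet> y \<notin> T"
      using inner_bounds[OF C(1), of x y] C(3) by (auto simp: avoiding_def inner_products_def)
  qed
  finally show ?thesis .
qed

lemma newton_sign:
  assumes "u < v" "t \<notin> {u<..<v::real}"
  shows "(t - u) * (t - v) * (s::real)\<^sup>2 \<ge> 0"
proof -
  have "(t - u) * (t - v) \<ge> 0" using assms by (auto simp: zero_le_mult_iff)
  then show ?thesis by simp
qed

text \<open>Reordering the nodes changes the Newton products but not the interpolant. Each listed
  order makes the products of the first \<open>j <= 7\<close> factors pass the sign test, which is
  rational arithmetic. The full product regroups into \<open>(t - u) * (t - v)\<close> for the ends
  of \<open>T\<close>, times a square.\<close>

theorem energy_lower_bound_intervals: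
  fixes C :: "(real ^ 23) set"
  assumes T: "T \<in> {{-3/5<..<-1/3}, {-1/3<..<-1/15}, {-1/15<..<1/5}, {1/5<..<7/15}}"
    and h: "absolutely_monotone h"
    and C: "spherical_code C" "card C = 47104" "avoiding T C"
  shows "energy h C \<ge> 47104 * node_value h"
  using T
proof (elim insertE emptyE)
  assume [simp]: "T = {-3/5<..<-1/3}"
  show ?thesis
  proof (rule energy_lower_bound[OF h C, of "[-3/5, -1/15, 1/5, -1/15, 1/5, -1/3, 7/15, 7/15]"])
    show "newton_positive [1] (butlast [-3/5, -1/15, 1/5, -1/15, 1/5, -1/3, 7/15, 7/15])"
      by (simp add: gegen_beta_def)
    fix t assume "t \<notin> T"
    then have "(t - (-3/5)) * (t - (-1/3)) * ((t - (-1/15)) * (t - 1/5) * (t - 7/15))\<^sup>2 \<ge> 0"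
      by (intro newton_sign) auto
    then show "newton_basis [-3/5, -1/15, 1/5, -1/15, 1/5, -1/3, 7/15, 7/15] 8 t \<ge> 0"
      by (simp add: newton_basis_def eval_nat_numeral mult_ac)
  qed auto
next
  assume [simp]: "T = {-1/3<..<-1/15}"
  show ?thesis
  proof (rule energy_lower_bound[OF h C, of "[-3/5, -1/15, -3/5, 1/5, -1/3, 1/5, 7/15, 7/15]"])
    show "newton_positive [1] (butlast [-3/5, -1/15, -3/5, 1/5, -1/3, 1/5, 7/15, 7/15])"
      by (simp add: gegen_beta_def)
    fix t assume "t \<notin> T"
    then have "(t - (-1/3)) * (t - (-1/15)) * ((t - (-3/5)) * (t - 1/5) * (t - 7/15))\<^sup>2 \<ge> 0"
      by (intro newton_sign) auto
    then show "newton_basis [-3/5, -1/15, -3/5, 1/5, -1/3, 1/5, 7/15, 7/15] 8 t \<ge> 0"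
      by (simp add: newton_basis_def eval_nat_numeral mult_ac)
  qed auto
next
  assume [simp]: "T = {-1/15<..<1/5}"
  show ?thesis
  proof (rule energy_lower_bound[OF h C, of "[-3/5, -1/3, 1/5, -1/15, -1/3, 7/15, -3/5, 7/15]"])
    show "newton_positive [1] (butlast [-3/5, -1/3, 1/5, -1/15, -1/3, 7/15, -3/5, 7/15])"
      by (simp add: gegen_beta_def)
    fix t assume "t \<notin> T"
    then have "(t - (-1/15)) * (t - 1/5) * ((t - (-3/5)) * (t - (-1/3)) * (t - 7/15))\<^sup>2 \<ge> 0"
      by (intro newton_sign) auto
    then show "newton_basis [-3/5, -1/3, 1/5, -1/15, -1/3, 7/15, -3/5, 7/15] 8 t \<ge> 0"
      by (simp add: newton_basis_def eval_nat_numeral mult_ac)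
  qed auto
next
  assume [simp]: "T = {1/5<..<7/15}"
  show ?thesis
  proof (rule energy_lower_bound[OF h C, of "[-3/5, -1/15, 1/5, -1/3, -1/15, 7/15, -1/3, -3/5]"])
    show "newton_positive [1] (butlast [-3/5, -1/15, 1/5, -1/3, -1/15, 7/15, -1/3, -3/5])"
      by (simp add: gegen_beta_def)
    fix t assume "t \<notin> T"
    then have "(t - 1/5) * (t - 7/15) * ((t - (-3/5)) * (t - (-1/3)) * (t - (-1/15)))\<^sup>2 \<ge> 0"
      by (intro newton_sign) auto
    then show "newton_basis [-3/5, -1/15, 1/5, -1/3, -1/15, 7/15, -1/3, -3/5] 8 t \<ge> 0"
      by (simp add: newton_basis_def eval_nat_numeral mult_ac)
  qed auto
qed

section \<open>The extended binary Golay code\<close>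

lemma odd_card_sym_diff:
  assumes "finite A" "finite B"
  shows "odd (card (sym_diff A B)) \<longleftrightarrow> odd (card A) \<noteq> odd (card B)"
proof -
  have "card (sym_diff A B) = card (A - B) + card (B - A)"
    using assms by (intro card_Un_disjoint) auto
  moreover have "card A = card (A - B) + card (A \<inter> B)" "card B = card (B - A) + card (A \<inter> B)"
    using assms by (simp_all add: card_Diff_subset_Int Int_commute card_mono)
  ultimately show ?thesis by auto
qed

text \<open>A linear combination over the two-element field: words are given by their supports and
  \<open>I\<close> selects the summands.\<close>

definition parity_span :: "('i \<Rightarrow> 'a set) \<Rightarrow> 'i set \<Rightarrow> 'a set" where
  "parity_span g I = {j. odd (card {i \<in> I. j \<in> g i})}"

lemma parity_span_sym_diff:
  assumes "finite I" "finite J"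
  shows "parity_span g (sym_diff I J) = sym_diff (parity_span g I) (parity_span g J)"
proof -
  have "{i \<in> sym_diff I J. x \<in> g i} = sym_diff {i \<in> I. x \<in> g i} {i \<in> J. x \<in> g i}" for x
    by auto
  then show ?thesis
    using assms by (auto simp: parity_span_def odd_card_sym_diff)
qed

lemma parity_span_empty [simp]: "parity_span g {} = {}"
  by (simp add: parity_span_def)

lemma parity_span_singleton [simp]: "parity_span g {i} = g i"
proof -
  have "{k \<in> {i}. j \<in> g k} = (if j \<in> g i then {i} else {})" for j by auto
  then show ?thesis by (auto simp: parity_span_def)
qed

lemma parity_span_insert:
  assumes "finite I" "i \<notin> I"
  shows "parity_span g (insert i I) = sym_diff (parity_span g I) (g i)"
proof -
  have "insert i I = sym_diff I {i}" using assms by auto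
  then show ?thesis using parity_span_sym_diff[of I "{i}" g] assms by simp
qed

lemma golay_code_eq: "golay_code = range (parity_span golay_generator)"
  by (auto simp: golay_code_def parity_span_def)

lemma golay_generator_in_code: "golay_generator i \<in> golay_code"
  unfolding golay_code_eq by (metis parity_span_singleton rangeI)

lemma empty_in_golay_code: "{} \<in> golay_code"
  unfolding golay_code_eq by (metis parity_span_empty rangeI)

lemma UNIV_in_golay_code: "UNIV \<in> golay_code"
  using golay_generator_in_code[of None] by (simp add: golay_generator_def)

lemma sym_diff_in_golay_code:
  "A \<in> golay_code \<Longrightarrow> B \<in> golay_code \<Longrightarrow> sym_diff A B \<in> golay_code"
  unfolding golay_code_eq by (auto simp flip: parity_span_sym_diff)

lemma Compl_in_golay_code: "A \<in> golay_code \<Longrightarrow> - A \<in> golay_code"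
  using sym_diff_in_golay_code[OF _ UNIV_in_golay_code, of A] by (simp add: Compl_eq_Diff_UNIV)

lemma parity_span_in_golay_code:
  assumes "finite I" "\<And>i. i \<in> I \<Longrightarrow> g i \<in> golay_code"
  shows "parity_span g I \<in> golay_code"
  using assms
  by (induction I rule: finite_induct)
     (simp_all add: empty_in_golay_code parity_span_insert sym_diff_in_golay_code)

lemma golay_code_induct [consumes 1, case_names empty sym_diff]:
  assumes "A \<in> golay_code" "P {}"
    and step: "\<And>A i. A \<in> golay_code \<Longrightarrow> P A \<Longrightarrow> P (sym_diff A (golay_generator i))"
  shows "P A"
proof -
  obtain I where A: "A = parity_span golay_generator I"
    using assms(1) by (auto simp: golay_code_eq)
  have "finite I" by simp
  then have "P (parity_span golay_generator I)"
  proof (induction I rule: finite_induct)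
    case (insert i I)
    then show ?case
      using step[of "parity_span golay_generator I" i] by (simp add: parity_span_insert golay_code_eq)
  qed (simp add: assms(2))
  with A show ?thesis by simp
qed

section \<open>Coordinates, generator matrix and self-orthogonality\<close>

definition point :: "nat \<Rightarrow> 23 option" where
  "point c = (if c < 23 then Some (of_nat c) else None)"

lemma of_nat_23_eq_iff: "(of_nat c :: 23) = of_nat d \<longleftrightarrow> c mod 23 = d mod 23"
  by (simp add: of_nat_eq_iff_cong_CHAR cong_def)

lemma inj_on_point: "inj_on point {..<24}"
  by (auto simp: inj_on_def point_def of_nat_23_eq_iff split: if_splits)

lemma bij_betw_point: "bij_betw point {..<24} UNIV"
proof -
  have "card (point ` {..<24}) = 24"
    using card_image[OF inj_on_point] by simp
  then have "point ` {..<24} = UNIV"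
    by (intro card_subset_eq) (auto simp: card_UNIV_option)
  with inj_on_point show ?thesis by (simp add: bij_betw_def)
qed

lemma point_cases:
  obtains c where "c < 24" "j = point c"
proof -
  have "j \<in> point ` {..<24}"
    using bij_betw_point by (simp add: bij_betw_def)
  with that show ?thesis by auto
qed

lemma point_inject: "point c = point c' \<Longrightarrow> c < 24 \<Longrightarrow> c' < 24 \<Longrightarrow> c = c'"
  using inj_onD[OF inj_on_point] by simp

lemma range_of_nat_23: "\<exists>e<23. (b :: 23) = of_nat e"
proof -
  have "Some b \<in> point ` {..<24}"
    using bij_betw_point by (simp add: bij_betw_def)
  then show ?thesis by (auto simp: point_def split: if_splits)
qed

definition residue_word :: "bool list" where
  "residue_word = [False, True, True, True, True, False, True, False, True, True, False, False,
     True, True, False, False, True, False, True, False, False, False, False]"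

lemma residue_word_nth:
  assumes "m < 23"
  shows "residue_word ! m \<longleftrightarrow> (\<exists>e\<in>set [1..<23]. e * e mod 23 = m)"
proof -
  have "\<forall>m\<in>set [0..<23]. residue_word ! m \<longleftrightarrow> (\<exists>e\<in>set [1..<23]. e * e mod 23 = m)"
    by (simp add: residue_word_def upt_rec)
  with assms show ?thesis by auto
qed

text \<open>\<open>rotate\<close> shifts to the left, so rotating by \<open>23 - i\<close>
  translates the word of squares by \<open>i\<close>. The appended entry is the point at infinity,
  which \<open>point\<close> numbers 23.\<close>

definition golay_row :: "nat \<Rightarrow> bool list" where
  "golay_row i = (if i < 23 then rotate (23 - i) residue_word @ [True] else map (\<lambda>_. True) [0..<24])"

lemma length_golay_row [simp]: "length (golay_row i) = 24"
  by (simp add: golay_row_def residue_word_def)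

lemma golay_row_nth:
  assumes "i < 24" "j < 24"
  shows "golay_row i ! j \<longleftrightarrow> point j \<in> golay_generator (point i)"
proof (cases "i < 23 \<and> j < 23")
  case True
  have len: "length residue_word = 23" by (simp add: residue_word_def)
  have "golay_row i ! j \<longleftrightarrow> residue_word ! ((j + (23 - i)) mod 23)"
    using True by (simp add: golay_row_def nth_append len nth_rotate add.commute)
  also have "\<dots> \<longleftrightarrow> (\<exists>e\<in>{1..<23}. e * e mod 23 = (j + (23 - i)) mod 23)"
    by (subst residue_word_nth) auto
  also have "\<dots> \<longleftrightarrow> (\<exists>e\<in>{1..<23}. (i + e * e) mod 23 = j mod 23)"
  proof (intro bex_cong refl)
    fix e :: nat
    have "e * e mod 23 = (j + (23 - i)) mod 23 \<longleftrightarrow> [e * e = j + (23 - i)] (mod 23)"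
      by (simp add: cong_def)
    also have "\<dots> \<longleftrightarrow> [i + e * e = i + (j + (23 - i))] (mod 23)"
      by (simp add: cong_add_lcancel_nat)
    also have "i + (j + (23 - i)) = j + 23" using True by simp
    also have "[i + e * e = j + 23] (mod 23) \<longleftrightarrow> (i + e * e) mod 23 = j mod 23"
      by (simp add: cong_def)
    finally show "(e * e mod 23 = (j + (23 - i)) mod 23) = ((i + e * e) mod 23 = j mod 23)" .
  qed
  also have "\<dots> \<longleftrightarrow> (\<exists>e\<in>{1..<23}. (of_nat j :: 23) = of_nat i + of_nat e ^ 2)"
    by (simp add: of_nat_23_eq_iff power2_eq_square eq_commute flip: of_nat_add of_nat_mult)
  also have "\<dots> \<longleftrightarrow> (\<exists>b\<noteq>0. (of_nat j :: 23) = of_nat i + b ^ 2)"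
  proof
    assume "\<exists>e\<in>{1..<23}. (of_nat j :: 23) = of_nat i + of_nat e ^ 2"
    then obtain e where e: "1 \<le> e" "e < 23" "(of_nat j :: 23) = of_nat i + of_nat e ^ 2" by auto
    then have "(of_nat e :: 23) \<noteq> 0"
      using of_nat_23_eq_iff[of e 0] by simp
    with e show "\<exists>b\<noteq>0. (of_nat j :: 23) = of_nat i + b ^ 2" by blast
  next
    assume "\<exists>b\<noteq>0. (of_nat j :: 23) = of_nat i + b ^ 2"
    then obtain b where b: "b \<noteq> 0" "(of_nat j :: 23) = of_nat i + b ^ 2" by auto
    obtain e where e: "e < 23" "b = of_nat e" using range_of_nat_23 by blast
    with b have "e \<noteq> 0" by (intro notI) simp
    with e b show "\<exists>e\<in>{1..<23}. (of_nat j :: 23) = of_nat i + of_nat e ^ 2"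
      by (intro bexI[of _ e]) auto
  qed
  finally show ?thesis
    using True by (auto simp: point_def golay_generator_def)
next
  case False
  with assms consider "i = 23" | "i < 23" "j = 23" by linarith
  then show ?thesis
  proof cases
    case 1
    with assms show ?thesis by (simp add: golay_row_def point_def golay_generator_def)
  next
    case 2
    then show ?thesis by (simp add: golay_row_def point_def golay_generator_def nth_append residue_word_def)
  qed
qed

definition golay_rows :: "bool list list" where
  "golay_rows = map golay_row [0..<24]"

lemma golay_rows_eq: "golay_rows = [
   [False,True,True,True,True,False,True,False,True,True,False,False,True,True,False,False,True,False,True,False,False,False,False,True],
   [False,False,True,True,True,True,False,True,False,True,True,False,False,True,True,False,False,True,False,True,False,False,False,True],
   [False,False,False,True,True,True,True,False,True,False,True,True,False,False,True,True,False,False,True,False,True,False,False,True],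
   [False,False,False,False,True,True,True,True,False,True,False,True,True,False,False,True,True,False,False,True,False,True,False,True],
   [False,False,False,False,False,True,True,True,True,False,True,False,True,True,False,False,True,True,False,False,True,False,True,True],
   [True,False,False,False,False,False,True,True,True,True,False,True,False,True,True,False,False,True,True,False,False,True,False,True],
   [False,True,False,False,False,False,False,True,True,True,True,False,True,False,True,True,False,False,True,True,False,False,True,True],
   [True,False,True,False,False,False,False,False,True,True,True,True,False,True,False,True,True,False,False,True,True,False,False,True],
   [False,True,False,True,False,False,False,False,False,True,True,True,True,False,True,False,True,True,False,False,True,True,False,True],
   [False,False,True,False,True,False,False,False,False,False,True,True,True,True,False,True,False,True,True,False,False,True,True,True],
   [True,False,False,True,False,True,False,False,False,False,False,True,True,True,True,False,True,False,True,True,False,False,True,True],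
   [True,True,False,False,True,False,True,False,False,False,False,False,True,True,True,True,False,True,False,True,True,False,False,True],
   [False,True,True,False,False,True,False,True,False,False,False,False,False,True,True,True,True,False,True,False,True,True,False,True],
   [False,False,True,True,False,False,True,False,True,False,False,False,False,False,True,True,True,True,False,True,False,True,True,True],
   [True,False,False,True,True,False,False,True,False,True,False,False,False,False,False,True,True,True,True,False,True,False,True,True],
   [True,True,False,False,True,True,False,False,True,False,True,False,False,False,False,False,True,True,True,True,False,True,False,True],
   [False,True,True,False,False,True,True,False,False,True,False,True,False,False,False,False,False,True,True,True,True,False,True,True],
   [True,False,True,True,False,False,True,True,False,False,True,False,True,False,False,False,False,False,True,True,True,True,False,True],
   [False,True,False,True,True,False,False,True,True,False,False,True,False,True,False,False,False,False,False,True,True,True,True,True],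
   [True,False,True,False,True,True,False,False,True,True,False,False,True,False,True,False,False,False,False,False,True,True,True,True],
   [True,True,False,True,False,True,True,False,False,True,True,False,False,True,False,True,False,False,False,False,False,True,True,True],
   [True,True,True,False,True,False,True,True,False,False,True,True,False,False,True,False,True,False,False,False,False,False,True,True],
   [True,True,True,True,False,True,False,True,True,False,False,True,True,False,False,True,False,True,False,False,False,False,False,True],
   [True,True,True,True,True,True,True,True,True,True,True,True,True,True,True,True,True,True,True,True,True,True,True,True]]"
  by (simp add: golay_rows_def golay_row_def residue_word_def upt_rec rotate_drop_take)

lemma golay_rows_nth: "i < 24 \<Longrightarrow> golay_rows ! i = golay_row i"
  by (simp add: golay_rows_def)

lemma card_as_filter:
  assumes "length v = 24"
  shows "card {j. \<exists>c<24. j = point c \<and> v ! c} = length (filter id v)"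
proof -
  have "{j. \<exists>c<24. j = point c \<and> v ! c} = point ` {c. c < 24 \<and> v ! c}" by auto
  moreover have "inj_on point {c. c < 24 \<and> v ! c}"
    by (rule inj_on_subset[OF inj_on_point]) auto
  ultimately show ?thesis
    using assms by (simp add: card_image length_filter_conv_card)
qed

lemma golay_generator_point:
  assumes "i < 24"
  shows "golay_generator (point i) = {j. \<exists>c<24. j = point c \<and> golay_row i ! c}"
proof (rule set_eqI)
  fix j
  obtain c where c: "c < 24" "j = point c" by (rule point_cases)
  then show "j \<in> golay_generator (point i) \<longleftrightarrow> j \<in> {j. \<exists>c<24. j = point c \<and> golay_row i ! c}"
    using golay_row_nth[OF assms c(1)] by (auto dest: point_inject)
qed

lemma golay_generator_weight: "4 dvd card (golay_generator i)"
proof -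
  obtain k where k: "k < 24" "i = point k" by (rule point_cases)
  have "list_all (\<lambda>v. length (filter id v) = 12 \<or> length (filter id v) = 24) golay_rows"
    by (simp add: golay_rows_eq)
  with k(1) have "length (filter id (golay_row k)) = 12 \<or> length (filter id (golay_row k)) = 24"
    by (simp add: golay_rows_def list_all_iff)
  then show ?thesis
    unfolding k(2) golay_generator_point[OF k(1)] by (subst card_as_filter) auto
qed

fun overlap_parity :: "bool list \<Rightarrow> bool list \<Rightarrow> bool" where
  "overlap_parity (a # v) (b # w) \<longleftrightarrow> (a \<and> b) \<noteq> overlap_parity v w"
| "overlap_parity _ _ \<longleftrightarrow> False"

lemma overlap_parity: "overlap_parity v w \<longleftrightarrow> odd (length (filter id (map2 (\<and>) v w)))"
  by (induction v w rule: overlap_parity.induct) auto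

lemma golay_generators_orthogonal: "even (card (golay_generator i \<inter> golay_generator j))"
proof -
  obtain k where k: "k < 24" "i = point k" by (rule point_cases)
  obtain l where l: "l < 24" "j = point l" by (rule point_cases)
  have "list_all (\<lambda>v. list_all (\<lambda>w. \<not> overlap_parity v w) golay_rows) golay_rows"
    by (simp add: golay_rows_eq)
  then have ev: "even (length (filter id (map2 (\<and>) (golay_row k) (golay_row l))))"
    using k(1) l(1) by (simp add: golay_rows_def list_all_iff overlap_parity)
  have nth: "map2 (\<and>) (golay_row k) (golay_row l) ! c \<longleftrightarrow> golay_row k ! c \<and> golay_row l ! c"
    if "c < 24" for c using that by simp
  have "golay_generator i \<inter> golay_generator j =
      {p. \<exists>c<24. p = point c \<and> map2 (\<and>) (golay_row k) (golay_row l) ! c}"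
    unfolding k(2) l(2) golay_generator_point[OF k(1)] golay_generator_point[OF l(1)]
    by (fastforce dest: point_inject simp: nth)
  with ev show ?thesis by (subst (asm) card_as_filter[symmetric]) auto
qed

lemma golay_code_orthogonal:
  assumes "A \<in> golay_code"
  shows "even (card (A \<inter> golay_generator i))"
  using assms
proof (induction rule: golay_code_induct)
  case (sym_diff A j)
  have "sym_diff A (golay_generator j) \<inter> golay_generator i =
      sym_diff (A \<inter> golay_generator i) (golay_generator j \<inter> golay_generator i)" by auto
  with sym_diff golay_generators_orthogonal[of j i]
    odd_card_sym_diff[of "A \<inter> golay_generator i" "golay_generator j \<inter> golay_generator i"]
  show ?case by simp
qed simp

lemma golay_code_self_orthogonal:
  assumes "A \<in> golay_code" "B \<in> golay_code"
  shows "even (card (A \<inter> B))"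
  using assms(2)
proof (induction rule: golay_code_induct)
  case (sym_diff B j)
  have "A \<inter> sym_diff B (golay_generator j) = sym_diff (A \<inter> B) (A \<inter> golay_generator j)" by auto
  with sym_diff golay_code_orthogonal[OF assms(1), of j]
    odd_card_sym_diff[of "A \<inter> B" "A \<inter> golay_generator j"]
  show ?case by simp
qed simp

text \<open>Adding a generator \<open>B\<close> changes the weight by
  \<open>card B - 2 * card (A \<inter> B)\<close>. Orthogonality and the generator weights make this
  a multiple of four.\<close>

lemma golay_code_doubly_even:
  assumes "A \<in> golay_code"
  shows "4 dvd card A"
  using assms
proof (induction rule: golay_code_induct)
  case (sym_diff A j)
  let ?B = "golay_generator j"
  have "card (sym_diff A ?B) + 2 * card (A \<inter> ?B) = card A + card ?B"
  proof -
    have "card (sym_diff A ?B) = card (A - ?B) + card (?B - A)"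
      by (intro card_Un_disjoint) auto
    moreover have "card A = card (A - ?B) + card (A \<inter> ?B)" "card ?B = card (?B - A) + card (A \<inter> ?B)"
      by (simp_all add: card_Diff_subset_Int Int_commute card_mono)
    ultimately show ?thesis by simp
  qed
  moreover have "4 dvd 2 * card (A \<inter> ?B)"
    using golay_code_orthogonal[OF sym_diff(1), of j] by (auto elim!: evenE)
  moreover have "4 dvd card A + card ?B"
    using sym_diff golay_generator_weight[of j] by simp
  ultimately show ?case by (metis dvd_add_left_iff)
qed simp

text \<open>Restricted to the generators 0 to 11, whose columns already tell all 24 points
  apart.\<close>

definition golay_columns :: "bool list list" where
  "golay_columns = map (\<lambda>j. map (\<lambda>i. golay_rows ! i ! j) [0..<12]) [0..<24]"

lemma golay_columns_eq: "golay_columns = [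
   [False, False, False, False, False, True, False, True, False, False, True, True],
   [True, False, False, False, False, False, True, False, True, False, False, True],
   [True, True, False, False, False, False, False, True, False, True, False, False],
   [True, True, True, False, False, False, False, False, True, False, True, False],
   [True, True, True, True, False, False, False, False, False, True, False, True],
   [False, True, True, True, True, False, False, False, False, False, True, False],
   [True, False, True, True, True, True, False, False, False, False, False, True],
   [False, True, False, True, True, True, True, False, False, False, False, False],
   [True, False, True, False, True, True, True, True, False, False, False, False],
   [True, True, False, True, False, True, True, True, True, False, False, False],
   [False, True, True, False, True, False, True, True, True, True, False, False],
   [False, False, True, True, False, True, False, True, True, True, True, False],
   [True, False, False, True, True, False, True, False, True, True, True, True],
   [True, True, False, False, True, True, False, True, False, True, True, True],
   [False, True, True, False, False, True, True, False, True, False, True, True],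
   [False, False, True, True, False, False, True, True, False, True, False, True],
   [True, False, False, True, True, False, False, True, True, False, True, False],
   [False, True, False, False, True, True, False, False, True, True, False, True],
   [True, False, True, False, False, True, True, False, False, True, True, False],
   [False, True, False, True, False, False, True, True, False, False, True, True],
   [False, False, True, False, True, False, False, True, True, False, False, True],
   [False, False, False, True, False, True, False, False, True, True, False, False],
   [False, False, False, False, True, False, True, False, False, True, True, False],
   [True, True, True, True, True, True, True, True, True, True, True, True]]"
  by (simp add: golay_columns_def golay_rows_eq upt_rec)

lemma golay_columns_nth:
  "j < 24 \<Longrightarrow> golay_columns ! j = map (\<lambda>i. point j \<in> golay_generator (point i)) [0..<12]"
  by (simp add: golay_columns_def golay_rows_nth golay_row_nth)

lemma distinct_golay_columns: "distinct golay_columns"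
  by (simp add: golay_columns_eq)

lemma golay_code_separates:
  assumes "i \<noteq> j"
  obtains k where "i \<in> golay_generator k \<longleftrightarrow> j \<notin> golay_generator k"
proof -
  obtain a where a: "a < 24" "i = point a" by (rule point_cases)
  obtain b where b: "b < 24" "j = point b" by (rule point_cases)
  have "golay_columns ! a \<noteq> golay_columns ! b"
    using assms a b distinct_golay_columns nth_eq_iff_index_eq[of golay_columns a b]
    by (auto simp: golay_columns_def)
  then show thesis
    using that a b by (auto simp: golay_columns_nth)
qed

section \<open>Systematic bases and exclusion of weight four\<close>

definition word_set :: "bool list \<Rightarrow> 23 option set" where
  "word_set v = {j. \<exists>c<24. j = point c \<and> v ! c}"

lemma point_in_word_set: "c < 24 \<Longrightarrow> point c \<in> word_set v \<longleftrightarrow> v ! c"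
  by (auto simp: word_set_def dest: point_inject)

definition golay_word :: "nat list \<Rightarrow> bool list" where
  "golay_word I = foldr (\<lambda>i. map2 (\<noteq>) (golay_rows ! i)) I (map (\<lambda>_. False) [0..<24])"

lemma length_golay_word: "set I \<subseteq> {..<24} \<Longrightarrow> length (golay_word I) = 24"
  by (induction I) (simp_all add: golay_word_def golay_rows_nth)

lemma golay_word_in_golay_code: "set I \<subseteq> {..<24} \<Longrightarrow> word_set (golay_word I) \<in> golay_code"
proof (induction I)
  case Nil
  have "word_set (golay_word []) = {}" by (auto simp: word_set_def golay_word_def)
  then show ?case by (simp add: empty_in_golay_code)
next
  case (Cons i I)
  have "word_set (golay_word (i # I)) = sym_diff (word_set (golay_word I)) (golay_generator (point i))"
  proof (rule set_eqI)
    fix j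
    obtain c where c: "c < 24" "j = point c" by (rule point_cases)
    have "golay_word (i # I) ! c \<longleftrightarrow> golay_row i ! c \<noteq> golay_word I ! c"
      using Cons.prems c length_golay_word[of I] by (simp add: golay_word_def golay_rows_nth)
    then show "j \<in> word_set (golay_word (i # I))
      \<longleftrightarrow> j \<in> sym_diff (word_set (golay_word I)) (golay_generator (point i))"
      using c golay_row_nth[of i c] Cons.prems by (auto simp: point_in_word_set)
  qed
  with Cons show ?case by (simp add: sym_diff_in_golay_code golay_generator_in_code)
qed

text \<open>The first basis is in systematic form on the points \<open>0, \<dots>, 11\<close>, the second one on the
  remaining points. Hence a codeword with at most two points in one of the halves is determined by
  these points, which excludes words of weight four.\<close>

definition basis_indices1 :: "nat list list" where
  "basis_indices1 = [[1, 2, 6, 9, 11], [0, 1, 4], [5, 6, 9, 11], [0, 1, 2, 3, 4, 6], [1, 2, 3, 4, 5, 7], [1, 3, 4, 5, 8, 9, 11], [0, 1, 3, 5, 6, 7, 9], [1, 2, 4, 6, 7, 8, 10], [1, 3, 5, 6, 7, 8], [1, 4, 7, 8, 11], [0, 2, 3, 4, 5, 6, 7, 8, 10, 11], [0, 1, 5, 8, 10]]"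

definition basis_indices2 :: "nat list list" where
  "basis_indices2 = [[1, 3, 4, 5, 7, 8, 9, 11], [0, 4, 6, 11], [0, 2, 3, 4, 5, 10], [1, 3, 4, 5, 6, 11], [0, 1, 3, 5, 6, 10], [2, 3, 5, 6, 8, 9], [1, 5, 6, 8, 10, 11], [0, 5, 6, 7, 8, 10], [1, 6, 7, 8, 9, 11], [0, 5, 7, 11], [0, 2, 3, 4, 6, 7, 8, 10], [0, 1, 5, 6, 7, 9, 11]]"

lemma basis1_eq: "map golay_word basis_indices1 = [
   [True, False, False, False, False, False, False, False, False, False, False, False, True, True, False, False, False, True, True, True, False, True, False, True],
   [False, True, False, False, False, False, False, False, False, False, False, False, False, True, True, False, False, False, True, True, True, False, True, True],
   [False, False, True, False, False, False, False, False, False, False, False, False, True, True, True, True, False, True, True, False, True, False, False, False],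
   [False, False, False, True, False, False, False, False, False, False, False, False, False, True, True, True, True, False, True, True, False, True, False, False],
   [False, False, False, False, True, False, False, False, False, False, False, False, False, False, True, True, True, True, False, True, True, False, True, False],
   [False, False, False, False, False, True, False, False, False, False, False, False, True, True, False, True, True, False, False, True, True, False, False, True],
   [False, False, False, False, False, False, True, False, False, False, False, False, False, True, True, False, True, True, False, False, True, True, False, True],
   [False, False, False, False, False, False, False, True, False, False, False, False, False, False, True, True, False, True, True, False, False, True, True, True],
   [False, False, False, False, False, False, False, False, True, False, False, False, True, True, False, True, True, True, False, False, False, True, True, False],
   [False, False, False, False, False, False, False, False, False, True, False, False, True, False, True, False, True, False, False, True, False, True, True, True],
   [False, False, False, False, False, False, False, False, False, False, True, False, True, False, False, True, False, False, True, True, True, True, True, False],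
   [False, False, False, False, False, False, False, False, False, False, False, True, True, False, False, False, True, True, True, False, True, False, True, True]]"
  by (simp add: golay_word_def basis_indices1_def golay_rows_eq upt_rec)

lemma basis2_eq: "map golay_word basis_indices2 = [
   [True, False, True, False, False, True, False, False, True, True, True, True, True, False, False, False, False, False, False, False, False, False, False, False],
   [True, True, True, True, False, True, True, False, True, False, False, False, False, True, False, False, False, False, False, False, False, False, False, False],
   [False, True, True, True, True, False, True, True, False, True, False, False, False, False, True, False, False, False, False, False, False, False, False, False],
   [False, False, True, True, True, True, False, True, True, False, True, False, False, False, False, True, False, False, False, False, False, False, False, False],
   [False, False, False, True, True, True, True, False, True, True, False, True, False, False, False, False, True, False, False, False, False, False, False, False],
   [True, False, True, False, True, False, True, True, True, False, False, True, False, False, False, False, False, True, False, False, False, False, False, False],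
   [True, True, True, True, False, False, False, True, False, False, True, True, False, False, False, False, False, False, True, False, False, False, False, False],
   [True, True, False, True, True, True, False, False, False, True, True, False, False, False, False, False, False, False, False, True, False, False, False, False],
   [False, True, True, False, True, True, True, False, False, False, True, True, False, False, False, False, False, False, False, False, True, False, False, False],
   [True, False, False, True, False, False, True, True, True, True, True, False, False, False, False, False, False, False, False, False, False, True, False, False],
   [False, True, False, False, True, False, False, True, True, True, True, True, False, False, False, False, False, False, False, False, False, False, True, False],
   [True, True, False, False, False, True, True, True, False, True, False, True, False, False, False, False, False, False, False, False, False, False, False, True]]"
  by (simp add: golay_word_def basis_indices2_def golay_rows_eq upt_rec)

definition basis1 :: "nat \<Rightarrow> 23 option set" where
  "basis1 k = word_set (map golay_word basis_indices1 ! k)"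

definition basis2 :: "nat \<Rightarrow> 23 option set" where
  "basis2 k = word_set (map golay_word basis_indices2 ! k)"

lemma basis_in_golay_code:
  assumes "k < 12"
  shows "basis1 k \<in> golay_code" "basis2 k \<in> golay_code"
proof -
  have "list_all (\<lambda>I. set I \<subseteq> {..<24}) basis_indices1" "list_all (\<lambda>I. set I \<subseteq> {..<24}) basis_indices2"
    by (simp_all add: basis_indices1_def basis_indices2_def)
  moreover have "length basis_indices1 = 12" "length basis_indices2 = 12"
    by (simp_all add: basis_indices1_def basis_indices2_def)
  ultimately show "basis1 k \<in> golay_code" "basis2 k \<in> golay_code"
    using assms by (simp_all add: basis1_def basis2_def golay_word_in_golay_code list_all_length)
qed

lemma basis1_systematic: "k < 12 \<Longrightarrow> c < 12 \<Longrightarrow> point c \<in> basis1 k \<longleftrightarrow> c = k"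
proof -
  have "\<forall>k\<in>set [0..<12]. \<forall>c\<in>set [0..<12]. map golay_word basis_indices1 ! k ! c \<longleftrightarrow> c = k"
    unfolding basis1_eq by (simp add: upt_rec)
  then show "k < 12 \<Longrightarrow> c < 12 \<Longrightarrow> point c \<in> basis1 k \<longleftrightarrow> c = k"
    by (simp add: basis1_def point_in_word_set)
qed

lemma basis2_systematic: "k < 12 \<Longrightarrow> c < 12 \<Longrightarrow> point (12 + c) \<in> basis2 k \<longleftrightarrow> c = k"
proof -
  have "\<forall>k\<in>set [0..<12]. \<forall>c\<in>set [0..<12]. map golay_word basis_indices2 ! k ! (12 + c) \<longleftrightarrow> c = k"
    unfolding basis2_eq by (simp add: upt_rec)
  then show "k < 12 \<Longrightarrow> c < 12 \<Longrightarrow> point (12 + c) \<in> basis2 k \<longleftrightarrow> c = k"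
    by (simp add: basis2_def point_in_word_set)
qed

lemma basis1_columns:
  "map (\<lambda>q. map (\<lambda>k. point (12 + q) \<in> basis1 k) [0..<12]) [0..<12] = [
   [True, False, True, False, False, True, False, False, True, True, True, True],
   [True, True, True, True, False, True, True, False, True, False, False, False],
   [False, True, True, True, True, False, True, True, False, True, False, False],
   [False, False, True, True, True, True, False, True, True, False, True, False],
   [False, False, False, True, True, True, True, False, True, True, False, True],
   [True, False, True, False, True, False, True, True, True, False, False, True],
   [True, True, True, True, False, False, False, True, False, False, True, True],
   [True, True, False, True, True, True, False, False, False, True, True, False],
   [False, True, True, False, True, True, True, False, False, False, True, True],
   [True, False, False, True, False, False, True, True, True, True, True, False],
   [False, True, False, False, True, False, False, True, True, True, True, True],
   [True, True, False, False, False, True, True, True, False, True, False, True]]"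
proof -
  have "map (\<lambda>q. map (\<lambda>k. point (12 + q) \<in> basis1 k) [0..<12]) [0..<12]
     = map (\<lambda>q. map (\<lambda>k. map golay_word basis_indices1 ! k ! (12 + q)) [0..<12]) [0..<12]"
    by (simp add: basis1_def point_in_word_set del: nth_map)
  also have "\<dots> = [
   [True, False, True, False, False, True, False, False, True, True, True, True],
   [True, True, True, True, False, True, True, False, True, False, False, False],
   [False, True, True, True, True, False, True, True, False, True, False, False],
   [False, False, True, True, True, True, False, True, True, False, True, False],
   [False, False, False, True, True, True, True, False, True, True, False, True],
   [True, False, True, False, True, False, True, True, True, False, False, True],
   [True, True, True, True, False, False, False, True, False, False, True, True],
   [True, True, False, True, True, True, False, False, False, True, True, False],
   [False, True, True, False, True, True, True, False, False, False, True, True],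
   [True, False, False, True, False, False, True, True, True, True, True, False],
   [False, True, False, False, True, False, False, True, True, True, True, True],
   [True, True, False, False, False, True, True, True, False, True, False, True]]"
    unfolding basis1_eq by (simp add: upt_rec)
  finally show ?thesis .
qed

lemma basis2_columns:
  "map (\<lambda>q. map (\<lambda>k. point q \<in> basis2 k) [0..<12]) [0..<12] = [
   [True, True, False, False, False, True, True, True, False, True, False, True],
   [False, True, True, False, False, False, True, True, True, False, True, True],
   [True, True, True, True, False, True, True, False, True, False, False, False],
   [False, True, True, True, True, False, True, True, False, True, False, False],
   [False, False, True, True, True, True, False, True, True, False, True, False],
   [True, True, False, True, True, False, False, True, True, False, False, True],
   [False, True, True, False, True, True, False, False, True, True, False, True],
   [False, False, True, True, False, True, True, False, False, True, True, True],
   [True, True, False, True, True, True, False, False, False, True, True, False],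
   [True, False, True, False, True, False, False, True, False, True, True, True],
   [True, False, False, True, False, False, True, True, True, True, True, False],
   [True, False, False, False, True, True, True, False, True, False, True, True]]"
proof -
  have "map (\<lambda>q. map (\<lambda>k. point q \<in> basis2 k) [0..<12]) [0..<12]
     = map (\<lambda>q. map (\<lambda>k. map golay_word basis_indices2 ! k ! q) [0..<12]) [0..<12]"
    by (simp add: basis2_def point_in_word_set del: nth_map)
  also have "\<dots> = [
   [True, True, False, False, False, True, True, True, False, True, False, True],
   [False, True, True, False, False, False, True, True, True, False, True, True],
   [True, True, True, True, False, True, True, False, True, False, False, False],
   [False, True, True, True, True, False, True, True, False, True, False, False],
   [False, False, True, True, True, True, False, True, True, False, True, False],
   [True, True, False, True, True, False, False, True, True, False, False, True],
   [False, True, True, False, True, True, False, False, True, True, False, True],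
   [False, False, True, True, False, True, True, False, False, True, True, True],
   [True, True, False, True, True, True, False, False, False, True, True, False],
   [True, False, True, False, True, False, False, True, False, True, True, True],
   [True, False, False, True, False, False, True, True, True, True, True, False],
   [True, False, False, False, True, True, True, False, True, False, True, True]]"
    unfolding basis2_eq by (simp add: upt_rec)
  finally show ?thesis .
qed

text \<open>In the half enumerated by \<open>c\<close> the word \<open>w k\<close> has the single
  point \<open>c k\<close>, and its whole intersection with \<open>A\<close> is even. So the points
  of \<open>A\<close> in the other half decide whether \<open>c k\<close> lies in
  \<open>A\<close>.\<close>

lemma codeword_half:
  fixes w :: "nat \<Rightarrow> 23 option set"
  assumes A: "A \<in> golay_code" and w: "\<And>k. k < 12 \<Longrightarrow> w k \<in> golay_code"
    and sys: "\<And>k l. k < 12 \<Longrightarrow> l < 12 \<Longrightarrow> c l \<in> w k \<longleftrightarrow> l = k"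
  shows "{k. k < 12 \<and> c k \<in> A} = {k. k < 12 \<and> odd (card ((A - c ` {..<12}) \<inter> w k))}"
proof (intro Collect_cong conj_cong refl)
  fix k :: nat assume k: "k < 12"
  have "A \<inter> w k = ((A - c ` {..<12}) \<inter> w k) \<union> (A \<inter> {c k})"
    using sys[OF k] k by auto
  moreover have "card (((A - c ` {..<12}) \<inter> w k) \<union> (A \<inter> {c k})) = card ((A - c ` {..<12}) \<inter> w k) + card (A \<inter> {c k})"
    using k by (intro card_Un_disjoint) auto
  moreover have "even (card (A \<inter> w k))"
    by (rule golay_code_self_orthogonal[OF A w[OF k]])
  moreover have "card (A \<inter> {c k}) = (if c k \<in> A then 1 else 0)" by auto
  ultimately show "c k \<in> A \<longleftrightarrow> odd (card ((A - c ` {..<12}) \<inter> w k))"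
    by (auto split: if_splits)
qed

lemma card_point_half:
  assumes "inj_on c {..<12::nat}"
  shows "card (A \<inter> c ` {..<12}) = card {k. k < 12 \<and> c k \<in> A}"
proof -
  have "A \<inter> c ` {..<12} = c ` {k. k < 12 \<and> c k \<in> A}" by auto
  then show ?thesis using assms by (simp add: card_image inj_on_def)
qed

lemma card_column:
  "card {k. k < n \<and> P k} = length (filter P [0..<n])"
proof -
  have "{k. k < n \<and> P k} = set (filter P [0..<n])" by auto
  then show ?thesis
    by (metis distinct_card distinct_filter distinct_upt)
qed

text \<open>By \<open>codeword_half\<close>, a codeword whose only point in the second half is
  \<open>point (12 + q)\<close> has this column as its first half; weight four would take three
  entries there.\<close>

lemma basis1_column_weights:
  assumes "q < 12"
  shows "card {k. k < 12 \<and> point (12 + q) \<in> basis1 k} \<noteq> 3"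
proof -
  have "list_all (\<lambda>c. length (filter id c) \<noteq> 3)
      (map (\<lambda>q. map (\<lambda>k. point (12 + q) \<in> basis1 k) [0..<12]) [0..<12])"
    unfolding basis1_columns by simp
  then have "\<forall>q<12. length (filter id (map (\<lambda>k. point (12 + q) \<in> basis1 k) [0..<12])) \<noteq> 3"
    by (auto simp: list_all_iff simp del: upt_Suc)
  with assms show ?thesis by (simp add: card_column filter_map comp_def)
qed

lemma basis2_column_weights:
  assumes "q < 12"
  shows "card {k. k < 12 \<and> point q \<in> basis2 k} \<noteq> 3"
proof -
  have "list_all (\<lambda>c. length (filter id c) \<noteq> 3)
      (map (\<lambda>q. map (\<lambda>k. point q \<in> basis2 k) [0..<12]) [0..<12])"
    unfolding basis2_columns by simp
  then have "\<forall>q<12. length (filter id (map (\<lambda>k. point q \<in> basis2 k) [0..<12])) \<noteq> 3"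
    by (auto simp: list_all_iff simp del: upt_Suc)
  with assms show ?thesis by (simp add: card_column filter_map comp_def)
qed

text \<open>Two points in the second half make the first half the sum of their columns, and weight
  four would require a sum of weight two.\<close>

lemma basis1_column_pairs:
  assumes "q < 12" "r < 12"
  shows "card {k. k < 12 \<and> (point (12 + q) \<in> basis1 k) \<noteq> (point (12 + r) \<in> basis1 k)} \<noteq> 2"
proof -
  let ?c = "\<lambda>q. map (\<lambda>k. point (12 + q) \<in> basis1 k) [0..<12]"
  have "list_all (\<lambda>c. list_all (\<lambda>d. length (filter id (map2 (\<noteq>) c d)) \<noteq> 2) (map ?c [0..<12])) (map ?c [0..<12])"
    unfolding basis1_columns by simp
  then have *: "length (filter id (map2 (\<noteq>) (?c q) (?c r))) \<noteq> 2"
    using assms by (auto simp: list_all_iff simp del: upt_Suc)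
  have eq: "map2 (\<noteq>) (?c q) (?c r) = map (\<lambda>k. (point (12 + q) \<in> basis1 k) \<noteq> (point (12 + r) \<in> basis1 k)) [0..<12]"
    by (rule nth_equalityI) auto
  from * show ?thesis
    unfolding eq card_column by (simp add: filter_map comp_def)
qed

lemma golay_code_card_neq_4:
  assumes A: "A \<in> golay_code"
  shows "card A \<noteq> 4"
proof
  assume 4: "card A = 4"
  let ?L = "point ` {..<12}" and ?c = "\<lambda>k. point (12 + k)"
  let ?R = "?c ` {..<12}"
  have injL: "inj_on point {..<12}" by (rule inj_on_subset[OF inj_on_point]) auto
  have injR: "inj_on ?c {..<12}" by (auto simp: inj_on_def dest: point_inject)
  have cover: "j \<in> ?L \<or> j \<in> ?R" for j
  proof -
    obtain c where "c < 24" "j = point c" by (rule point_cases)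
    then show ?thesis by (cases "c < 12") (auto intro!: image_eqI[of _ _ "c - 12"])
  qed
  have disj: "?L \<inter> ?R = {}" by (auto dest: point_inject)
  have half: "A - ?L = A \<inter> ?R" "A - ?R = A \<inter> ?L" using cover disj by auto
  have h1: "{k. k < 12 \<and> point k \<in> A} = {k. k < 12 \<and> odd (card ((A - ?L) \<inter> basis1 k))}"
    by (rule codeword_half[OF A basis_in_golay_code(1) basis1_systematic])
  have h2: "{k. k < 12 \<and> ?c k \<in> A} = {k. k < 12 \<and> odd (card ((A - ?R) \<inter> basis2 k))}"
    by (rule codeword_half[OF A basis_in_golay_code(2) basis2_systematic])
  have sum: "card (A \<inter> ?L) + card (A \<inter> ?R) = 4"
  proof -
    have "A = (A \<inter> ?L) \<union> (A \<inter> ?R)" using cover by auto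
    moreover have "card ((A \<inter> ?L) \<union> (A \<inter> ?R)) = card (A \<inter> ?L) + card (A \<inter> ?R)"
      using disj by (intro card_Un_disjoint) auto
    ultimately show ?thesis using 4 by simp
  qed
  have L: "card (A \<inter> ?L) = card {k. k < 12 \<and> odd (card ((A \<inter> ?R) \<inter> basis1 k))}"
    using card_point_half[OF injL, of A] h1 half by simp
  have R: "card (A \<inter> ?R) = card {k. k < 12 \<and> odd (card ((A \<inter> ?L) \<inter> basis2 k))}"
    using card_point_half[OF injR, of A] h2 half by simp
  have single: "odd (card ({p} \<inter> B)) \<longleftrightarrow> p \<in> B" for p :: "23 option" and B
    by (cases "p \<in> B") auto
  \<comment> \<open>The splits 4 + 0, 3 + 1, 2 + 2, 1 + 3 and 0 + 4 of the points between the two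
    halves.\<close>
  consider "card (A \<inter> ?R) = 0" | "card (A \<inter> ?R) = 1" | "card (A \<inter> ?R) = 2" | "card (A \<inter> ?L) = 1" | "card (A \<inter> ?L) = 0"
    using sum by linarith
  then show False
  proof cases
    case 1
    then have "A \<inter> ?R = {}" by simp
    with L sum 1 show False by simp
  next
    case 2
    then obtain p where p: "A \<inter> ?R = {p}" using card_1_singletonE by blast
    then obtain q where "q < 12" "p = point (12 + q)" by auto
    with L sum 2 p basis1_column_weights[of q] show False by (simp add: single)
  next
    case 3
    then obtain p p' where p: "A \<inter> ?R = {p, p'}" "p \<noteq> p'" by (meson card_2_iff)
    then have "p \<in> ?R" "p' \<in> ?R" by blast+
    then obtain q r where "q < 12" "p = point (12 + q)" "r < 12" "p' = point (12 + r)" by auto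
    moreover have "odd (card ({p, p'} \<inter> B)) \<longleftrightarrow> (p \<in> B) \<noteq> (p' \<in> B)" for B
      using p(2) by (cases "p \<in> B"; cases "p' \<in> B") auto
    ultimately show False
      using L sum 3 p basis1_column_pairs[of q r] by simp
  next
    case 4
    then obtain p where p: "A \<inter> ?L = {p}" using card_1_singletonE by blast
    then obtain q where "q < 12" "p = point q" by auto
    with R sum 4 p basis2_column_weights[of q] show False by (simp add: single)
  next
    case 5
    then have "A \<inter> ?L = {}" by simp
    with R sum 5 show False by simp
  qed
qed

lemma card_Compl_23: "card (- A :: 23 option set) = 24 - card A"
  by (simp add: Compl_eq_Diff_UNIV card_Diff_subset card_UNIV_option)

lemma golay_code_weights:
  assumes A: "A \<in> golay_code"
  shows "card A \<in> {0, 8, 12, 16, 24}"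
proof -
  have "card A \<le> 24" using card_mono[of UNIV A] by (simp add: card_UNIV_option)
  moreover obtain m where "card A = 4 * m" using golay_code_doubly_even[OF A] by (rule dvdE)
  moreover have "card A \<noteq> 20"
    using golay_code_card_neq_4[OF Compl_in_golay_code[OF A]] by (auto simp: card_Compl_23)
  ultimately show ?thesis using golay_code_card_neq_4[OF A] by auto
qed

lemma golay_code_min_weight: "A \<in> golay_code \<Longrightarrow> A \<noteq> {} \<Longrightarrow> card A \<ge> 8"
  using golay_code_weights[of A] by auto

text \<open>Systematic form is what gives injectivity: a set of basis words can be read off from the
  first half of its sum.\<close>

lemma card_golay_code_ge: "card golay_code \<ge> 4096"
proof -
  let ?f = "parity_span basis1"
  have "inj_on ?f (Pow {..<12})"
  proof (rule inj_onI)
    fix S S' :: "nat set" assume S: "S \<in> Pow {..<12}" "S' \<in> Pow {..<12}" and eq: "?f S = ?f S'"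
    have *: "point c \<in> ?f S \<longleftrightarrow> c \<in> S" if "S \<subseteq> {..<12}" "c < 12" for S c
    proof -
      have "{i \<in> S. point c \<in> basis1 i} = (if c \<in> S then {c} else {})"
        using that basis1_systematic[of _ c] by auto
      then show ?thesis by (simp add: parity_span_def)
    qed
    show "S = S'"
    proof (rule set_eqI)
      fix c show "c \<in> S \<longleftrightarrow> c \<in> S'"
        using S eq *[of S c] *[of S' c] by (cases "c < 12") auto
    qed
  qed
  moreover have "?f ` Pow {..<12} \<subseteq> golay_code"
    by (auto intro!: parity_span_in_golay_code basis_in_golay_code intro: finite_subset)
  ultimately have "card (Pow {..<12::nat}) \<le> card golay_code"
    by (metis card_image card_mono finite)
  then show ?thesis by (simp add: card_Pow)
qed

section \<open>Second moment of the weights and the number of octads\<close>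

definition word_sign :: "'a set \<Rightarrow> 'a \<Rightarrow> int" where
  "word_sign A j = (if j \<in> A then -1 else 1)"

lemma sum_word_sign: "(\<Sum>j\<in>UNIV. word_sign A (j :: 23 option)) = 24 - 2 * int (card A)"
proof -
  have "word_sign A j = 1 - 2 * (if j \<in> A then 1 else 0)" for j :: "23 option"
    by (simp add: word_sign_def)
  then show ?thesis
    by (simp add: sum_subtractf card_UNIV_option sum.If_cases flip: sum_distrib_left)
qed

text \<open>Adding a generator that separates \<open>i\<close> from \<open>j\<close> is an
  involution of the code that flips the sign of every summand.\<close>

lemma golay_code_sign_correlation:
  assumes "i \<noteq> j"
  shows "(\<Sum>A\<in>golay_code. word_sign A i * word_sign A j) = 0"
proof -
  obtain k where k: "i \<in> golay_generator k \<longleftrightarrow> j \<notin> golay_generator k"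
    using golay_code_separates[OF assms] by blast
  let ?t = "\<lambda>A. sym_diff A (golay_generator k)"
  have t: "?t (?t A) = A" "A \<in> golay_code \<Longrightarrow> ?t A \<in> golay_code" for A
    by (auto intro!: sym_diff_in_golay_code golay_generator_in_code)
  have "(\<Sum>A\<in>golay_code. word_sign A i * word_sign A j) =
      (\<Sum>A\<in>golay_code. - (word_sign A i * word_sign A j))"
    by (rule sum.reindex_bij_witness[of _ ?t ?t]) (use t k in \<open>auto simp: word_sign_def\<close>)
  then show ?thesis by (simp add: sum_negf)
qed

text \<open>Distinct coordinates are uncorrelated over the code. As the weights are 0, 8, 12, 16, 24 and the
  code is closed under complements, this moment fixes the number of octads.\<close>

lemma golay_code_second_moment:
  "(\<Sum>A\<in>golay_code. (24 - 2 * int (card A))\<^sup>2) = 24 * int (card golay_code)"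
proof -
  have "(\<Sum>A\<in>golay_code. (24 - 2 * int (card A))\<^sup>2) =
      (\<Sum>A\<in>golay_code. \<Sum>i\<in>UNIV. \<Sum>j\<in>UNIV. word_sign A i * word_sign A (j :: 23 option))"
    by (simp add: sum_word_sign[symmetric] power2_eq_square sum_product)
  also have "\<dots> = (\<Sum>i\<in>UNIV. \<Sum>j\<in>UNIV. \<Sum>A\<in>golay_code. word_sign A i * word_sign A (j :: 23 option))"
    by (subst sum.swap, subst (2) sum.swap) (rule refl)
  also have "\<dots> = (\<Sum>i\<in>UNIV. \<Sum>j\<in>UNIV. if i = (j :: 23 option) then int (card golay_code) else 0 :: int)"
  proof (intro sum.cong refl)
    fix i j :: "23 option"
    have "word_sign A i * word_sign A i = 1" for A by (simp add: word_sign_def)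
    then show "(\<Sum>A\<in>golay_code. word_sign A i * word_sign A j) = (if i = j then int (card golay_code) else 0)"
      using golay_code_sign_correlation[of i j] by auto
  qed
  also have "\<dots> = 24 * int (card golay_code)" by (simp add: card_UNIV_option)
  finally show ?thesis .
qed

lemma card_octads_ge: "card {A \<in> golay_code. card A = 8} \<ge> 759"
proof -
  let ?O = "{A \<in> golay_code. card A = 8}" and ?O' = "{A \<in> golay_code. card A = 16}"
  have fin: "finite golay_code" by simp
  have O': "card ?O' = card ?O"
    by (rule bij_betw_same_card[of uminus], rule bij_betw_byWitness[of _ uminus])
       (auto simp: card_Compl_23 Compl_in_golay_code)
  have "24 * int (card golay_code) = (\<Sum>A\<in>golay_code. (24 - 2 * int (card A))\<^sup>2)"
    by (rule golay_code_second_moment[symmetric])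
  \<comment> \<open>The empty and the full word contribute \<open>24\<^sup>2\<close>, octads and
    their complements \<open>8\<^sup>2\<close>, and words of weight 12 nothing.\<close>
  also have "\<dots> = (\<Sum>A\<in>golay_code. (if A = {} then 576 else 0) + (if A = UNIV then 576 else 0)
      + (if card A = 8 then 64 else 0) + (if card A = 16 then 64 else 0))"
  proof (intro sum.cong refl)
    fix A assume "A \<in> golay_code"
    then consider "A = {}" | "A = UNIV" | "card A = 8" | "card A = 12" | "card A = 16"
      using golay_code_weights[of A] card_eq_UNIV_imp_eq_UNIV[of A] by (auto simp: card_UNIV_option)
    then show "(24 - 2 * int (card A))\<^sup>2 = (if A = {} then 576 else 0) + (if A = UNIV then 576 else 0)
      + (if card A = 8 then 64 else 0) + (if card A = 16 then 64 else 0)"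
      by cases (auto simp: card_UNIV_option)
  qed
  also have "\<dots> = 1152 + 64 * int (card ?O) + 64 * int (card ?O')"
    by (simp add: sum.distrib empty_in_golay_code UNIV_in_golay_code sum.If_cases Int_def)
  finally have "24 * int (card golay_code) = 1152 + 128 * int (card ?O)" using O' by simp
  with card_golay_code_ge show ?thesis by linarith
qed

section \<open>Minimal vectors of the Leech lattice\<close>

text \<open>Lattice vectors are handled through their integer coordinates before scaling by \<open>1 / sqrt 8\<close>, so
  that minimal norm 4 reads \<open>32\<close>.\<close>

definition leech_int :: "(23 option \<Rightarrow> int) \<Rightarrow> bool" where
  "leech_int a \<longleftrightarrow> (\<exists>m. (\<forall>i. [a i = m] (mod 2)) \<and> [(\<Sum>i\<in>UNIV. a i) = 4 * m] (mod 8) \<and>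
     (\<forall>k. {i. [a i = k] (mod 4)} \<in> golay_code))"

lemma leech_int_decomp:
  assumes "leech_int a"
  shows "\<exists>m S c. S \<in> golay_code \<and> (\<forall>i. a i = m + 2 * of_bool (i \<in> S) + 4 * c i) \<and>
    8 dvd sum a UNIV - 4 * m"
proof -
  obtain m where m: "\<And>i. [a i = m] (mod 2)" "[sum a UNIV = 4 * m] (mod 8)"
    "{i. [a i = m + 2] (mod 4)} \<in> golay_code"
    using assms unfolding leech_int_def by blast
  let ?S = "{i. [a i = m + 2] (mod 4)}"
  have "\<exists>c. a i = m + 2 * of_bool (i \<in> ?S) + 4 * c" for i
  proof (cases "i \<in> ?S")
    case True
    then have "4 dvd a i - (m + 2)" by (simp add: cong_iff_dvd_diff)
    then show ?thesis using True by (auto elim!: dvdE simp: algebra_simps)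
  next
    case False
    then have "\<not> 4 dvd a i - (m + 2)" by (simp add: cong_iff_dvd_diff)
    moreover have "2 dvd a i - m" using m(1)[of i] by (simp add: cong_iff_dvd_diff)
    ultimately have "4 dvd a i - m" by presburger
    then show ?thesis using False by (auto elim!: dvdE simp: algebra_simps)
  qed
  then have "\<forall>i. \<exists>c. a i = m + 2 * of_bool (i \<in> ?S) + 4 * c" by blast
  from choice[OF this] obtain c where c: "\<And>i. a i = m + 2 * of_bool (i \<in> ?S) + 4 * c i" by blast
  have "8 dvd sum a UNIV - 4 * m" using m(2) by (simp add: cong_iff_dvd_diff)
  with m(3) c show ?thesis by blast
qed

text \<open>Of the residue classes modulo 4, two are the supports \<open>S\<close> and
  \<open>- S\<close> and the others are empty, so a single codeword settles the condition for every
  \<open>k\<close>.\<close>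

lemma leech_intI:
  assumes S: "S \<in> golay_code" and a: "\<And>i. a i = m + 2 * of_bool (i \<in> S) + 4 * c i"
    and sum: "8 dvd sum a UNIV - 4 * m"
  shows "leech_int a"
  unfolding leech_int_def
proof (intro exI[of _ m] conjI allI)
  fix i show "[a i = m] (mod 2)" by (simp add: a cong_iff_dvd_diff)
next
  show "[sum a UNIV = 4 * m] (mod 8)" using sum by (simp add: cong_iff_dvd_diff)
next
  fix k
  have S': "[a i = k] (mod 4) \<longleftrightarrow> 4 dvd m - k + 2 * of_bool (i \<in> S)" for i
  proof -
    have "a i - k = (m - k + 2 * of_bool (i \<in> S)) + 4 * c i" by (simp add: a)
    then show ?thesis by (simp only: cong_iff_dvd_diff dvd_add_left_iff[OF dvd_triv_left])
  qed
  consider "4 dvd m - k" | "4 dvd m - k + 2" | "\<not> 4 dvd m - k" "\<not> 4 dvd m - k + 2" by blast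
  then show "{i. [a i = k] (mod 4)} \<in> golay_code"
  proof cases
    case 1
    then have "\<not> 4 dvd m - k + 2" by presburger
    with 1 have "{i. [a i = k] (mod 4)} = - S" by (auto simp: S' of_bool_def)
    with S show ?thesis by (simp add: Compl_in_golay_code)
  next
    case 2
    then have "\<not> 4 dvd m - k" by presburger
    with 2 have "{i. [a i = k] (mod 4)} = S" by (auto simp: S' of_bool_def)
    with S show ?thesis by simp
  next
    case 3
    then have "{i. [a i = k] (mod 4)} = {}" by (auto simp: S' of_bool_def)
    then show ?thesis by (simp add: empty_in_golay_code)
  qed
qed

lemma leech_int_diff:
  assumes "leech_int a" "leech_int b"
  shows "leech_int (\<lambda>i. a i - b i)"
proof -
  obtain m S c where a: "S \<in> golay_code" "\<And>i. a i = m + 2 * of_bool (i \<in> S) + 4 * c i"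
    "8 dvd sum a UNIV - 4 * m" using leech_int_decomp[OF assms(1)] by blast
  obtain m' S' c' where b: "S' \<in> golay_code" "\<And>i. b i = m' + 2 * of_bool (i \<in> S') + 4 * c' i"
    "8 dvd sum b UNIV - 4 * m'" using leech_int_decomp[OF assms(2)] by blast
  show ?thesis
  \<comment> \<open>On \<open>S' - S\<close> the marks differ by -2, which is 2 - 4; the last
    summand absorbs this 4.\<close>
  proof (rule leech_intI[of "sym_diff S S'" _ "m - m'" "\<lambda>i. c i - c' i - of_bool (i \<in> S' - S)"])
    show "sym_diff S S' \<in> golay_code" using a b by (intro sym_diff_in_golay_code)
    show "a i - b i = m - m' + 2 * of_bool (i \<in> sym_diff S S') + 4 * (c i - c' i - of_bool (i \<in> S' - S))" for i
      unfolding a(2) b(2) by (auto simp: of_bool_def)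
    have eq: "(\<Sum>i\<in>UNIV. a i - b i) - 4 * (m - m') = (sum a UNIV - 4 * m) - (sum b UNIV - 4 * m')"
      by (simp add: sum_subtractf)
    show "8 dvd (\<Sum>i\<in>UNIV. a i - b i) - 4 * (m - m')"
      unfolding eq by (rule dvd_diff[OF a(3) b(3)])
  qed
qed

lemma leech_int_0: "leech_int (\<lambda>_. 0)"
  by (rule leech_intI[of "{}" _ 0 "\<lambda>_. 0"]) (auto simp: empty_in_golay_code)

lemma leech_int_uminus: "leech_int a \<Longrightarrow> leech_int (\<lambda>i. - a i)"
  using leech_int_diff[OF leech_int_0, of a] by simp

lemma leech_int_add: "leech_int a \<Longrightarrow> leech_int b \<Longrightarrow> leech_int (\<lambda>i. a i + b i)"
  using leech_int_diff[OF _ leech_int_uminus, of a b] by simp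

lemma sum_of_bool_mem: "(\<Sum>i\<in>UNIV. of_bool (i \<in> S) :: int) = int (card (S :: 'a::finite set))"
  by (simp add: of_bool_def sum.If_cases)

lemma leech_int_inner:
  assumes "leech_int a" "leech_int b"
  shows "8 dvd (\<Sum>i\<in>UNIV. a i * b i)"
proof -
  obtain m S c where a: "S \<in> golay_code" "\<And>i. a i = m + 2 * of_bool (i \<in> S) + 4 * c i"
    "8 dvd sum a UNIV - 4 * m" using leech_int_decomp[OF assms(1)] by blast
  obtain m' S' c' where b: "S' \<in> golay_code" "\<And>i. b i = m' + 2 * of_bool (i \<in> S') + 4 * c' i"
    "8 dvd sum b UNIV - 4 * m'" using leech_int_decomp[OF assms(2)] by blast
  \<comment> \<open>This is \<open>(m + u) * (m' + u')\<close> with even \<open>u\<close> and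
    \<open>u'\<close>. The parts with \<open>m\<close> and \<open>m'\<close> reduce to the
    coordinate sums, known modulo 8, and \<open>u * u'\<close> is 4 on the intersection of the two
    codewords, up to multiples of 8.\<close>
  have "a i * b i = m' * a i + m * b i - m * m' + 4 * of_bool (i \<in> S \<inter> S')
     + 8 * (of_bool (i \<in> S) * c' i + of_bool (i \<in> S') * c i + 2 * c i * c' i)" for i
    unfolding a(2) b(2) by (simp add: of_bool_def algebra_simps)
  then have "(\<Sum>i\<in>UNIV. a i * b i) = m' * sum a UNIV + m * sum b UNIV - 24 * (m * m')
     + 4 * int (card (S \<inter> S')) + 8 * (\<Sum>i\<in>UNIV. of_bool (i \<in> S) * c' i + of_bool (i \<in> S') * c i + 2 * c i * c' i)"
    by (simp only: sum.distrib sum_subtractf sum_distrib_left[symmetric] sum_of_bool_mem sum_constant)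
      (simp add: card_UNIV_option)
  also have "\<dots> = m' * (sum a UNIV - 4 * m) + m * (sum b UNIV - 4 * m') + 4 * int (card (S \<inter> S'))
     + 8 * ((\<Sum>i\<in>UNIV. of_bool (i \<in> S) * c' i + of_bool (i \<in> S') * c i + 2 * c i * c' i) - 2 * m * m')"
    by (simp add: algebra_simps)
  finally have *: "(\<Sum>i\<in>UNIV. a i * b i) = \<dots>" .
  have "8 dvd 4 * int (card (S \<inter> S'))"
    using golay_code_self_orthogonal[OF a(1) b(1)] by (auto elim!: evenE)
  then show ?thesis
    unfolding * by (intro dvd_add[OF dvd_add[OF dvd_add[OF dvd_mult[OF a(3)] dvd_mult[OF b(3)]]] dvd_triv_left])
qed

section \<open>The minimal norm and inner products of minimal vectors\<close>

lemma sum_squares_ge_card: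
  fixes a :: "'a::finite \<Rightarrow> int"
  assumes "\<And>i. i \<in> S \<Longrightarrow> n \<le> (a i)\<^sup>2"
  shows "int (card S) * n \<le> (\<Sum>i\<in>UNIV. (a i)\<^sup>2)"
proof -
  have "int (card S) * n \<le> (\<Sum>i\<in>S. (a i)\<^sup>2)"
    using sum_mono[of S "\<lambda>_. n" "\<lambda>i. (a i)\<^sup>2"] assms by simp
  also have "\<dots> \<le> (\<Sum>i\<in>UNIV. (a i)\<^sup>2)" by (intro sum_mono2) auto
  finally show ?thesis .
qed

lemma square_ge:
  assumes "k \<le> \<bar>z :: int\<bar>" "0 \<le> k"
  shows "k\<^sup>2 \<le> z\<^sup>2"
  using assms power_mono[of k "\<bar>z\<bar>" 2] by simp

text \<open>If all entries were 1 or -1, their sum would be \<open>24 - 2 * card S\<close> up to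
  sign, a multiple of 8, whereas it is \<open>4 * m\<close> modulo 8 with \<open>m\<close> odd. So
  some entry has absolute value at least 3, and 9 + 23 = 32.\<close>

lemma leech_int_min_odd:
  fixes a c :: "23 option \<Rightarrow> int"
  assumes a: "S \<in> golay_code" "\<And>i. a i = m + 2 * of_bool (i \<in> S) + 4 * c i"
    "8 dvd sum a UNIV - 4 * m" and m: "odd m"
  shows "(\<Sum>i\<in>UNIV. (a i)\<^sup>2) \<ge> 32"
proof -
  have odd: "odd (a i)" for i using m by (simp add: a(2))
  then have ge1: "(a i)\<^sup>2 \<ge> 1" for i
  proof -
    have "a i \<noteq> 0" using odd[of i] by auto
    then show ?thesis using square_ge[of 1 "a i"] by simp
  qed
  have "\<exists>i. \<bar>a i\<bar> \<noteq> 1"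
  proof (rule ccontr)
    assume "\<not> (\<exists>i. \<bar>a i\<bar> \<noteq> 1)"
    then have pm: "a i = 1 \<or> a i = -1" for i by (metis abs_eq_iff abs_minus_cancel abs_one)
    \<comment> \<open>\<open>s\<close> is the sign congruent to \<open>m\<close> modulo 4; entries
      are then \<open>s\<close> off \<open>S\<close> and \<open>- s\<close> on
      \<open>S\<close>.\<close>
    obtain s where s: "s = 1 \<or> s = -1" "4 dvd m - s"
    proof -
      have "4 dvd m - 1 \<or> 4 dvd m - (-1)" using m by presburger
      then show ?thesis using that by blast
    qed
    obtain u where u: "m = s + 4 * u" using s(2) by (metis add.commute diff_add_cancel dvdE)
    have "a i = s - 2 * s * of_bool (i \<in> S)" for i
    proof (cases "i \<in> S")
      case True
      then have "a i = s + 2 + 4 * (u + c i)" using a(2)[of i] u by simp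
      then have "a i = - s" using pm[of i] s(1) by presburger
      with True show ?thesis by simp
    next
      case False
      then have "a i = s + 4 * (u + c i)" using a(2)[of i] u by simp
      then have "a i = s" using pm[of i] s(1) by presburger
      with False show ?thesis by simp
    qed
    then have "sum a UNIV = (\<Sum>i\<in>UNIV. s - 2 * s * of_bool (i \<in> S))" by simp
    also have "\<dots> = 24 * s - 2 * s * int (card S)"
      by (simp only: sum_subtractf sum_distrib_left[symmetric] sum_of_bool_mem) (simp add: card_UNIV_option)
    finally have sum: "sum a UNIV = 24 * s - 2 * s * int (card S)" .
    obtain w where "card S = 4 * w" using golay_code_doubly_even[OF a(1)] by (rule dvdE)
    with sum have "sum a UNIV = 8 * (3 * s - s * int w)" by simp
    with a(3) have "8 dvd 4 * m" by (metis dvd_diff_right_iff dvd_triv_left)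
    with m show False by presburger
  qed
  then obtain j where j: "\<bar>a j\<bar> \<noteq> 1" by blast
  with odd[of j] have "3 \<le> \<bar>a j\<bar>" by presburger
  then have "9 \<le> (a j)\<^sup>2" using square_ge[of 3 "a j"] by simp
  have "(\<Sum>i\<in>UNIV. (a i)\<^sup>2) = (a j)\<^sup>2 + (\<Sum>i\<in>UNIV - {j}. (a i)\<^sup>2)" by (subst sum.remove[of _ j]) auto
  also have "(\<Sum>i\<in>UNIV - {j}. (a i)\<^sup>2) \<ge> (\<Sum>i\<in>UNIV - {j}. 1)" by (intro sum_mono ge1)
  then have "(a j)\<^sup>2 + (\<Sum>i\<in>UNIV - {j}. (a i)\<^sup>2) \<ge> 9 + 23"
    using \<open>9 \<le> (a j)\<^sup>2\<close> by (simp add: card_UNIV_option card_Diff_singleton)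
  finally show ?thesis by simp
qed

text \<open>For even \<open>m\<close> the coordinates not divisible by 4 form a codeword
  \<open>Q\<close>. If it is nonempty, at least eight squares are at least 4. Otherwise the vector
  is \<open>4 * d\<close>, and the sum condition makes the coordinate sum of \<open>d\<close> even.
  Squares have the parity of their roots, so the norm of a nonzero \<open>d\<close> is at least
  2.\<close>

lemma leech_int_min:
  assumes "leech_int a" "a i0 \<noteq> 0"
  shows "(\<Sum>i\<in>UNIV. (a i)\<^sup>2) \<ge> 32"
proof -
  obtain m S c where a: "S \<in> golay_code" "\<And>i. a i = m + 2 * of_bool (i \<in> S) + 4 * c i"
    "8 dvd sum a UNIV - 4 * m" using leech_int_decomp[OF assms(1)] by blast
  show ?thesis
  proof (cases "odd m")
    case True
    with a show ?thesis by (rule leech_int_min_odd)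
  next
    case False
    define Q where "Q = (if 4 dvd m then S else - S)"
    have Q: "Q \<in> golay_code" using a(1) by (simp add: Q_def Compl_in_golay_code)
    have mem: "i \<in> Q \<longleftrightarrow> \<not> 4 dvd a i" for i
    proof -
      have "4 dvd a i \<longleftrightarrow> 4 dvd m + 2 * of_bool (i \<in> S)" unfolding a(2)[of i] by (simp only: dvd_add_left_iff[OF dvd_triv_left])
      moreover have "4 dvd m \<or> 4 dvd m + 2" "\<not> (4 dvd m \<and> 4 dvd m + 2)" using False by presburger+
      ultimately show ?thesis by (auto simp: Q_def of_bool_def)
    qed
    have even: "even (a i)" for i using False by (simp add: a(2))
    show ?thesis
    proof (cases "Q = {}")
      case False
      have "8 \<le> card Q" using golay_code_min_weight[OF Q False] .
      moreover have "4 \<le> (a i)\<^sup>2" if "i \<in> Q" for i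
      proof -
        from that have "2 \<le> \<bar>a i\<bar>" using mem[of i] even[of i] by (cases "a i = 0") (auto elim!: evenE)
        then show ?thesis using square_ge[of 2 "a i"] by simp
      qed
      then have "int (card Q) * 4 \<le> (\<Sum>i\<in>UNIV. (a i)\<^sup>2)" by (rule sum_squares_ge_card)
      ultimately show ?thesis by linarith
    next
      case True
      then have "\<forall>i. \<exists>d. a i = 4 * d" using mem by (auto elim!: dvdE)
      from choice[OF this] obtain d where d: "\<And>i. a i = 4 * d i" by blast
      have "8 dvd 4 * m" using False by (auto elim!: evenE)
      then have "8 dvd sum a UNIV" using a(3) by (metis dvd_diff_left_iff)
      then have ev: "even (sum d UNIV)"
        unfolding d sum_distrib_left[symmetric] by presburger
      have "even ((d i)\<^sup>2 - d i)" for i by auto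
      then have "even (\<Sum>i\<in>UNIV. (d i)\<^sup>2 - d i)" by (intro dvd_sum)
      with ev have ev2: "even (\<Sum>i\<in>UNIV. (d i)\<^sup>2)" by (simp add: sum_subtractf)
      have "0 < (d i0)\<^sup>2" using assms(2) d[of i0] by simp
      also have "(d i0)\<^sup>2 \<le> (\<Sum>i\<in>UNIV. (d i)\<^sup>2)" by (intro member_le_sum) auto
      finally have "2 \<le> (\<Sum>i\<in>UNIV. (d i)\<^sup>2)" using ev2 by presburger
      moreover have "(\<Sum>i\<in>UNIV. (a i)\<^sup>2) = 16 * (\<Sum>i\<in>UNIV. (d i)\<^sup>2)"
        by (simp add: d power_mult_distrib sum_distrib_left)
      ultimately show ?thesis by simp
    qed
  qed
qed

definition leech_min :: "(23 option \<Rightarrow> int) set" where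
  "leech_min = {a. leech_int a \<and> (\<Sum>i\<in>UNIV. (a i)\<^sup>2) = 32}"

text \<open>Sum and difference of \<open>a\<close> and \<open>b\<close> lie in the lattice, so each
  is zero or has square sum at least 32. Divisibility by 8 leaves the listed values.\<close>

lemma leech_min_inner:
  assumes "a \<in> leech_min" "b \<in> leech_min" "a \<noteq> b"
  shows "(\<Sum>i\<in>UNIV. a i * b i) \<in> {-32, -16, -8, 0, 8, 16}"
proof -
  let ?s = "\<Sum>i\<in>UNIV. a i * b i"
  have n: "(\<Sum>i\<in>UNIV. (a i)\<^sup>2) = 32" "(\<Sum>i\<in>UNIV. (b i)\<^sup>2) = 32" "leech_int a" "leech_int b"
    using assms by (auto simp: leech_min_def)
  have "(\<Sum>i\<in>UNIV. (a i - b i)\<^sup>2) = (\<Sum>i\<in>UNIV. (a i)\<^sup>2) + (\<Sum>i\<in>UNIV. (b i)\<^sup>2) - 2 * ?s"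
    by (simp add: power2_diff sum.distrib sum_subtractf sum_distrib_left mult.assoc)
  moreover have "32 \<le> (\<Sum>i\<in>UNIV. (a i - b i)\<^sup>2)"
  proof -
    obtain i where "a i \<noteq> b i" using assms(3) by auto
    then show ?thesis using leech_int_min[OF leech_int_diff[OF n(3,4)], of i] by simp
  qed
  ultimately have le: "?s \<le> 16" using n by simp
  have eq: "(\<Sum>i\<in>UNIV. (a i + b i)\<^sup>2) = (\<Sum>i\<in>UNIV. (a i)\<^sup>2) + (\<Sum>i\<in>UNIV. (b i)\<^sup>2) + 2 * ?s"
    by (simp add: power2_sum sum.distrib sum_distrib_left mult.assoc)
  have "-16 \<le> ?s \<or> ?s = -32"
  proof (cases "\<exists>i. a i + b i \<noteq> 0")
    case True
    then have "32 \<le> (\<Sum>i\<in>UNIV. (a i + b i)\<^sup>2)"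
      using leech_int_min[OF leech_int_add[OF n(3,4)]] by blast
    with eq n show ?thesis by simp
  next
    case False
    then have "(\<Sum>i\<in>UNIV. (a i + b i)\<^sup>2) = 0" by simp
    with eq n show ?thesis by simp
  qed
  moreover obtain k where "?s = 8 * k" using leech_int_inner[OF n(3,4)] by (rule dvdE)
  ultimately show ?thesis using le by (simp, presburger)
qed

lemma leech_min_uminus: "a \<in> leech_min \<Longrightarrow> (\<lambda>i. - a i) \<in> leech_min"
  by (simp add: leech_min_def leech_int_uminus)

lemma finite_leech_min: "finite leech_min"
proof (rule finite_subset)
  show "leech_min \<subseteq> UNIV \<rightarrow>\<^sub>E {-32..32}"
  proof
    fix a assume "a \<in> leech_min"
    then have a: "(\<Sum>i\<in>UNIV. (a i)\<^sup>2) = 32" by (simp add: leech_min_def)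
    have "\<bar>a i\<bar> \<le> 32" for i
    proof -
      have "(a i)\<^sup>2 \<le> 32" unfolding a[symmetric] by (intro member_le_sum) auto
      moreover have "\<bar>a i\<bar> \<le> (a i)\<^sup>2"
        using mult_left_mono[of 1 "\<bar>a i\<bar>" "\<bar>a i\<bar>"] by (cases "a i = 0") (simp_all add: power2_eq_square)
      ultimately show ?thesis by linarith
    qed
    then have "-32 \<le> a i \<and> a i \<le> 32" for i by (simp add: abs_le_iff minus_le_iff)
    then show "a \<in> UNIV \<rightarrow>\<^sub>E {-32..32}" by (simp add: PiE_iff extensional_def)
  qed
qed (auto intro: finite_PiE)

section \<open>The shapes of minimal vectors and their number\<close>

definition type1_vec :: "23 option \<Rightarrow> 23 option \<Rightarrow> 23 option \<Rightarrow> int" where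
  "type1_vec i j k = 4 * of_bool (k \<in> {i}) - 4 * of_bool (k \<in> {j})"

text \<open>Vectors with two entries of absolute value 4 are divided by their signs: opposite signs
  need an ordered pair, as in \<open>type1_vec\<close>, and equal signs an unordered one. This keeps
  both parametrizations injective.\<close>

definition type2_vec :: "23 option set \<Rightarrow> int \<Rightarrow> 23 option \<Rightarrow> int" where
  "type2_vec K s k = 4 * s * of_bool (k \<in> K)"

definition octad_vec :: "23 option set \<Rightarrow> 23 option set \<Rightarrow> 23 option \<Rightarrow> int" where
  "octad_vec Q W k = 2 * of_bool (k \<in> Q) - 4 * of_bool (k \<in> W)"

text \<open>The word \<open>W\<close> negates a vector whose entries -3 and 1 are all 1 modulo 4. So
  \<open>W\<close> can be recovered as the residue class of 3.\<close>

definition odd_vec :: "23 option \<Rightarrow> 23 option set \<Rightarrow> 23 option \<Rightarrow> int" where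
  "odd_vec i W k = (if k \<in> W then -1 else 1) * (if k = i then -3 else 1)"

lemma type1_vec_in_leech_min:
  assumes "i \<noteq> j"
  shows "type1_vec i j \<in> leech_min"
proof -
  have s: "sum (type1_vec i j) UNIV = 0"
    unfolding type1_vec_def sum_subtractf sum_distrib_left[symmetric] sum_of_bool_mem by simp
  have "leech_int (type1_vec i j)"
  proof (rule leech_intI[of "{}" _ 0 "\<lambda>k. of_bool (k \<in> {i}) - of_bool (k \<in> {j})"])
    show "8 dvd sum (type1_vec i j) UNIV - 4 * 0" by (simp add: s)
  qed (auto simp: empty_in_golay_code type1_vec_def)
  moreover have "(type1_vec i j k)\<^sup>2 = 16 * of_bool (k \<in> {i, j})" for k
    using assms by (auto simp: type1_vec_def)
  then have "(\<Sum>k\<in>UNIV. (type1_vec i j k)\<^sup>2) = 32"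
    by (simp only: sum_distrib_left[symmetric] sum_of_bool_mem) (simp add: assms)
  ultimately show ?thesis by (simp add: leech_min_def)
qed

lemma type2_vec_in_leech_min:
  assumes "card K = 2" "s \<in> {1, -1}"
  shows "type2_vec K s \<in> leech_min"
proof -
  have "sum (type2_vec K s) UNIV = 8 * s"
    unfolding type2_vec_def sum_distrib_left[symmetric] sum_of_bool_mem by (simp add: assms(1))
  then have "leech_int (type2_vec K s)"
    by (intro leech_intI[of "{}" _ 0 "\<lambda>k. s * of_bool (k \<in> K)"])
       (auto simp: empty_in_golay_code type2_vec_def)
  moreover have "(type2_vec K s k)\<^sup>2 = 16 * of_bool (k \<in> K)" for k
    using assms(2) by (auto simp: type2_vec_def)
  then have "(\<Sum>k\<in>UNIV. (type2_vec K s k)\<^sup>2) = 32"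
    by (simp only: sum_distrib_left[symmetric] sum_of_bool_mem) (simp add: assms)
  ultimately show ?thesis by (simp add: leech_min_def)
qed

lemma octad_vec_in_leech_min:
  assumes Q: "Q \<in> golay_code" "card Q = 8" and W: "W \<subseteq> Q" "even (card W)"
  shows "octad_vec Q W \<in> leech_min"
proof -
  have "sum (octad_vec Q W) UNIV = 16 - 4 * int (card W)"
    unfolding octad_vec_def sum_subtractf sum_distrib_left[symmetric] sum_of_bool_mem by (simp add: Q(2))
  then have "8 dvd sum (octad_vec Q W) UNIV - 4 * 0" using W(2) by (auto elim!: evenE)
  then have "leech_int (octad_vec Q W)"
    by (intro leech_intI[OF Q(1), of _ 0 "\<lambda>k. - of_bool (k \<in> W)"]) (auto simp: octad_vec_def)
  moreover have "(octad_vec Q W k)\<^sup>2 = 4 * of_bool (k \<in> Q)" for k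
    using W(1) by (auto simp: octad_vec_def)
  then have "(\<Sum>k\<in>UNIV. (octad_vec Q W k)\<^sup>2) = 32"
    by (simp only: sum_distrib_left[symmetric] sum_of_bool_mem) (simp add: Q(2))
  ultimately show ?thesis by (simp add: leech_min_def)
qed

lemma odd_vec_in_leech_min:
  assumes W: "W \<in> golay_code"
  shows "odd_vec i W \<in> leech_min"
proof -
  let ?s = "if i \<in> W then -1 else 1 :: int"
  have eq: "odd_vec i W k = 1 - 2 * of_bool (k \<in> W) - 4 * ?s * of_bool (k \<in> {i})" for k
    by (auto simp: odd_vec_def)
  have sum: "sum (odd_vec i W) UNIV = 24 - 2 * int (card W) - 4 * ?s"
    unfolding eq sum_subtractf sum_distrib_left[symmetric] sum_of_bool_mem by (simp add: card_UNIV_option)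
  obtain w where "card W = 4 * w" using golay_code_doubly_even[OF W] by (rule dvdE)
  with sum have "sum (odd_vec i W) UNIV - 4 * 1 = 8 * (if i \<in> W then 3 - int w else 2 - int w)"
    by simp
  then have "8 dvd sum (odd_vec i W) UNIV - 4 * 1" by (metis dvd_triv_left)
  then have "leech_int (odd_vec i W)"
    by (intro leech_intI[OF W, of _ 1 "\<lambda>k. - of_bool (k \<in> W) - ?s * of_bool (k \<in> {i})"])
       (auto simp: odd_vec_def)
  moreover have "(odd_vec i W k)\<^sup>2 = 1 + 8 * of_bool (k \<in> {i})" for k
    by (auto simp: odd_vec_def)
  then have "(\<Sum>k\<in>UNIV. (odd_vec i W k)\<^sup>2) = 32"
    by (simp only: sum.distrib sum_distrib_left[symmetric] sum_of_bool_mem) (simp add: card_UNIV_option)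
  ultimately show ?thesis by (simp add: leech_min_def)
qed

lemma card_even_subsets_8:
  assumes "card Q = 8"
  shows "card {W. W \<subseteq> Q \<and> even (card W)} = 128"
proof -
  have fin: "finite Q" using assms by (metis card.infinite zero_neq_numeral)
  have "{W. W \<subseteq> Q \<and> even (card W)} = (\<Union>j\<in>{0, 2, 4, 6, 8}. {W. W \<subseteq> Q \<and> card W = j})"
  proof (intro set_eqI iffI)
    fix W assume "W \<in> {W. W \<subseteq> Q \<and> even (card W)}"
    then have W: "W \<subseteq> Q" "even (card W)" by auto
    have "card W \<le> 8" using card_mono[OF fin W(1)] assms by simp
    moreover have "even n \<Longrightarrow> n \<le> 8 \<Longrightarrow> n = 0 \<or> n = 2 \<or> n = 4 \<or> n = 6 \<or> n = 8" for n :: nat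
      by presburger
    ultimately have "card W \<in> {0, 2, 4, 6, 8}" using W(2) by blast
    with W(1) show "W \<in> (\<Union>j\<in>{0, 2, 4, 6, 8}. {W. W \<subseteq> Q \<and> card W = j})" by blast
  qed auto
  also have "card \<dots> = (\<Sum>j\<in>{0, 2, 4, 6, 8}. card {W. W \<subseteq> Q \<and> card W = j})"
    using fin by (intro card_UN_disjoint) auto
  also have "\<dots> = (\<Sum>j\<in>{0, 2, 4, 6, 8::nat}. 8 choose j)"
    by (simp only: n_subsets[OF fin] assms)
  also have "\<dots> = 128" by (simp add: eval_nat_numeral)
  finally show ?thesis .
qed

lemma card_leech_min_ge: "card leech_min \<ge> 196560"
proof -
  \<comment> \<open>The four families contribute \<open>24 * 23\<close>,
    \<open>2 * (24 choose 2)\<close>, at least \<open>759 * 2^7\<close> and at least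
    \<open>24 * 2^12\<close> vectors, in total 196560.\<close>
  define A where "A = (\<lambda>(i, j). type1_vec i j) ` (SIGMA i:UNIV. UNIV - {i})"
  define B where "B = (\<lambda>(K, s). type2_vec K s) ` ({K. K \<subseteq> UNIV \<and> card K = 2} \<times> {1, -1})"
  define C where "C = (\<lambda>(Q, W). octad_vec Q W) ` (SIGMA Q:{Q \<in> golay_code. card Q = 8}. {W. W \<subseteq> Q \<and> even (card W)})"
  define D where "D = (\<lambda>(i, W). odd_vec i W) ` (UNIV \<times> golay_code)"
  have "card A = 552"
  proof -
    have "inj_on (\<lambda>(i, j). type1_vec i j) (SIGMA i:UNIV. UNIV - {i})"
    proof (rule inj_onI)
      fix p p' assume "p \<in> (SIGMA i:UNIV. UNIV - {i})" "p' \<in> (SIGMA i:UNIV. UNIV - {i})"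
        and *: "(\<lambda>(i, j). type1_vec i j) p = (\<lambda>(i, j). type1_vec i j) p'"
      then obtain i j i' j' where p: "p = (i, j)" "j \<noteq> i" "p' = (i', j')" "j' \<noteq> i'" by auto
      with * have "type1_vec i j = type1_vec i' j'" by simp
      then have "type1_vec i j i = type1_vec i' j' i" "type1_vec i j j = type1_vec i' j' j" by simp_all
      with p show "p = p'" by (auto simp: type1_vec_def of_bool_def split: if_splits)
    qed
    then show ?thesis by (simp add: A_def card_image card_UNIV_option card_Diff_singleton)
  qed
  moreover have "card B = 552"
  proof -
    have "inj_on (\<lambda>(K, s). type2_vec K s) ({K. K \<subseteq> UNIV \<and> card K = 2} \<times> {1, -1})"
    proof (rule inj_onI, clarsimp simp del: insert_iff)
      fix K K' s s' assume *: "card K = 2" "card K' = 2" "s \<in> {1, -1 :: int}" "s' \<in> {1, -1 :: int}"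
        and eq: "type2_vec K s = type2_vec K' s'"
      have supp: "{k. type2_vec L t k \<noteq> 0} = L" if "t \<in> {1, -1}" for L t
        using that by (auto simp: type2_vec_def)
      have "K = K'" using supp[OF *(3), of K] supp[OF *(4), of K'] eq by simp
      moreover obtain k where "k \<in> K" using *(1) by (metis card.empty ex_in_conv zero_neq_numeral)
      moreover have "type2_vec K s k = type2_vec K' s' k" using eq by simp
      ultimately show "K = K' \<and> s = s'" by (simp add: type2_vec_def)
    qed
    then have "card B = card ({K :: 23 option set. K \<subseteq> UNIV \<and> card K = 2} \<times> {1, -1 :: int})"
      unfolding B_def by (rule card_image)
    also have "\<dots> = (24 choose 2) * 2"
      unfolding card_cartesian_product n_subsets[OF finite] by (simp add: card_UNIV_option)
    finally show ?thesis by (simp add: choose_two)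
  qed
  moreover have "card C \<ge> 97152"
  proof -
    have "inj_on (\<lambda>(Q, W). octad_vec Q W) (SIGMA Q:{Q \<in> golay_code. card Q = 8}. {W. W \<subseteq> Q \<and> even (card W)})"
    proof (rule inj_onI, clarsimp)
      fix Q W Q' W' assume *: "W \<subseteq> Q" "W' \<subseteq> Q'" and eq: "octad_vec Q W = octad_vec Q' W'"
      have supp: "{k. octad_vec P V k \<noteq> 0} = P" "{k. octad_vec P V k < 0} = V" if "V \<subseteq> P" for P V
        using that by (auto simp: octad_vec_def of_bool_def)
      show "Q = Q' \<and> W = W'"
        using supp[OF *(1)] supp[OF *(2)] eq by simp
    qed
    then have "card C = (\<Sum>Q\<in>{Q \<in> golay_code. card Q = 8}. card {W. W \<subseteq> Q \<and> even (card W)})"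
      unfolding C_def by (subst card_image) auto
    also have "\<dots> = (\<Sum>Q\<in>{Q \<in> golay_code. card Q = 8}. 128)"
      by (intro sum.cong refl card_even_subsets_8) simp
    also have "\<dots> \<ge> 97152" using card_octads_ge by simp
    finally show ?thesis .
  qed
  moreover have "card D \<ge> 98304"
  proof -
    have "inj_on (\<lambda>(i, W). odd_vec i W) (UNIV \<times> golay_code)"
    proof (rule inj_onI, clarsimp)
      fix i i' W W' assume eq: "odd_vec i W = odd_vec i' W'"
      have pos: "{k. \<bar>odd_vec j V k\<bar> = 3} = {j}" "{k. odd_vec j V k mod 4 = 3} = V" for j V
        by (auto simp: odd_vec_def split: if_splits)
      show "i = i' \<and> W = W'"
        using pos[of i W] pos[of i' W'] eq by simp
    qed
    then have "card D = 24 * card golay_code"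
      by (simp add: D_def card_image card_cartesian_product card_UNIV_option)
    with card_golay_code_ge show ?thesis by simp
  qed
  moreover have "card (A \<union> B \<union> C \<union> D) = card A + card B + card C + card D"
  proof -
    \<comment> \<open>The families are told apart by invariants: \<open>A\<close> and
      \<open>B\<close> by the coordinate sum, both from \<open>C\<close> by an entry of absolute
      value 4, and all three from \<open>D\<close> by parity.\<close>
    have fin: "finite A" "finite B" "finite C" "finite D"
      by (auto simp: A_def B_def C_def D_def)
    have sA: "sum a UNIV = 0" if "a \<in> A" for a
      using that by (auto simp: A_def type1_vec_def sum_subtractf simp flip: sum_distrib_left)
    have memA: "\<exists>i j. i \<noteq> j \<and> a = type1_vec i j" if "a \<in> A" for a
    proof -
      from that obtain p where "p \<in> (SIGMA i:UNIV. UNIV - {i})" "a = (\<lambda>(i, j). type1_vec i j) p"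
        unfolding A_def by (elim imageE)
      then show ?thesis by (intro exI[of _ "fst p"] exI[of _ "snd p"]) auto
    qed
    have memB: "\<exists>K s. card K = 2 \<and> s \<in> {1, -1} \<and> a = type2_vec K s" if "a \<in> B" for a
    proof -
      from that obtain p where "p \<in> {K. K \<subseteq> UNIV \<and> card K = 2} \<times> {1, -1}" "a = (\<lambda>(K, s). type2_vec K s) p"
        unfolding B_def by (elim imageE)
      then show ?thesis by (cases p) auto
    qed
    have sB: "sum a UNIV \<noteq> 0" if "a \<in> B" for a
    proof -
      from memB[OF that] obtain K s where K: "card K = 2" "s \<in> {1, -1}" "a = type2_vec K s" by blast
      have "sum a UNIV = 8 * s"
        unfolding K(3) type2_vec_def sum_distrib_left[symmetric] sum_of_bool_mem by (simp add: K(1))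
      with K(2) show ?thesis by auto
    qed
    have eA: "\<exists>k. \<bar>a k\<bar> = 4" if "a \<in> A" for a
    proof -
      from memA[OF that] obtain i j where "i \<noteq> j" "a = type1_vec i j" by blast
      then show ?thesis by (intro exI[of _ i]) (simp add: type1_vec_def)
    qed
    have eB: "\<exists>k. \<bar>a k\<bar> = 4" if "a \<in> B" for a
    proof -
      from memB[OF that] obtain K s where K: "card K = 2" "s \<in> {1, -1}" "a = type2_vec K s" by blast
      then obtain k where "k \<in> K" by (metis card.empty ex_in_conv zero_neq_numeral)
      with K show ?thesis by (intro exI[of _ k]) (auto simp: type2_vec_def)
    qed
    have eC: "\<bar>a k\<bar> \<le> 2 \<and> even (a k)" if "a \<in> C" for a k
      using that by (auto simp: C_def octad_vec_def)
    have eD: "odd (a k)" if "a \<in> D" for a k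
      using that by (auto simp: D_def odd_vec_def split: if_splits)
    have "A \<inter> B = {}" using sA sB by blast
    moreover have "\<nexists>k. \<bar>a k\<bar> = 4" if "a \<in> C" for a
    proof clarify
      fix k assume "\<bar>a k\<bar> = 4"
      with eC[OF that, of k] show False by simp
    qed
    then have "(A \<union> B) \<inter> C = {}" using eA eB by blast
    moreover have "(A \<union> B \<union> C) \<inter> D = {}"
    proof -
      have "\<exists>k. even (a k)" if "a \<in> A \<union> B \<union> C" for a
      proof -
        have "\<exists>k. \<bar>a k\<bar> = 4" if "a \<in> A \<union> B" using that eA eB by blast
        moreover have "even z" if "\<bar>z\<bar> = 4" for z :: int using that by presburger
        ultimately show ?thesis using that eC by blast
      qed
      with eD show ?thesis by blast
    qed
    ultimately show ?thesis using fin by (simp add: card_Un_disjoint)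
  qed
  moreover have "A \<subseteq> leech_min"
    unfolding A_def by (rule image_subsetI, elim SigmaE) (simp add: type1_vec_in_leech_min[OF not_sym])
  then have "A \<union> B \<union> C \<union> D \<subseteq> leech_min"
    by (auto simp: B_def C_def D_def type2_vec_in_leech_min octad_vec_in_leech_min odd_vec_in_leech_min)
  then have "card (A \<union> B \<union> C \<union> D) \<le> card leech_min"
    by (rule card_mono[OF finite_leech_min])
  ultimately show ?thesis by linarith
qed

section \<open>From integer coordinates to unit vectors\<close>

definition leech_vec :: "(23 option \<Rightarrow> int) \<Rightarrow> real ^ 23 option" where
  "leech_vec a = (1 / sqrt 8) *\<^sub>R (\<chi> i. real_of_int (a i))"

lemma leech_lattice_eq: "leech_lattice = leech_vec ` Collect leech_int"
  unfolding leech_lattice_def leech_vec_def leech_int_def by auto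

lemma leech_vec_inner: "leech_vec a \<bullet> leech_vec b = real_of_int (\<Sum>i\<in>UNIV. a i * b i) / 8"
  by (simp add: leech_vec_def inner_vec_def sum_divide_distrib)

lemma leech_vec_norm: "norm (leech_vec a) = sqrt (real_of_int (\<Sum>i\<in>UNIV. (a i)\<^sup>2) / 8)"
  by (simp add: norm_eq_sqrt_inner leech_vec_inner power2_eq_square)

lemma leech_vec_eq_iff: "leech_vec a = leech_vec b \<longleftrightarrow> a = b"
  by (auto simp: leech_vec_def vec_eq_iff fun_eq_iff)

lemma leech_vec_eq_0_iff: "leech_vec a = 0 \<longleftrightarrow> a = (\<lambda>_. 0)"
  by (auto simp: leech_vec_def vec_eq_iff fun_eq_iff)

lemma leech_min_nonempty: "leech_min \<noteq> {}"
  using type1_vec_in_leech_min[of None "Some 0"] by blast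

lemma leech_min_norm:
  assumes "a \<in> leech_min"
  shows "norm (leech_vec a) = 2"
proof -
  have "(\<Sum>i\<in>UNIV. (a i)\<^sup>2) = 32" using assms by (simp add: leech_min_def)
  then have "norm (leech_vec a) = sqrt (real_of_int 32 / 8)" by (simp only: leech_vec_norm)
  then show ?thesis by simp
qed

lemma minimal_vectors_leech: "minimal_vectors leech_lattice = leech_vec ` leech_min"
proof -
  have ge: "2 \<le> norm (leech_vec a)" if a: "leech_int a" "a \<noteq> (\<lambda>_. 0)" for a
  proof -
    obtain i where "a i \<noteq> 0" using a(2) by auto
    with leech_int_min[OF a(1)] have "32 \<le> real_of_int (\<Sum>i\<in>UNIV. (a i)\<^sup>2)"
      by (metis of_int_le_iff of_int_numeral)
    then have "sqrt 4 \<le> norm (leech_vec a)" unfolding leech_vec_norm by (intro real_sqrt_le_mono) simp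
    then show ?thesis by simp
  qed
  obtain b where b: "b \<in> leech_min" using leech_min_nonempty by blast
  have nz: "a \<noteq> (\<lambda>_. 0)" if "a \<in> leech_min" for a using that by (auto simp: leech_min_def)
  show ?thesis
  proof (intro set_eqI iffI)
    fix v assume "v \<in> minimal_vectors leech_lattice"
    then obtain a where a: "v = leech_vec a" "leech_int a" "a \<noteq> (\<lambda>_. 0)"
      and min: "\<And>w. w \<in> leech_lattice - {0} \<Longrightarrow> norm v \<le> norm w"
      by (auto simp: minimal_vectors_def leech_lattice_eq leech_vec_eq_0_iff)
    have "norm v \<le> norm (leech_vec b)"
      using b nz[OF b] by (intro min) (auto simp: leech_lattice_eq leech_vec_eq_0_iff leech_min_def)
    then have "norm (leech_vec a) = 2" using a ge[of a] leech_min_norm[OF b] by simp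
    then have "real_of_int (\<Sum>i\<in>UNIV. (a i)\<^sup>2) / 8 = 4"
      unfolding leech_vec_norm by (metis real_sqrt_eq_iff real_sqrt_four)
    then have "(\<Sum>i\<in>UNIV. (a i)\<^sup>2) = 32" by linarith
    with a show "v \<in> leech_vec ` leech_min" by (auto simp: leech_min_def)
  next
    fix v assume "v \<in> leech_vec ` leech_min"
    then obtain a where a: "v = leech_vec a" "a \<in> leech_min" by auto
    show "v \<in> minimal_vectors leech_lattice"
      unfolding minimal_vectors_def
    proof (intro CollectI conjI ballI)
      show "v \<in> leech_lattice - {0}"
        using a nz by (auto simp: leech_lattice_eq leech_vec_eq_0_iff leech_min_def)
      fix w assume "w \<in> leech_lattice - {0}"
      then show "norm v \<le> norm w"
        using a leech_min_norm ge by (auto simp: leech_lattice_eq leech_vec_eq_0_iff)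
    qed
  qed
qed

lemma leech_code_eq: "leech_code = (\<lambda>a. leech_vec a /\<^sub>R 2) ` leech_min"
  unfolding leech_code_def minimal_vectors_leech image_image
  by (intro image_cong) (auto simp: leech_min_norm)

lemma leech_code_inner:
  assumes "x \<in> leech_code" "y \<in> leech_code" "x \<noteq> y"
  shows "x \<bullet> y \<in> {-1, -1/2, -1/4, 0, 1/4, 1/2}"
proof -
  obtain a b where ab: "a \<in> leech_min" "b \<in> leech_min" "x = leech_vec a /\<^sub>R 2" "y = leech_vec b /\<^sub>R 2"
    using assms(1,2) by (auto simp: leech_code_eq)
  with assms(3) have "a \<noteq> b" by auto
  have "x \<bullet> y = real_of_int (\<Sum>i\<in>UNIV. a i * b i) / 32"
    by (simp only: ab inner_scaleR_left inner_scaleR_right leech_vec_inner) simp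
  with leech_min_inner[OF ab(1,2) \<open>a \<noteq> b\<close>] show ?thesis by (elim insertE emptyE) simp_all
qed

lemma leech_code_uminus:
  assumes "x \<in> leech_code"
  shows "- x \<in> leech_code"
proof -
  obtain a where a: "a \<in> leech_min" "x = leech_vec a /\<^sub>R 2"
    using assms by (auto simp: leech_code_eq)
  have "- x = leech_vec (\<lambda>i. - a i) /\<^sub>R 2" by (simp add: a(2) leech_vec_def vec_eq_iff)
  with leech_min_uminus[OF a(1)] show ?thesis unfolding leech_code_eq by blast
qed

lemma leech_code_spherical: "spherical_code leech_code"
  by (auto simp: spherical_code_def leech_code_eq finite_leech_min leech_min_norm)

lemma card_leech_code_ge: "card leech_code \<ge> 196560"
proof -
  have "inj_on (\<lambda>a. leech_vec a /\<^sub>R 2) leech_min"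
    by (auto simp: inj_on_def leech_vec_eq_iff)
  then show ?thesis unfolding leech_code_eq using card_leech_min_ge by (simp add: card_image)
qed

section \<open>Distance counts in the Leech code\<close>

lemma sum_inner_values:
  fixes C :: "(real ^ 'n) set" and f :: "real \<Rightarrow> real"
  assumes "finite C" "finite V" "\<And>y. y \<in> C \<Longrightarrow> x \<bullet> y \<in> V"
  shows "(\<Sum>y\<in>C. f (x \<bullet> y)) = (\<Sum>t\<in>V. real (distance_count C x t) * f t)"
proof -
  have "(\<Sum>y\<in>C. f (x \<bullet> y)) = (\<Sum>t\<in>V. \<Sum>y\<in>{y \<in> C. x \<bullet> y = t}. f (x \<bullet> y))"
    using assms by (intro sum.group[symmetric]) auto
  also have "\<dots> = (\<Sum>t\<in>V. real (distance_count C x t) * f t)"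
    by (intro sum.cong) (auto simp: distance_count_def)
  finally show ?thesis .
qed

lemma spherical_code_inner_eq_1:
  assumes "spherical_code C" "x \<in> C" "y \<in> C"
  shows "x \<bullet> y = 1 \<longleftrightarrow> x = y"
proof
  show "x \<bullet> y = 1 \<Longrightarrow> x = y" using inner_bounds[OF assms] by force
  show "x = y \<Longrightarrow> x \<bullet> y = 1" using assms norm_eq_1[of x] by (auto simp: spherical_code_def)
qed

lemma distance_count_1:
  assumes "spherical_code C" "x \<in> C"
  shows "distance_count C x 1 = 1"
proof -
  have "{y \<in> C. x \<bullet> y = 1} = {x}"
    using spherical_code_inner_eq_1[OF assms] assms(2) by auto
  then show ?thesis by (simp add: distance_count_def)
qed

lemma leech_code_distance_count_uminus:
  "distance_count leech_code x (- t) = distance_count leech_code x t"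
  unfolding distance_count_def
  by (rule bij_betw_same_card[of uminus], rule bij_betw_byWitness[of _ uminus])
     (auto simp: leech_code_uminus)

text \<open>The polynomial \<open>q\<close> vanishes at all inner products except 1 and -1, so each
  point contributes \<open>q 1 + q (-1) = 45/32\<close>. The constant coefficient of
  \<open>q\<close> is 1/139776, and \<open>139776 * 45/32 = 196560\<close>. With that many points
  the constant term uses up the whole sum, and the other terms, all nonnegative, must
  vanish.\<close>

lemma leech_code_gegen:
  assumes "norm v = 1" "k \<in> {2, 4, 6}"
  shows "(\<Sum>x\<in>leech_code. gegen 24 k (v \<bullet> x)) = 0"
proof -
  let ?X = leech_code
  define N where "N = real (card ?X)"
  have fin: "finite ?X" using leech_code_spherical by (simp add: spherical_code_def)
  define q where "q t = t^2 * (t^2 - 1/16) * (t^2 - 1/4)" for t :: real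
  have q: "q = (\<lambda>t. 1/139776 + ((1/224) * gegen 24 2 t + ((15/4) * gegen 24 4 t + 720 * gegen 24 6 t)))"
    by (rule ext) (simp add: q_def gegen_24 power_numeral_reduce field_simps)
  have "pair_sum q ?X = (\<Sum>x\<in>?X. q 1 + q (-1))"
    unfolding pair_sum_def
  proof (rule sum.cong[OF refl])
    fix x assume x: "x \<in> ?X"
    have "(\<Sum>y\<in>?X. q (x \<bullet> y)) =
        (\<Sum>t\<in>{1, -1, -1/2, -1/4, 0, 1/4, 1/2}. real (distance_count ?X x t) * q t)"
      using leech_code_inner[OF x] spherical_code_inner_eq_1[OF leech_code_spherical x]
      by (intro sum_inner_values fin) auto
    then show "(\<Sum>y\<in>?X. q (x \<bullet> y)) = q 1 + q (-1)"
      using distance_count_1[OF leech_code_spherical x] leech_code_distance_count_uminus[of x 1]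
      by (simp add: q_def power2_eq_square)
  qed
  also have "\<dots> = N * (45/32)" by (simp add: q_def N_def)
  finally have sum: "N * (45/32) = N^2 / 139776 + ((1/224) * pair_sum (gegen 24 2) ?X
      + ((15/4) * pair_sum (gegen 24 4) ?X + 720 * pair_sum (gegen 24 6) ?X))"
    unfolding q pair_sum_add pair_sum_scale pair_sum_const by (simp add: N_def)
  have nonneg: "pair_sum (gegen 24 j) ?X \<ge> 0" for j
    using pair_sum_gegen_nonneg[OF leech_code_spherical, of j] by (simp add: card_UNIV_option)
  have N: "N \<ge> 196560" using card_leech_code_ge by (simp add: N_def)
  then have "N * N \<ge> N * 196560" by (intro mult_left_mono) auto
  then have "N^2 / 139776 \<ge> N * (45/32)" by (simp add: power2_eq_square)
  with sum nonneg[of 2] nonneg[of 4] nonneg[of 6] assms(2) have "pair_sum (gegen 24 k) ?X = 0"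
    by auto
  then show ?thesis
    using gegen_sum_eq_0[of ?X v k] assms(1) leech_code_spherical
    by (simp add: pair_sum_def spherical_code_def card_UNIV_option)
qed

text \<open>The counts at \<open>t\<close> and \<open>-t\<close> agree, and those at 1 and -1 are
  one. The degrees 2, 4, 6 then give three linear equations for the counts at 0, 1/4 and
  1/2.\<close>

lemma leech_code_distance_count:
  assumes x: "x \<in> leech_code"
  shows "distance_count leech_code x (1/4) = 47104"
proof -
  let ?X = leech_code
  have fin: "finite ?X" using leech_code_spherical by (simp add: spherical_code_def)
  have nx: "norm x = 1" using leech_code_spherical x by (auto simp: spherical_code_def)
  have S: "(\<Sum>t\<in>{1, -1, -1/2, -1/4, 0, 1/4, 1/2}. real (distance_count ?X x t) * gegen 24 k t) = 0"
    if k: "k \<in> {2, 4, 6}" for k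
  proof -
    have "(\<Sum>y\<in>?X. gegen 24 k (x \<bullet> y)) =
        (\<Sum>t\<in>{1, -1, -1/2, -1/4, 0, 1/4, 1/2}. real (distance_count ?X x t) * gegen 24 k t)"
      using leech_code_inner[OF x] spherical_code_inner_eq_1[OF leech_code_spherical x]
      by (intro sum_inner_values fin) auto
    with leech_code_gegen[OF nx k] show ?thesis by simp
  qed
  show ?thesis
    using S[of 2] S[of 4] S[of 6]
      distance_count_1[OF leech_code_spherical x] leech_code_distance_count_uminus[of x 1]
      leech_code_distance_count_uminus[of x "1/2"] leech_code_distance_count_uminus[of x "1/4"]
    by (simp add: gegen_24 power_numeral_reduce)
qed

section \<open>Codes with five inner products\<close>

definition nodes :: "real set" where
  "nodes = {-3/5, -1/3, -1/15, 1/5, 7/15}"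

text \<open>The annihilator polynomial of the five inner products has positive Gegenbauer coefficients and
  its linear programming bound is exactly 47104, so that a code of this size is a 5-design.\<close>

lemma node_code_gegen:
  fixes C :: "(real ^ 23) set"
  assumes C: "spherical_code C" "card C = 47104" "inner_products C \<subseteq> nodes"
    and v: "norm v = 1" and k: "k \<in> {1, 2, 3, 4, 5}"
  shows "(\<Sum>x\<in>C. gegen 23 k (v \<bullet> x)) = 0"
proof -
  define g where "g t = (t + 3/5) * (t + 1/3) * (t + 1/15) * (t - 1/5) * (t - 7/15)" for t :: real
  have g: "g = (\<lambda>t. 8/388125 + ((8/16875) * gegen 23 1 t + ((8/675) * gegen 23 2 t
      + ((88/435) * gegen 23 3 t + (8 * gegen 23 4 t + 120 * gegen 23 5 t)))))"
    by (rule ext) (simp add: g_def gegen_1 gegen_23 power_numeral_reduce field_simps)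
  have "energy g C = 0"
    unfolding energy_def
  proof (intro sum.neutral ballI, clarify)
    fix x y assume "x \<in> C" "y \<in> C" "x \<noteq> y"
    then have "x \<bullet> y \<in> nodes" using C(3) by (auto simp: inner_products_def)
    then show "g (x \<bullet> y) = 0" by (auto simp: nodes_def g_def)
  qed
  then have "pair_sum g C = 47104 * g 1"
    by (simp add: energy_eq_pair_sum[OF C(1)] C(2))
  \<comment> \<open>Tightness: \<open>g 1 = 16384/16875\<close> is 47104 times the constant
    coefficient of \<open>g\<close>, so the diagonal is used up by the term of degree 0.\<close>
  also have "\<dots> = 47104\<^sup>2 * (8/388125)" by (simp add: g_def power2_eq_square)
  finally have sum: "(8/16875) * pair_sum (gegen 23 1) C + ((8/675) * pair_sum (gegen 23 2) C
      + ((88/435) * pair_sum (gegen 23 3) C + (8 * pair_sum (gegen 23 4) C + 120 * pair_sum (gegen 23 5) C))) = 0"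
    unfolding g pair_sum_add pair_sum_scale pair_sum_const C(2) by simp
  have nonneg: "pair_sum (gegen 23 j) C \<ge> 0" for j
    using pair_sum_gegen_nonneg[OF C(1), of j] by simp
  have "pair_sum (gegen 23 1) C = 0 \<and> pair_sum (gegen 23 2) C = 0 \<and> pair_sum (gegen 23 3) C = 0 \<and>
      pair_sum (gegen 23 4) C = 0 \<and> pair_sum (gegen 23 5) C = 0"
    using sum nonneg[of 1] nonneg[of 2] nonneg[of 3] nonneg[of 4] nonneg[of 5]
    by (intro conjI) linarith+
  with k have "pair_sum (gegen 23 k) C = 0" by blast
  then show ?thesis
    using gegen_sum_eq_0[of C v k] v C(1) by (simp add: pair_sum_def spherical_code_def)
qed

text \<open>The cardinality and the degrees 1 to 4 give five linear equations for five counts. The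
  system is regular because the nodes are distinct and the polynomials span all degrees up to
  4.\<close>

lemma node_code_distance_count:
  fixes C :: "(real ^ 23) set"
  assumes C: "spherical_code C" "card C = 47104" "inner_products C \<subseteq> nodes" and x: "x \<in> C"
  shows "distance_count C x (-3/5) = 275" "distance_count C x (-1/3) = 7128"
    "distance_count C x (-1/15) = 22275" "distance_count C x (1/5) = 15400"
    "distance_count C x (7/15) = 2025"
proof -
  have fin: "finite C" and nx: "norm x = 1" using C(1) x by (auto simp: spherical_code_def)
  have mem: "x \<bullet> y \<in> insert 1 nodes" if "y \<in> C" for y
    using that C(3) x spherical_code_inner_eq_1[OF C(1) x that] by (auto simp: inner_products_def)
  have S: "(\<Sum>t\<in>insert 1 nodes. real (distance_count C x t) * f t) = (\<Sum>y\<in>C. f (x \<bullet> y))" for f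
    using mem by (intro sum_inner_values[symmetric] fin) (auto simp: nodes_def)
  have 0: "(\<Sum>t\<in>insert 1 nodes. real (distance_count C x t) * gegen 23 k t) = 0"
    if "k \<in> {1, 2, 3, 4, 5}" for k
    unfolding S by (rule node_code_gegen[OF C nx that])
  have eqs: "distance_count C x (-3/5) = 275 \<and> distance_count C x (-1/3) = 7128 \<and>
    distance_count C x (-1/15) = 22275 \<and> distance_count C x (1/5) = 15400 \<and>
    distance_count C x (7/15) = 2025"
    using 0[of 1] 0[of 2] 0[of 3] 0[of 4] S[of "\<lambda>_. 1"] distance_count_1[OF C(1) x] C(2)
    by (simp add: nodes_def gegen_1 gegen_23 power_numeral_reduce)
  then show "distance_count C x (-3/5) = 275" "distance_count C x (-1/3) = 7128"
    "distance_count C x (-1/15) = 22275" "distance_count C x (1/5) = 15400"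
    "distance_count C x (7/15) = 2025" by auto
qed

lemma node_code_energy:
  fixes C :: "(real ^ 23) set"
  assumes C: "spherical_code C" "card C = 47104" "inner_products C \<subseteq> nodes"
  shows "energy h C = 47104 * node_value h"
proof -
  have "pair_sum h C = (\<Sum>x\<in>C. h 1 + node_value h)"
    unfolding pair_sum_def
  proof (rule sum.cong[OF refl])
    fix x assume x: "x \<in> C"
    have "(\<Sum>y\<in>C. h (x \<bullet> y)) = (\<Sum>t\<in>insert 1 nodes. real (distance_count C x t) * h t)"
    proof (rule sum_inner_values)
      fix y assume y: "y \<in> C"
      show "x \<bullet> y \<in> insert 1 nodes"
        using y C(3) x spherical_code_inner_eq_1[OF C(1) x y] by (auto simp: inner_products_def)
    qed (use C(1) in \<open>auto simp: nodes_def spherical_code_def\<close>)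
    then show "(\<Sum>y\<in>C. h (x \<bullet> y)) = h 1 + node_value h"
      using node_code_distance_count[OF C x] distance_count_1[OF C(1) x]
      by (simp add: nodes_def node_value_def)
  qed
  then show ?thesis
    by (simp add: energy_eq_pair_sum[OF C(1)] C(2) algebra_simps)
qed

lemma node_code_avoiding:
  assumes "T \<in> {{-3/5<..<-1/3}, {-1/3<..<-1/15}, {-1/15<..<1/5}, {1/5<..<7/15}}"
    and "inner_products C \<subseteq> nodes"
  shows "avoiding T C"
proof -
  have "nodes \<inter> T = {}" using assms(1) by (elim insertE emptyE) (auto simp: nodes_def)
  with assms(2) show ?thesis by (auto simp: avoiding_def)
qed

section \<open>The code of neighbours at inner product 1/4 in dimension 23\<close>

lemma hyperplane_isometry_inner:
  assumes "hyperplane_isometry x f" "x \<bullet> u = 0" "x \<bullet> v = 0"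
  shows "f u \<bullet> f v = u \<bullet> v"
proof -
  have lin: "linear f" and norm: "\<And>v. x \<bullet> v = 0 \<Longrightarrow> norm (f v) = norm v"
    using assms(1) by (auto simp: hyperplane_isometry_def)
  have "norm (f u + f v) = norm (u + v)"
    using norm[of "u + v"] assms(2,3) by (simp add: linear_add[OF lin] inner_add_right)
  then show ?thesis
    using norm[OF assms(2)] norm[OF assms(3)] by (simp add: dot_norm)
qed

text \<open>Projecting and rescaling sends an inner product \<open>s\<close> to
  \<open>(16 * s - 1) / 15\<close>, which carries -1/2, -1/4, 0, 1/4, 1/2 to the five nodes and 1 to
  itself.\<close>

lemma C_quarter_image:
  assumes x: "x \<in> leech_code" and f: "hyperplane_isometry x f"
  shows "spherical_code (f ` C_quarter x)" "card (f ` C_quarter x) = 47104"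
    "inner_products (f ` C_quarter x) \<subseteq> nodes"
proof -
  let ?Y = "{y \<in> leech_code. x \<bullet> y = 1/4}"
  define p where "p y = (1 / sqrt (15/16)) *\<^sub>R (y - (1/4) *\<^sub>R x)" for y
  have xx: "x \<bullet> x = 1" using spherical_code_inner_eq_1[OF leech_code_spherical x x] by simp
  have C: "f ` C_quarter x = (f \<circ> p) ` ?Y"
    by (auto simp: C_quarter_def p_def)
  have perp: "x \<bullet> p y = 0" if "y \<in> ?Y" for y
    using that by (simp add: p_def inner_diff_right xx)
  have inner: "(f \<circ> p) y \<bullet> (f \<circ> p) z = (16 * (y \<bullet> z) - 1) / 15" if "y \<in> ?Y" "z \<in> ?Y" for y z
  proof -
    have xy: "x \<bullet> y = 1/4" "x \<bullet> z = 1/4" using that by blast+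
    have "(f \<circ> p) y \<bullet> (f \<circ> p) z = p y \<bullet> p z"
      using hyperplane_isometry_inner[OF f perp perp] that by simp
    also have "\<dots> = (1 / sqrt (15/16) * (1 / sqrt (15/16))) * ((y - (1/4) *\<^sub>R x) \<bullet> (z - (1/4) *\<^sub>R x))"
      by (simp only: p_def inner_scaleR_left inner_scaleR_right mult.assoc)
    also have "1 / sqrt (15/16) * (1 / sqrt (15/16)) = (16/15 :: real)"
      by (simp add: real_sqrt_divide)
    also have "(y - (1/4) *\<^sub>R x) \<bullet> (z - (1/4) *\<^sub>R x) = y \<bullet> z - (x \<bullet> z) / 4 - (x \<bullet> y - 1/4) / 4"
      by (simp add: inner_diff_left inner_diff_right xx inner_commute[of y x])
    also have "\<dots> = y \<bullet> z - 1/16" unfolding xy by simp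
    finally show ?thesis by simp
  qed
  have self: "y \<bullet> y = 1" if "y \<in> ?Y" for y
    using that spherical_code_inner_eq_1[OF leech_code_spherical, of y y] by simp
  have inj: "inj_on (f \<circ> p) ?Y"
  proof (rule inj_onI)
    fix y z assume yz: "y \<in> ?Y" "z \<in> ?Y" and "(f \<circ> p) y = (f \<circ> p) z"
    then have "y \<bullet> z = 1" using inner[OF yz] inner[OF yz(1) yz(1)] self[OF yz(1)] by simp
    then show "y = z" using spherical_code_inner_eq_1[OF leech_code_spherical] yz by blast
  qed
  have fin: "finite ?Y" using leech_code_spherical by (simp add: spherical_code_def)
  show "spherical_code (f ` C_quarter x)"
    unfolding C spherical_code_def
  proof (intro conjI subsetI)
    show "finite ((f \<circ> p) ` ?Y)" using fin by simp
    fix w assume "w \<in> (f \<circ> p) ` ?Y"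
    then obtain y where y: "y \<in> ?Y" "w = (f \<circ> p) y" by blast
    have "w \<bullet> w = 1" unfolding y(2) inner[OF y(1) y(1)] self[OF y(1)] by simp
    then show "w \<in> sphere 0 1" by (simp add: norm_eq_1)
  qed
  show "card (f ` C_quarter x) = 47104"
    unfolding C card_image[OF inj] using leech_code_distance_count[OF x] by (simp add: distance_count_def)
  show "inner_products (f ` C_quarter x) \<subseteq> nodes"
  proof
    fix t assume "t \<in> inner_products (f ` C_quarter x)"
    then obtain y z where yz: "y \<in> ?Y" "z \<in> ?Y" "(f \<circ> p) y \<noteq> (f \<circ> p) z" "t = (f \<circ> p) y \<bullet> (f \<circ> p) z"
      unfolding C inner_products_def by blast
    then have ne: "y \<noteq> z" and t: "t = (16 * (y \<bullet> z) - 1) / 15" using inner[of y z] by auto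
    \<comment> \<open>Antipodal \<open>y\<close> and \<open>z\<close> would have opposite inner
      products with \<open>x\<close>, but both are 1/4.\<close>
    have "y \<bullet> z \<noteq> -1"
    proof
      assume "y \<bullet> z = -1"
      then have "y \<bullet> (- z) = 1" by simp
      then have "y = - z"
        using spherical_code_inner_eq_1[OF leech_code_spherical, of y "- z"] yz leech_code_uminus by blast
      with yz show False by simp
    qed
    then have "y \<bullet> z \<in> {-1/2, -1/4, 0, 1/4, 1/2}"
      using leech_code_inner[of y z] yz ne by blast
    then show "t \<in> nodes" unfolding t nodes_def by (elim insertE emptyE) simp_all
  qed
qed

lemma hyperplane_isometry_exists:
  assumes "x \<in> leech_code"
  obtains f where "hyperplane_isometry x f"
proof -
  have "x \<noteq> 0" using assms leech_code_spherical by (auto simp: spherical_code_def)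
  then have "dim {v. x \<bullet> v = 0} = 23" by (simp add: dim_hyperplane card_UNIV_option)
  then have le: "dim {v. x \<bullet> v = 0} \<le> dim (UNIV :: (real ^ 23) set)" by simp
  show thesis
  proof (rule isometry_subset_subspace[OF subspace_hyperplane subspace_UNIV le])
    fix f :: "real ^ 23 option \<Rightarrow> real ^ 23"
    assume "linear f" "\<And>v. v \<in> {v. x \<bullet> v = 0} \<Longrightarrow> norm (f v) = norm v"
    then show thesis by (intro that[of f]) (simp add: hyperplane_isometry_def)
  qed
qed

theorem theorem7p1:
  fixes T :: "real set"
  assumes T: "T \<in> {{-3/5<..<-1/3}, {-1/3<..<-1/15}, {-1/15<..<1/5}, {1/5<..<7/15}}"
  shows
    "(\<forall>h. absolutely_monotone h \<and> (\<forall>t \<in> {-1<..<1}. (deriv ^^ 8) h t > 0) \<longrightarrow>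
       min_energy h TYPE(23) 47104 T =
         47104 * (275 * h (-3/5) + 7128 * h (-1/3) + 22275 * h (-1/15)
                    + 15400 * h (1/5) + 2025 * h (7/15)) \<and>
       (\<exists>C :: (real ^ 23) set. spherical_code C \<and> avoiding T C \<and> card C = 47104 \<and>
          energy h C = min_energy h TYPE(23) 47104 T) \<and>
       (\<forall>C :: (real ^ 23) set. spherical_code C \<and> avoiding T C \<and> card C = 47104 \<longrightarrow>
          energy h C \<ge> min_energy h TYPE(23) 47104 T \<and>
          (spherical_design 7 C \<and> inner_products C = {-3/5, -1/3, -1/15, 1/5, 7/15} \<longrightarrow>
             distance_invariant C \<and>
             has_distance_distribution C [275, 7128, 22275, 15400, 2025] \<and>
             energy h C = min_energy h TYPE(23) 47104 T)))
     \<and> (\<forall>x \<in> leech_code. \<forall>f. hyperplane_isometry x f \<longrightarrow>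
          avoiding_universally_optimal T (f ` C_quarter x))"
proof (intro conjI allI impI ballI)
  fix x f assume x: "x \<in> leech_code" and f: "hyperplane_isometry x f"
  note D = C_quarter_image[OF x f]
  show "avoiding_universally_optimal T (f ` C_quarter x)"
    unfolding avoiding_universally_optimal_def
    using D node_code_avoiding[OF T D(3)] energy_lower_bound_intervals[OF T] node_code_energy[OF D]
    by simp
next
  fix h assume "absolutely_monotone h \<and> (\<forall>t \<in> {-1<..<1}. (deriv ^^ 8) h t > 0)"
  then have h: "absolutely_monotone h" by blast
  \<comment> \<open>One minimal vector with one identification of its hyperplane yields a code
    attaining the bound, so the \<open>LEAST\<close> in \<open>min_energy\<close> is a genuine
    minimum.\<close>
  obtain x where x: "x \<in> leech_code" using leech_min_nonempty by (auto simp: leech_code_eq)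
  obtain f where f: "hyperplane_isometry x f" using hyperplane_isometry_exists[OF x] .
  note D = C_quarter_image[OF x f]
  note avoid = node_code_avoiding[OF T D(3)]
  have min: "min_energy h TYPE(23) 47104 T = 47104 * node_value h"
    unfolding min_energy_def
  proof (rule Least_equality)
    show "\<exists>C :: (real ^ 23) set. spherical_code C \<and> avoiding T C \<and> card C = 47104 \<and> 47104 * node_value h = energy h C"
      using D avoid node_code_energy[OF D, of h] by (intro exI[of _ "f ` C_quarter x"]) simp
  qed (use energy_lower_bound_intervals[OF T h] in auto)
  show "min_energy h TYPE(23) 47104 T =
         47104 * (275 * h (-3/5) + 7128 * h (-1/3) + 22275 * h (-1/15)
                    + 15400 * h (1/5) + 2025 * h (7/15))"
    by (simp only: min node_value_def)
  show "\<exists>C :: (real ^ 23) set. spherical_code C \<and> avoiding T C \<and> card C = 47104 \<and>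
          energy h C = min_energy h TYPE(23) 47104 T"
    using D avoid node_code_energy[OF D, of h] unfolding min by (intro exI[of _ "f ` C_quarter x"]) simp
  fix C :: "(real ^ 23) set"
  assume "spherical_code C \<and> avoiding T C \<and> card C = 47104"
  then have C: "spherical_code C" "card C = 47104" "avoiding T C" by auto
  show "energy h C \<ge> min_energy h TYPE(23) 47104 T"
    unfolding min by (rule energy_lower_bound_intervals[OF T h C])
  assume "spherical_design 7 C \<and> inner_products C = {-3/5, -1/3, -1/15, 1/5, 7/15}"
  then have I: "inner_products C = nodes" by (simp add: nodes_def)
  then have sub: "inner_products C \<subseteq> nodes" by simp
  note count = node_code_distance_count[OF C(1,2) sub]
  show "energy h C = min_energy h TYPE(23) 47104 T"
    unfolding min by (rule node_code_energy[OF C(1,2) sub])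
  show inv: "distance_invariant C"
    unfolding distance_invariant_def I nodes_def by (intro ballI, elim insertE emptyE) (simp_all only: count)
  have "sorted_list_of_set nodes = [-3/5, -1/3, -1/15, 1/5, 7/15]"
  proof -
    have "sorted_list_of_set (set [-3/5, -1/3, -1/15, 1/5, 7/15 :: real]) = [-3/5, -1/3, -1/15, 1/5, 7/15]"
      by (rule sorted_list_of_set.idem_if_sorted_distinct) auto
    then show ?thesis by (simp add: nodes_def)
  qed
  with inv count show "has_distance_distribution C [275, 7128, 22275, 15400, 2025]"
    by (simp add: has_distance_distribution_def I)
qed

end
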